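(* Let $L/K$ be a separable (algebraic) field extension of possibly infinite degree, let $\tilde L = (L_i)_{i\in I}$ be the family of distinct conjugate fields of $L$, let $\Gamma$ be the associated groupoid, let $\beta$ be a family as in the context, let $\Delta$ be a wide subgroupoid of $\Gamma$, and let $(L/K,\beta)$ and $(L/K,\beta_\Delta)$ be the corresponding object crossed products. Suppose that for each $j\in I$, $\Delta(L_j)$ is closed in $\Gamma(L_j)$ with respect to the Krull topology. Then $(L/K,\beta)/(L/K,\beta_\Delta)$ is separable if and only if there exists $i\in I$ such that $[\Gamma(L_i):\Delta(L_i)]<\infty$.
   Context: Rings are associative but not necessarily unital. If $S$ is a subring of $R$, the extension $R/S$ is separable if there is an $R$-bimodule map $\delta: R\to R\otimes_S R$ with $\mu\circ\delta=\mathrm{id}_R$, where $\mu: R\otimes_S R\to R$ is the multiplication map. A groupoid is a small category in which every morphism is an isomorphism; objects are identified with identity morphisms; $d$ and $r$ denote domain and range; $\Gamma(e,f)$ is the set of morphisms $e\to f$; $\Gamma(e):=\Gamma(e,e)$; $\Gamma_2:=\{(\sigma,\tau)\mid d(\sigma)=r(\tau)\}$. A subgroupoid (a subcategory which is a groupoid) is wide if it has the same objects as $\Gamma$. Let $\overline K$ be a fixed algebraic closure of $K$ containing $L$, $N/K$ a normal closure of $L/K$ in $\overline K$, and $G$ the Galois group of $N/K$. Let $\tilde L=(L_i)_{i\in I}$ be the family of distinct conjugate fields of $L$ under the action of $G$. The groupoid $\Gamma$ has object set $\Gamma_0:=\tilde L$ and morphism sets $\Gamma(L_i,L_j):=\{g|_{L_i}\mid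 g\in G,\ g(L_i)=L_j\}$, with composition of maps; it is connected. For $\sigma\in\Gamma$, put $\alpha_\sigma:=\sigma$. For $(\sigma,\tau)\in\Gamma_2$, $\beta_{\sigma,\tau}$ is a chosen nonzero element of the field $r(\sigma)$ such that $\beta_{\sigma,d(\sigma)}=\beta_{r(\sigma),\sigma}=1$ for all $\sigma\in\Gamma$ and $\beta_{\sigma,\tau}\beta_{\sigma\tau,\rho}=\sigma(\beta_{\tau,\rho})\beta_{\sigma,\tau\rho}$ for all $(\sigma,\tau),(\tau,\rho)\in\Gamma_2$. The object crossed product $(L/K,\beta):=\tilde L\rtimes^\alpha_\beta\Gamma$ is the ring of formal sums $\sum_{\sigma\in\Gamma}a_\sigma u_\sigma$ with $a_\sigma$ in the field $r(\sigma)$, almost all zero, where $u_\sigma$ are formal symbols, with componentwise addition and multiplication extending additively $(a u_\sigma)(b u_\tau)=a\,\sigma(b)\,\beta_{\sigma,\tau}u_{\sigma\tau}$ if $(\sigma,\tau)\in\Gamma_2$, and $0$ otherwise. $(L/K,\beta_\Delta)$ is the analogous object crossed product defined by $\Delta$ with the restricted families $\alpha_\Delta=(\alpha_\sigma)_{\sigma\in\Delta}$, $\beta_\Delta=(\beta_{\sigma,\tau})_{(\sigma,\tau)\in\Delta_2}$, i.e. the subring of sums supported on $\Delta$. The Krull topology on $\Gamma(L_j)$, a group of automorphisms of $L_j$, is the group topology in which the pointwise stabilizers of finite subsets of $L_j$ form a neighbourhood basis of the identity. *)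

theory Defs
  imports "HOL-Algebra.Algebra" "HOL-Analysis.Abstract_Topology"
begin

section \<open>Separable extensions of associative, not necessarily unital rings\<close>

text \<open>Such rings are represented by the records of HOL-Algebra; their field \<open>one\<close> is never used.\<close>

locale rng = abelian_group R for R (structure) +
  assumes m_closed: "\<lbrakk>x \<in> carrier R; y \<in> carrier R\<rbrakk> \<Longrightarrow> x \<otimes> y \<in> carrier R"
    and m_assoc: "\<lbrakk>x \<in> carrier R; y \<in> carrier R; z \<in> carrier R\<rbrakk> \<Longrightarrow> (x \<otimes> y) \<otimes> z = x \<otimes> (y \<otimes> z)"
    and l_distr: "\<lbrakk>x \<in> carrier R; y \<in> carrier R; z \<in> carrier R\<rbrakk> \<Longrightarrow> (x \<oplus> y) \<otimes> z = x \<otimes> z \<oplus> y \<otimes> z"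
    and r_distr: "\<lbrakk>x \<in> carrier R; y \<in> carrier R; z \<in> carrier R\<rbrakk> \<Longrightarrow> z \<otimes> (x \<oplus> y) = z \<otimes> x \<oplus> z \<otimes> y"

definition subrng :: "('a, 'c) ring_scheme \<Rightarrow> ('a, 'b) ring_scheme \<Rightarrow> bool" where
  "subrng S R \<longleftrightarrow> rng S \<and> carrier S \<subseteq> carrier R \<and>
     (\<forall>x\<in>carrier S. \<forall>y\<in>carrier S. x \<oplus>\<^bsub>S\<^esub> y = x \<oplus>\<^bsub>R\<^esub> y \<and> x \<otimes>\<^bsub>S\<^esub> y = x \<otimes>\<^bsub>R\<^esub> y)"

text \<open>The tensor product \<open>R \<otimes>\<^sub>S R\<close> is the free abelian group on \<open>R \<times> R\<close> modulo
  the subgroup generated by the relations of additivity in either argument and \<open>S\<close>-balancedness.\<close>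

definition tensor_free :: "('a, 'b) ring_scheme \<Rightarrow> (('a \<times> 'a) \<Rightarrow>\<^sub>0 int) monoid" where
  "tensor_free R = free_Abelian_group (carrier R \<times> carrier R)"

definition tensor_relators ::
  "('a, 'b) ring_scheme \<Rightarrow> ('a, 'c) ring_scheme \<Rightarrow> (('a \<times> 'a) \<Rightarrow>\<^sub>0 int) set" where
  "tensor_relators R S =
     {frag_of (x \<oplus>\<^bsub>R\<^esub> y, z) - frag_of (x, z) - frag_of (y, z) | x y z.
        x \<in> carrier R \<and> y \<in> carrier R \<and> z \<in> carrier R} \<union>
     {frag_of (z, x \<oplus>\<^bsub>R\<^esub> y) - frag_of (z, x) - frag_of (z, y) | x y z.
        x \<in> carrier R \<and> y \<in> carrier R \<and> z \<in> carrier R} \<union>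
     {frag_of (x \<otimes>\<^bsub>R\<^esub> s, y) - frag_of (x, s \<otimes>\<^bsub>R\<^esub> y) | x s y.
        x \<in> carrier R \<and> s \<in> carrier S \<and> y \<in> carrier R}"

definition tensor_null ::
  "('a, 'b) ring_scheme \<Rightarrow> ('a, 'c) ring_scheme \<Rightarrow> (('a \<times> 'a) \<Rightarrow>\<^sub>0 int) set" where
  "tensor_null R S = generate (tensor_free R) (tensor_relators R S)"

definition tensor_product ::
  "('a, 'b) ring_scheme \<Rightarrow> ('a, 'c) ring_scheme \<Rightarrow> (('a \<times> 'a) \<Rightarrow>\<^sub>0 int) set monoid" where
  "tensor_product R S = tensor_free R Mod tensor_null R S"

text \<open>The bimodule operations \<open>a (x \<otimes> y) = a x \<otimes> y\<close> and \<open>(x \<otimes> y) a = x \<otimes> y a\<close>, and the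
  multiplication map \<open>x \<otimes> y \<mapsto> x y\<close>, are induced from the free abelian group: all representatives
  \<open>z\<close> of a class \<open>T\<close> give the same result.\<close>

definition tensor_lmult ::
  "('a, 'b) ring_scheme \<Rightarrow> ('a, 'c) ring_scheme \<Rightarrow> 'a \<Rightarrow>
     (('a \<times> 'a) \<Rightarrow>\<^sub>0 int) set \<Rightarrow> (('a \<times> 'a) \<Rightarrow>\<^sub>0 int) set" where
  "tensor_lmult R S a T =
     (\<Union>z\<in>T. tensor_null R S #>\<^bsub>tensor_free R\<^esub> frag_extend (\<lambda>(x, y). frag_of (a \<otimes>\<^bsub>R\<^esub> x, y)) z)"

definition tensor_rmult ::
  "('a, 'b) ring_scheme \<Rightarrow> ('a, 'c) ring_scheme \<Rightarrow>
     (('a \<times> 'a) \<Rightarrow>\<^sub>0 int) set \<Rightarrow> 'a \<Rightarrow> (('a \<times> 'a) \<Rightarrow>\<^sub>0 int) set" where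
  "tensor_rmult R S T a =
     (\<Union>z\<in>T. tensor_null R S #>\<^bsub>tensor_free R\<^esub> frag_extend (\<lambda>(x, y). frag_of (x, y \<otimes>\<^bsub>R\<^esub> a)) z)"

definition tensor_mu :: "('a, 'b) ring_scheme \<Rightarrow> (('a \<times> 'a) \<Rightarrow>\<^sub>0 int) set \<Rightarrow> 'a" where
  "tensor_mu R T = the_elem
     ((\<lambda>z. \<Oplus>\<^bsub>R\<^esub>p\<in>Poly_Mapping.keys z.
          [Poly_Mapping.lookup z p] \<cdot>\<^bsub>R\<^esub> (fst p \<otimes>\<^bsub>R\<^esub> snd p)) ` T)"

definition separable_rng_extension :: "('a, 'b) ring_scheme \<Rightarrow> ('a, 'c) ring_scheme \<Rightarrow> bool" where
  "separable_rng_extension R S \<longleftrightarrow> rng R \<and> subrng S R \<and>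
     (\<exists>\<delta> \<in> hom (add_monoid R) (tensor_product R S).
        (\<forall>a\<in>carrier R. \<forall>x\<in>carrier R.
           \<delta> (a \<otimes>\<^bsub>R\<^esub> x) = tensor_lmult R S a (\<delta> x) \<and>
           \<delta> (x \<otimes>\<^bsub>R\<^esub> a) = tensor_rmult R S (\<delta> x) a) \<and>
        (\<forall>x\<in>carrier R. tensor_mu R (\<delta> x) = x))"


section \<open>Separable field extensions and normal closures inside an algebraic closure\<close>

context field
begin

text \<open>In what follows \<open>R\<close> is an algebraic closure of \<open>K\<close>, so that the roots of a polynomial
  over \<open>K\<close> may be sought in \<open>R\<close>.\<close>

definition separable_poly :: "'a list \<Rightarrow> bool" where
  "separable_poly p \<longleftrightarrow> p \<noteq> [] \<and> (\<forall>a\<in>carrier R. alg_mult p a \<le> 1)"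

definition separable_field_extension :: "'a set \<Rightarrow> 'a set \<Rightarrow> bool" where
  "separable_field_extension K L \<longleftrightarrow>
     subfield K R \<and> subfield L R \<and> K \<subseteq> L \<and>
     (\<forall>x\<in>L. (algebraic over K) x \<and> separable_poly (Irr K x))"

definition normal_field_extension :: "'a set \<Rightarrow> 'a set \<Rightarrow> bool" where
  "normal_field_extension K M \<longleftrightarrow>
     subfield K R \<and> subfield M R \<and> K \<subseteq> M \<and> (\<forall>x\<in>M. (algebraic over K) x) \<and>
     (\<forall>p\<in>carrier (K[X]). pirreducible K p \<and> (\<exists>a\<in>M. eval p a = \<zero>) \<longrightarrow>
        ring.splitted (R\<lparr>carrier := M\<rparr>) p)"

definition normal_closure :: "'a set \<Rightarrow> 'a set \<Rightarrow> 'a set \<Rightarrow> bool" where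
  "normal_closure K L N \<longleftrightarrow> normal_field_extension K N \<and> L \<subseteq> N \<and>
     (\<forall>M. normal_field_extension K M \<and> L \<subseteq> M \<longrightarrow> N \<subseteq> M)"

definition galois_group :: "'a set \<Rightarrow> 'a set \<Rightarrow> ('a \<Rightarrow> 'a) set" where
  "galois_group K N =
     {g \<in> ring_iso (R\<lparr>carrier := N\<rparr>) (R\<lparr>carrier := N\<rparr>) \<inter> extensional N. \<forall>x\<in>K. g x = x}"

definition conjugate_fields :: "'a set \<Rightarrow> 'a set \<Rightarrow> 'a set \<Rightarrow> 'a set set" where
  "conjugate_fields K L N = {g ` L | g. g \<in> galois_group K N}"

end


section \<open>The groupoid of conjugate fields\<close>

text \<open>A morphism is a pair of its domain (a field) and the underlying map, made extensional on the
  domain; its range is the image of the domain.\<close>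

type_synonym 'a mor = "'a set \<times> ('a \<Rightarrow> 'a)"

abbreviation mor_dom :: "'a mor \<Rightarrow> 'a set" where "mor_dom \<sigma> \<equiv> fst \<sigma>"

abbreviation mor_map :: "'a mor \<Rightarrow> 'a \<Rightarrow> 'a" where "mor_map \<sigma> \<equiv> snd \<sigma>"

definition mor_rng :: "'a mor \<Rightarrow> 'a set" where "mor_rng \<sigma> = mor_map \<sigma> ` mor_dom \<sigma>"

definition mor_id :: "'a set \<Rightarrow> 'a mor" where "mor_id E = (E, \<lambda>x\<in>E. x)"

definition mor_comp :: "'a mor \<Rightarrow> 'a mor \<Rightarrow> 'a mor" where
  "mor_comp \<sigma> \<tau> = (mor_dom \<tau>, compose (mor_dom \<tau>) (mor_map \<sigma>) (mor_map \<tau>))"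

definition (in field) conjugate_homs :: "'a set \<Rightarrow> 'a set \<Rightarrow> 'a set \<Rightarrow> 'a set \<Rightarrow> 'a mor set" where
  "conjugate_homs K N E F = {(E, restrict g E) | g. g \<in> galois_group K N \<and> g ` E = F}"

definition (in field) conjugate_groupoid :: "'a set \<Rightarrow> 'a set \<Rightarrow> 'a set \<Rightarrow> 'a mor set" where
  "conjugate_groupoid K L N =
     (\<Union>E\<in>conjugate_fields K L N. \<Union>F\<in>conjugate_fields K L N. conjugate_homs K N E F)"

definition wide_subgroupoid :: "'a mor set \<Rightarrow> 'a mor set \<Rightarrow> bool" where
  "wide_subgroupoid \<Delta> \<Gamma> \<longleftrightarrow> \<Delta> \<subseteq> \<Gamma> \<and>
     (\<forall>\<sigma>\<in>\<Gamma>. mor_id (mor_dom \<sigma>) \<in> \<Delta> \<and> mor_id (mor_rng \<sigma>) \<in> \<Delta>) \<and>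
     (\<forall>\<sigma>\<in>\<Delta>. \<forall>\<tau>\<in>\<Delta>. mor_dom \<sigma> = mor_rng \<tau> \<longrightarrow> mor_comp \<sigma> \<tau> \<in> \<Delta>) \<and>
     (\<forall>\<sigma>\<in>\<Delta>. \<exists>\<tau>\<in>\<Delta>. mor_dom \<tau> = mor_rng \<sigma> \<and> mor_rng \<tau> = mor_dom \<sigma> \<and>
        mor_comp \<tau> \<sigma> = mor_id (mor_dom \<sigma>) \<and> mor_comp \<sigma> \<tau> = mor_id (mor_rng \<sigma>))"

definition vertex_group :: "'a mor set \<Rightarrow> 'a set \<Rightarrow> 'a mor monoid" where
  "vertex_group \<Gamma> E =
     \<lparr>carrier = {\<sigma> \<in> \<Gamma>. mor_dom \<sigma> = E \<and> mor_rng \<sigma> = E}, monoid.mult = mor_comp, one = mor_id E\<rparr>"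

definition pointwise_stabilizer :: "'a mor set \<Rightarrow> 'a set \<Rightarrow> 'a set \<Rightarrow> 'a mor set" where
  "pointwise_stabilizer \<Gamma> E F = {\<sigma> \<in> carrier (vertex_group \<Gamma> E). \<forall>x\<in>F. mor_map \<sigma> x = x}"

definition krull_open :: "'a mor set \<Rightarrow> 'a set \<Rightarrow> 'a mor set \<Rightarrow> bool" where
  "krull_open \<Gamma> E U \<longleftrightarrow> U \<subseteq> carrier (vertex_group \<Gamma> E) \<and>
     (\<forall>\<sigma>\<in>U. \<exists>F. finite F \<and> F \<subseteq> E \<and> \<sigma> <#\<^bsub>vertex_group \<Gamma> E\<^esub> pointwise_stabilizer \<Gamma> E F \<subseteq> U)"

definition krull_topology :: "'a mor set \<Rightarrow> 'a set \<Rightarrow> 'a mor topology" where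
  "krull_topology \<Gamma> E = topology (krull_open \<Gamma> E)"

lemma istopology_krull_open: "istopology (krull_open \<Gamma> E)"
proof -
  let ?B = "\<lambda>\<sigma> F. \<sigma> <#\<^bsub>vertex_group \<Gamma> E\<^esub> pointwise_stabilizer \<Gamma> E F"
  have mono: "?B \<sigma> F' \<subseteq> ?B \<sigma> F" if "F \<subseteq> F'" for \<sigma> F F'
    using that by (auto simp: l_coset_def pointwise_stabilizer_def)
  show ?thesis
    unfolding istopology_def
  proof (intro conjI allI impI)
    fix U V assume U: "krull_open \<Gamma> E U" and V: "krull_open \<Gamma> E V"
    show "krull_open \<Gamma> E (U \<inter> V)"
      unfolding krull_open_def
    proof (intro conjI ballI)
      show "U \<inter> V \<subseteq> carrier (vertex_group \<Gamma> E)"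
        using U by (auto simp: krull_open_def)
    next
      fix \<sigma> assume \<sigma>: "\<sigma> \<in> U \<inter> V"
      from U \<sigma> obtain F where F: "finite F" "F \<subseteq> E" "?B \<sigma> F \<subseteq> U"
        by (auto simp: krull_open_def)
      from V \<sigma> obtain F' where F': "finite F'" "F' \<subseteq> E" "?B \<sigma> F' \<subseteq> V"
        by (auto simp: krull_open_def)
      have "?B \<sigma> (F \<union> F') \<subseteq> U \<inter> V"
        using mono[of F "F \<union> F'" \<sigma>] mono[of F' "F \<union> F'" \<sigma>] F(3) F'(3)
        by (meson Int_greatest Un_upper1 Un_upper2 subset_trans)
      then show "\<exists>F. finite F \<and> F \<subseteq> E \<and> ?B \<sigma> F \<subseteq> U \<inter> V"
        using F(1,2) F'(1,2) by (intro exI[of _ "F \<union> F'"]) simp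
    qed
  next
    fix \<U> assume \<U>: "\<forall>U\<in>\<U>. krull_open \<Gamma> E U"
    show "krull_open \<Gamma> E (\<Union>\<U>)"
      unfolding krull_open_def
    proof (intro conjI ballI)
      show "\<Union>\<U> \<subseteq> carrier (vertex_group \<Gamma> E)"
        using \<U> by (auto simp: krull_open_def)
    next
      fix \<sigma> assume "\<sigma> \<in> \<Union>\<U>"
      then obtain U where U: "U \<in> \<U>" "\<sigma> \<in> U" by auto
      with \<U> have "krull_open \<Gamma> E U" by simp
      with U(2) obtain F where F: "finite F" "F \<subseteq> E" "?B \<sigma> F \<subseteq> U"
        by (auto simp: krull_open_def)
      then have "?B \<sigma> F \<subseteq> \<Union>\<U>" using U(1) by (meson Union_upper subset_trans)
      then show "\<exists>F. finite F \<and> F \<subseteq> E \<and> ?B \<sigma> F \<subseteq> \<Union>\<U>"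
        using F(1,2) by (intro exI[of _ F]) simp
    qed
  qed
qed

lemma openin_krull_topology: "openin (krull_topology \<Gamma> E) U \<longleftrightarrow> krull_open \<Gamma> E U"
  unfolding krull_topology_def by (simp add: topology_inverse'[OF istopology_krull_open])


section \<open>Object crossed products\<close>

context field
begin

definition normalized_cocycle :: "'a mor set \<Rightarrow> ('a mor \<Rightarrow> 'a mor \<Rightarrow> 'a) \<Rightarrow> bool" where
  "normalized_cocycle \<Gamma> \<beta> \<longleftrightarrow>
     (\<forall>\<sigma>\<in>\<Gamma>. \<forall>\<tau>\<in>\<Gamma>. mor_dom \<sigma> = mor_rng \<tau> \<longrightarrow> \<beta> \<sigma> \<tau> \<in> mor_rng \<sigma> - {\<zero>}) \<and>
     (\<forall>\<sigma>\<in>\<Gamma>. \<beta> \<sigma> (mor_id (mor_dom \<sigma>)) = \<one> \<and> \<beta> (mor_id (mor_rng \<sigma>)) \<sigma> = \<one>) \<and>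
     (\<forall>\<sigma>\<in>\<Gamma>. \<forall>\<tau>\<in>\<Gamma>. \<forall>\<rho>\<in>\<Gamma>. mor_dom \<sigma> = mor_rng \<tau> \<and> mor_dom \<tau> = mor_rng \<rho> \<longrightarrow>
        \<beta> \<sigma> \<tau> \<otimes> \<beta> (mor_comp \<sigma> \<tau>) \<rho> = mor_map \<sigma> (\<beta> \<tau> \<rho>) \<otimes> \<beta> \<sigma> (mor_comp \<tau> \<rho>))"

text \<open>A formal sum \<open>\<Sum> a\<^sub>\<sigma> u\<^sub>\<sigma>\<close> is the finitely supported function \<open>\<sigma> \<mapsto> a\<^sub>\<sigma>\<close>. Only the values
  \<open>\<beta> \<sigma> \<tau>\<close> for composable \<open>\<sigma>\<close>, \<open>\<tau>\<close> in \<open>\<Gamma>\<close> enter, so for a subgroupoid no restriction of \<open>\<beta>\<close>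
  is needed. The ring need not be unital, hence the field \<open>one\<close> carries no information.\<close>

definition object_crossed_product ::
  "'a mor set \<Rightarrow> ('a mor \<Rightarrow> 'a mor \<Rightarrow> 'a) \<Rightarrow> ('a mor \<Rightarrow> 'a) ring" where
  "object_crossed_product \<Gamma> \<beta> =
     \<lparr>carrier = {f. (\<forall>\<sigma>\<in>\<Gamma>. f \<sigma> \<in> mor_rng \<sigma>) \<and> (\<forall>\<sigma>. \<sigma> \<notin> \<Gamma> \<longrightarrow> f \<sigma> = \<zero>) \<and> finite {\<sigma>. f \<sigma> \<noteq> \<zero>}},
      monoid.mult = (\<lambda>f g r. finsum R (\<lambda>(s, t). f s \<otimes> mor_map s (g t) \<otimes> \<beta> s t)
        {(s, t). f s \<noteq> \<zero> \<and> g t \<noteq> \<zero> \<and> mor_dom s = mor_rng t \<and> mor_comp s t = r}),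
      monoid.one = undefined,
      ring.zero = (\<lambda>_. \<zero>),
      ring.add = (\<lambda>f g \<sigma>. f \<sigma> \<oplus> g \<sigma>)\<rparr>"

end

end

theory Submission
  imports Defs
begin

text \<open>Write \<open>R\<close> and \<open>S\<close> for the crossed products over \<open>\<Gamma>\<close> and \<open>\<Delta>\<close>.

  If \<open>\<delta>\<close> splits the multiplication map, then \<open>w = \<delta> (u\<^sub>E)\<close> commutes with every \<open>u\<^sub>\<tau>\<close>, \<open>\<tau> \<in> \<Gamma>(E)\<close>.
  As \<open>R\<close> is the direct sum over the cosets \<open>\<gamma>\<Delta>\<close> of right \<open>S\<close>-modules, \<open>w\<close> has a component at each
  coset, and left translation by \<open>\<tau>\<close> permutes the nonzero components. Only finitely many
  components are nonzero, and one is because the multiplication map sends \<open>w\<close> to \<open>u\<^sub>E\<close>; so some coset \<open>\<gamma>\<Delta>\<close>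
  has a finite \<open>\<Gamma>(E)\<close>-orbit, which means that \<open>\<Delta>\<close> has finite index at the domain of \<open>\<gamma>\<close>.

  Conversely, a closed subgroup \<open>\<Delta>(F)\<close> of finite index is open, hence contains the pointwise
  stabilizer of a finite \<open>B \<subseteq> F\<close>. Elements of \<open>F\<close> are algebraic, so there are only finitely many
  restrictions to \<open>B\<close> of morphisms \<open>\<gamma> : F \<rightarrow> E\<close>; pick a representative \<open>\<gamma>\<close> for each. By the independence of
  characters there is \<open>x \<in> F\<close>, with \<open>\<gamma> x\<close> depending only on the restriction of \<open>\<gamma>\<close> to \<open>B\<close>, such that
  \<open>\<Sum> \<gamma> x = 1\<close>. The elements \<open>w\<^sub>E = \<Sum> (\<gamma> x) u\<^sub>\<gamma> \<otimes> u\<^sub>\<gamma>\<^sup>-\<^sup>1\<close> then satisfy \<open>u\<^sub>\<tau> w\<^sub>E = w\<^sub>E\<^sub>' u\<^sub>\<tau>\<close> for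
  \<open>\<tau> : E \<rightarrow> E'\<close>, and right multiplication by them is the required splitting.\<close>

text \<open>The rings have no unit once there are infinitely many conjugate fields, so
  \<open>\<delta>\<close> is not governed by one element: there is an element
  \<open>w\<^sub>E\<close> for every object, and those for different objects are tied together by
  the morphisms between them. The tensor product is never decomposed. A component at a coset is
  detected by projecting the left factor to it and then multiplying, which gives a value in the ring
  itself; this is well defined because right multiplication by \<Delta> preserves the coset.
  Separability yields some coset \<open>\<gamma>\<Delta>\<close> without control over the domain of
  \<gamma>, hence an existential condition on the object. In the converse, averaging over cosets
  would divide by their number, which may vanish in the field; the element x of trace one replaces
  the average. The sum runs over restrictions to B, which may be finer than the cosets of \<Delta>,
  because distinct restrictions are visibly distinct characters and left translation permutes
  them.\<close>

lemma keys_diff_subset: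
  "\<lbrakk>Poly_Mapping.keys z \<subseteq> B; Poly_Mapping.keys w \<subseteq> B\<rbrakk> \<Longrightarrow> Poly_Mapping.keys (z - w) \<subseteq> B"
  for z w :: "'i \<Rightarrow>\<^sub>0 int"
  using keys_diff[of z w] by blast

section \<open>Evaluating formal sums in an abelian group\<close>

context abelian_group
begin

text \<open>The homomorphism from the free abelian group that extends \<open>h\<close>, in the very
  form in which \<open>tensor_mu\<close> is written, so that both unfold to the same sum.\<close>

definition frag_eval :: "('i \<Rightarrow> 'a) \<Rightarrow> ('i \<Rightarrow>\<^sub>0 int) \<Rightarrow> 'a" where
  "frag_eval h z = (\<Oplus>p\<in>Poly_Mapping.keys z. add_pow G (Poly_Mapping.lookup z p) (h p))"

text \<open>Keys can cancel when formal sums are added, so two evaluations are only comparable over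
  a common index set; the additional terms have coefficient 0.\<close>

lemma frag_eval_superset:
  assumes "finite B" "Poly_Mapping.keys z \<subseteq> B" "\<And>p. p \<in> B \<Longrightarrow> h p \<in> carrier G"
  shows "frag_eval h z = (\<Oplus>p\<in>B. add_pow G (Poly_Mapping.lookup z p) (h p))"
  unfolding frag_eval_def
proof (rule add.finprod_mono_neutral_cong_left)
  show "add_pow G (Poly_Mapping.lookup z i) (h i) = \<zero>" if "i \<in> B - Poly_Mapping.keys z" for i
    using that by (auto simp: in_keys_iff add_pow_def)
qed (use assms in auto)

lemma frag_eval_closed:
  assumes "Poly_Mapping.keys z \<subseteq> B" "h \<in> B \<rightarrow> carrier G"
  shows "frag_eval h z \<in> carrier G"
  unfolding frag_eval_def using assms by (intro finsum_closed) (auto intro!: add.int_pow_closed)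

lemma frag_eval_zero [simp]: "frag_eval h 0 = \<zero>"
  by (simp add: frag_eval_def)

lemma frag_eval_frag_of [simp]: "h p \<in> carrier G \<Longrightarrow> frag_eval h (frag_of p) = h p"
  by (simp add: frag_eval_def)

lemma frag_eval_cong:
  assumes "Poly_Mapping.keys z \<subseteq> B" "h \<in> B \<rightarrow> carrier G" "\<And>p. p \<in> Poly_Mapping.keys z \<Longrightarrow> g p = h p"
  shows "frag_eval g z = frag_eval h z"
  unfolding frag_eval_def
  by (rule finsum_cong') (use assms in \<open>auto intro!: add.int_pow_closed\<close>)

lemma frag_eval_add:
  assumes "Poly_Mapping.keys z \<subseteq> B" "Poly_Mapping.keys w \<subseteq> B" "h \<in> B \<rightarrow> carrier G"
  shows "frag_eval h (z + w) = frag_eval h z \<oplus> frag_eval h w"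
proof -
  let ?C = "Poly_Mapping.keys z \<union> Poly_Mapping.keys w"
  have c: "h p \<in> carrier G" if "p \<in> ?C" for p
    using that assms by blast
  have "frag_eval h (z + w) = (\<Oplus>p\<in>?C. add_pow G (Poly_Mapping.lookup (z + w) p) (h p))"
    using c by (intro frag_eval_superset keys_add) auto
  also have "\<dots> = (\<Oplus>p\<in>?C. add_pow G (Poly_Mapping.lookup z p) (h p) \<oplus> add_pow G (Poly_Mapping.lookup w p) (h p))"
    using c by (intro add.finprod_cong') (auto simp: lookup_add add.int_pow_mult intro!: add.int_pow_closed)
  also have "\<dots> = (\<Oplus>p\<in>?C. add_pow G (Poly_Mapping.lookup z p) (h p)) \<oplus> (\<Oplus>p\<in>?C. add_pow G (Poly_Mapping.lookup w p) (h p))"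
    using c by (intro finsum_addf) (auto intro!: add.int_pow_closed)
  also have "\<dots> = frag_eval h z \<oplus> frag_eval h w"
    using c by (subst (1 2) frag_eval_superset[of ?C]) auto
  finally show ?thesis .
qed

lemma frag_eval_diff:
  assumes "Poly_Mapping.keys z \<subseteq> B" "Poly_Mapping.keys w \<subseteq> B" "h \<in> B \<rightarrow> carrier G"
  shows "frag_eval h (z - w) = frag_eval h z \<ominus> frag_eval h w"
proof -
  have k: "Poly_Mapping.keys (z - w) \<subseteq> B"
    using keys_diff[of z w] assms by blast
  have "frag_eval h z = frag_eval h (z - w) \<oplus> frag_eval h w"
    using frag_eval_add[OF k assms(2,3)] by simp
  then show ?thesis
    using frag_eval_closed[OF k assms(3)] frag_eval_closed[OF assms(2,3)]
    by (simp add: a_minus_def a_assoc r_neg)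
qed

lemma frag_eval_sum:
  assumes "finite I" "\<And>i. i \<in> I \<Longrightarrow> Poly_Mapping.keys (z i) \<subseteq> B" "h \<in> B \<rightarrow> carrier G"
  shows "frag_eval h (\<Sum>i\<in>I. z i) = (\<Oplus>i\<in>I. frag_eval h (z i))"
  using assms(1,2)
proof (induction I)
  case (insert i I)
  have "Poly_Mapping.keys (\<Sum>i\<in>I. z i) \<subseteq> B"
    using keys_sum[of z I] insert.prems by fastforce
  with insert show ?case
    using assms(3) frag_eval_closed[OF _ assms(3)]
    by (simp add: frag_eval_add[of _ B])
qed simp

text \<open>Two homomorphisms on a free group agree if they agree on generators. The map
  \<open>\<phi>\<close> is only asked to respect differences, as the induction principle for free
  abelian groups is built on differences.\<close>

lemma frag_eval_hom_eqI:
  assumes "Poly_Mapping.keys z \<subseteq> B" "h \<in> C \<rightarrow> carrier G" "\<And>p. p \<in> B \<Longrightarrow> Poly_Mapping.keys (f p) \<subseteq> C"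
    and "h' \<in> B \<rightarrow> carrier G"
    and "\<phi> \<in> carrier G \<rightarrow> carrier G" "\<And>x y. \<lbrakk>x \<in> carrier G; y \<in> carrier G\<rbrakk> \<Longrightarrow> \<phi> (x \<ominus> y) = \<phi> x \<ominus> \<phi> y"
    and "\<And>p. p \<in> B \<Longrightarrow> frag_eval h (f p) = \<phi> (h' p)"
  shows "frag_eval h (frag_extend f z) = \<phi> (frag_eval h' z)"
proof -
  have k: "Poly_Mapping.keys (frag_extend f w) \<subseteq> C" if "Poly_Mapping.keys w \<subseteq> B" for w
    using keys_frag_extend[of f w] that assms(3) by blast
  have z: "\<phi> \<zero> = \<zero>"
    using assms(6)[of \<zero> \<zero>] assms(5) by (auto simp: a_minus_def Pi_iff r_neg)
  show ?thesis
    using assms(1)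
  proof (induction z rule: free_Abelian_group_induct[consumes 1, case_names zero diff frag])
    case (diff x y)
    then show ?case
      using k frag_eval_closed[OF _ assms(4)] assms(2,4,6)
      by (simp add: frag_extend_diff frag_eval_diff[of _ C] frag_eval_diff[of _ B])
  next
    case (frag a)
    then show ?case using assms(4,7) by (auto simp: Pi_iff)
  qed (simp add: z)
qed

lemma sum_minus_both: "\<lbrakk>x \<in> carrier G; y \<in> carrier G\<rbrakk> \<Longrightarrow> x \<oplus> y \<ominus> x \<ominus> y = \<zero>"
  by (simp add: a_minus_def a_comm[of x y] a_assoc r_neg)

end

section \<open>The tensor product\<close>

context rng
begin

lemma zero_mult [simp]: assumes "x \<in> carrier R" shows "\<zero> \<otimes> x = \<zero>"
proof -
  have "\<zero> \<otimes> x \<oplus> \<zero> \<otimes> x = \<zero> \<otimes> x"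
    using l_distr[of \<zero> \<zero> x] assms by simp
  then show ?thesis
    using assms add.l_cancel_one[of "\<zero> \<otimes> x" "\<zero> \<otimes> x"] by (simp add: m_closed)
qed

lemma mult_zero [simp]: assumes "x \<in> carrier R" shows "x \<otimes> \<zero> = \<zero>"
proof -
  have "x \<otimes> \<zero> \<oplus> x \<otimes> \<zero> = x \<otimes> \<zero>"
    using r_distr[of \<zero> \<zero> x] assms by simp
  then show ?thesis
    using assms add.l_cancel_one[of "x \<otimes> \<zero>" "x \<otimes> \<zero>"] by (simp add: m_closed)
qed

lemma mult_minus: assumes "x \<in> carrier R" "y \<in> carrier R" shows "x \<otimes> (\<ominus> y) = \<ominus> (x \<otimes> y)"
  using r_distr[of "\<ominus> y" y x] assms
  by (intro minus_equality[symmetric]) (simp_all add: m_closed l_neg)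

lemma minus_mult: assumes "x \<in> carrier R" "y \<in> carrier R" shows "(\<ominus> x) \<otimes> y = \<ominus> (x \<otimes> y)"
  using l_distr[of "\<ominus> x" x y] assms
  by (intro minus_equality[symmetric]) (simp_all add: m_closed l_neg)

lemma mult_diff:
  assumes "x \<in> carrier R" "y \<in> carrier R" "z \<in> carrier R"
  shows "x \<otimes> (y \<ominus> z) = x \<otimes> y \<ominus> x \<otimes> z" "(y \<ominus> z) \<otimes> x = y \<otimes> x \<ominus> z \<otimes> x"
  using assms by (simp_all add: a_minus_def r_distr l_distr mult_minus minus_mult)

end

section \<open>Congruence modulo the tensor relations\<close>

locale rng_tensor = rng R for R :: "('a, 'b) ring_scheme" (structure) and S :: "('a, 'c) ring_scheme" +
  assumes S_subset: "carrier S \<subseteq> carrier R"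
begin

abbreviation pairs where "pairs \<equiv> carrier R \<times> carrier R"
abbreviation null where "null \<equiv> tensor_null R S"

text \<open>Equality in the tensor product, stated for representatives: sums of elementary tensors
  are computed in the free group, and classes enter only through \<open>tclass\<close>.\<close>

definition teq (infix "\<approx>\<^sub>T" 50) where "z \<approx>\<^sub>T w \<longleftrightarrow> z - w \<in> null"

lemma carrier_tensor_free: "z \<in> carrier (tensor_free R) \<longleftrightarrow> Poly_Mapping.keys z \<subseteq> pairs"
  by (simp add: tensor_free_def)

lemma S_closed: "s \<in> carrier S \<Longrightarrow> s \<in> carrier R"
  using S_subset by blast

lemma relator_cases [consumes 1, case_names left right balanced]:
  assumes "r \<in> tensor_relators R S"
  obtains x y z where "x \<in> carrier R" "y \<in> carrier R" "z \<in> carrier R"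
      "r = frag_of (x \<oplus> y, z) - frag_of (x, z) - frag_of (y, z)"
    | x y z where "x \<in> carrier R" "y \<in> carrier R" "z \<in> carrier R"
      "r = frag_of (z, x \<oplus> y) - frag_of (z, x) - frag_of (z, y)"
    | x s y where "x \<in> carrier R" "s \<in> carrier S" "y \<in> carrier R"
      "r = frag_of (x \<otimes> s, y) - frag_of (x, s \<otimes> y)"
  using assms unfolding tensor_relators_def
  by (elim UnE CollectE exE conjE) (rule that; assumption)+

lemma keys_relator: "r \<in> tensor_relators R S \<Longrightarrow> Poly_Mapping.keys r \<subseteq> pairs"
  by (cases rule: relator_cases, assumption) (use S_subset in \<open>auto simp: m_closed dest!: subsetD[OF keys_diff]\<close>)

lemma relators_subset: "tensor_relators R S \<subseteq> carrier (tensor_free R)"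
  using keys_relator carrier_tensor_free by blast

lemma group_tensor_free: "group (tensor_free R)"
  by (simp add: tensor_free_def)

lemma subgroup_null: "subgroup null (tensor_free R)"
  unfolding tensor_null_def
  by (rule group.generate_is_subgroup[OF group_tensor_free relators_subset])

lemma normal_null: "null \<lhd> tensor_free R"
  by (metis abelian_free_Abelian_group comm_group.normal_iff_subgroup subgroup_null tensor_free_def)

lemma keys_null: "z \<in> null \<Longrightarrow> Poly_Mapping.keys z \<subseteq> pairs"
  using subgroup.mem_carrier[OF subgroup_null] carrier_tensor_free by blast

lemma null_zero: "0 \<in> null"
  using subgroup.one_closed[OF subgroup_null] by (simp add: tensor_free_def)

lemma null_add: "\<lbrakk>z \<in> null; w \<in> null\<rbrakk> \<Longrightarrow> z + w \<in> null"
  using subgroup.m_closed[OF subgroup_null] by (simp add: tensor_free_def)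

lemma null_uminus: "z \<in> null \<Longrightarrow> - z \<in> null"
  using subgroup.m_inv_closed[OF subgroup_null, of z] keys_null[of z] by (simp add: tensor_free_def)

lemma null_diff: "\<lbrakk>z \<in> null; w \<in> null\<rbrakk> \<Longrightarrow> z - w \<in> null"
  using null_add[OF _ null_uminus, of z w] by simp

lemma relator_null: "r \<in> tensor_relators R S \<Longrightarrow> r \<in> null"
  unfolding tensor_null_def by (rule generate.incl)

text \<open>Closure under differences covers both remaining group operations, by -x = 0 - x and x +
  y = x - (-y).\<close>

lemma null_induct [consumes 1, case_names zero relator diff]:
  assumes "z \<in> null" and "P 0" and r: "\<And>r. r \<in> tensor_relators R S \<Longrightarrow> P r"
    and d: "\<And>x y. \<lbrakk>x \<in> null; y \<in> null; P x; P y\<rbrakk> \<Longrightarrow> P (x - y)"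
  shows "P z"
proof -
  have minus: "P (- x)" if "x \<in> null" "P x" for x
    using d[OF null_zero that(1) assms(2) that(2)] by simp
  have "z \<in> generate (tensor_free R) (tensor_relators R S)"
    using assms(1) by (simp add: tensor_null_def)
  then show ?thesis
  proof (induction rule: generate.induct)
    case one
    then show ?case using assms(2) by (simp add: tensor_free_def)
  next
    case (incl h)
    then show ?case by (rule r)
  next
    case (inv h)
    then show ?case
      using minus[OF relator_null r] keys_relator[of h] by (simp add: tensor_free_def)
  next
    case (eng x y)
    then have "x \<in> null" "y \<in> null" by (simp_all add: tensor_null_def)
    then show ?case
      using d[OF _ null_uminus, of x y] minus[of y] eng by (simp add: tensor_free_def)
  qed
qed

lemma teq_refl [simp, intro]: "z \<approx>\<^sub>T z" by (simp add: teq_def null_zero)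
lemma teq_sym: "z \<approx>\<^sub>T w \<Longrightarrow> w \<approx>\<^sub>T z" using null_uminus[of "z - w"] by (simp add: teq_def)
lemma teq_trans [trans]: "\<lbrakk>z \<approx>\<^sub>T w; w \<approx>\<^sub>T v\<rbrakk> \<Longrightarrow> z \<approx>\<^sub>T v"
  using null_add[of "z - w" "w - v"] by (simp add: teq_def)
lemma teq_add: "\<lbrakk>z \<approx>\<^sub>T w; z' \<approx>\<^sub>T w'\<rbrakk> \<Longrightarrow> z + z' \<approx>\<^sub>T w + w'"
  using null_add[of "z - w" "z' - w'"] by (simp add: teq_def algebra_simps)
lemma teq_sum: "(\<And>i. i \<in> I \<Longrightarrow> z i \<approx>\<^sub>T w i) \<Longrightarrow> (\<Sum>i\<in>I. z i) \<approx>\<^sub>T (\<Sum>i\<in>I. w i)"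
  by (induction I rule: infinite_finite_induct) (auto intro: teq_add)

lemma teq_left_add:
  "\<lbrakk>x \<in> carrier R; y \<in> carrier R; z \<in> carrier R\<rbrakk> \<Longrightarrow>
     frag_of (x \<oplus> y, z) \<approx>\<^sub>T frag_of (x, z) + frag_of (y, z)"
  unfolding teq_def diff_diff_eq[symmetric]
  by (rule relator_null) (auto simp: tensor_relators_def)

lemma teq_right_add:
  "\<lbrakk>x \<in> carrier R; y \<in> carrier R; z \<in> carrier R\<rbrakk> \<Longrightarrow>
     frag_of (z, x \<oplus> y) \<approx>\<^sub>T frag_of (z, x) + frag_of (z, y)"
  unfolding teq_def diff_diff_eq[symmetric]
  by (rule relator_null) (auto simp: tensor_relators_def)

lemma teq_balanced:
  "\<lbrakk>x \<in> carrier R; s \<in> carrier S; y \<in> carrier R\<rbrakk> \<Longrightarrow> frag_of (x \<otimes> s, y) \<approx>\<^sub>T frag_of (x, s \<otimes> y)"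
  unfolding teq_def by (rule relator_null) (auto simp: tensor_relators_def)

lemma teq_left_zero: assumes "z \<in> carrier R" shows "frag_of (\<zero>, z) \<approx>\<^sub>T 0"
proof -
  have "frag_of (\<zero>, z) \<approx>\<^sub>T frag_of (\<zero>, z) + frag_of (\<zero>, z)"
    using teq_left_add[of \<zero> \<zero> z] assms by simp
  then show ?thesis
    using null_uminus by (fastforce simp: teq_def)
qed

lemma teq_right_zero: assumes "z \<in> carrier R" shows "frag_of (z, \<zero>) \<approx>\<^sub>T 0"
proof -
  have "frag_of (z, \<zero>) \<approx>\<^sub>T frag_of (z, \<zero>) + frag_of (z, \<zero>)"
    using teq_right_add[of \<zero> \<zero> z] assms by simp
  then show ?thesis
    using null_uminus by (fastforce simp: teq_def)
qed

abbreviation tclass where "tclass z \<equiv> null #>\<^bsub>tensor_free R\<^esub> z"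

lemma tclass_eq: "tclass z = {n + z | n. n \<in> null}"
  by (auto simp: r_coset_def tensor_free_def)

lemma tclass_eq_iff: "tclass z = tclass w \<longleftrightarrow> z \<approx>\<^sub>T w"
proof
  assume "tclass z = tclass w"
  then have "z \<in> tclass w"
    using null_zero by (force simp: tclass_eq)
  then show "z \<approx>\<^sub>T w" by (auto simp: tclass_eq teq_def)
next
  have *: "tclass z \<subseteq> tclass w" if "z \<approx>\<^sub>T w" for z w
  proof
    fix v assume "v \<in> tclass z"
    then obtain n where "n \<in> null" "v = n + z" by (auto simp: tclass_eq)
    then show "v \<in> tclass w"
      using null_add[of n "z - w"] that unfolding tclass_eq teq_def
      by (intro CollectI exI[of _ "n + (z - w)"]) auto
  qed
  assume "z \<approx>\<^sub>T w"
  then show "tclass z = tclass w" using * teq_sym by blast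
qed

lemma tensor_product_cases:
  assumes "T \<in> carrier (tensor_product R S)"
  obtains z where "Poly_Mapping.keys z \<subseteq> pairs" "T = tclass z"
  using assms by (auto simp: tensor_product_def FactGroup_def RCOSETS_def carrier_tensor_free)

lemma tclass_closed: "Poly_Mapping.keys z \<subseteq> pairs \<Longrightarrow> tclass z \<in> carrier (tensor_product R S)"
  by (auto simp: tensor_product_def FactGroup_def RCOSETS_def carrier_tensor_free)

lemma tclass_mult:
  assumes "Poly_Mapping.keys z \<subseteq> pairs" "Poly_Mapping.keys w \<subseteq> pairs"
  shows "tclass z \<otimes>\<^bsub>tensor_product R S\<^esub> tclass w = tclass (z + w)"
  using normal.rcos_sum[OF normal_null, of z w] assms
  by (simp add: tensor_product_def FactGroup_def carrier_tensor_free) (simp add: tensor_free_def)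

section \<open>The bimodule structure and the multiplication map on representatives\<close>

definition lmul where "lmul a = frag_extend (\<lambda>(x, y). frag_of (a \<otimes> x, y))"
definition rmul where "rmul a = frag_extend (\<lambda>(x, y). frag_of (x, y \<otimes> a))"

lemma lmul_simps [simp]:
  "lmul a 0 = 0" "lmul a (frag_of (x, y)) = frag_of (a \<otimes> x, y)"
  "lmul a (z + w) = lmul a z + lmul a w" "lmul a (z - w) = lmul a z - lmul a w"
  by (simp_all add: lmul_def frag_extend_add frag_extend_diff)

lemma rmul_simps [simp]:
  "rmul a 0 = 0" "rmul a (frag_of (x, y)) = frag_of (x, y \<otimes> a)"
  "rmul a (z + w) = rmul a z + rmul a w" "rmul a (z - w) = rmul a z - rmul a w"
  by (simp_all add: rmul_def frag_extend_add frag_extend_diff)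

lemma lmul_sum [simp]: "lmul a (\<Sum>i\<in>I. z i) = (\<Sum>i\<in>I. lmul a (z i))"
  by (induction I rule: infinite_finite_induct) auto

lemma rmul_sum [simp]: "rmul a (\<Sum>i\<in>I. z i) = (\<Sum>i\<in>I. rmul a (z i))"
  by (induction I rule: infinite_finite_induct) auto

lemma keys_rmul: "\<lbrakk>a \<in> carrier R; Poly_Mapping.keys z \<subseteq> pairs\<rbrakk> \<Longrightarrow> Poly_Mapping.keys (rmul a z) \<subseteq> pairs"
  using keys_frag_extend[of "\<lambda>(x, y). frag_of (x, y \<otimes> a)" z] m_closed by (fastforce simp: rmul_def)

text \<open>Relators go to relators of the same kind, by distributivity for the additive ones and
  associativity for the balanced ones. This makes the left action well defined on classes.\<close>

lemma lmul_null: assumes "a \<in> carrier R" "z \<in> null" shows "lmul a z \<in> null"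
  using assms(2)
proof (induction rule: null_induct)
  case (relator r)
  then show ?case
  proof (cases rule: relator_cases)
    case (left x y z)
    then show ?thesis
      using teq_left_add[of "a \<otimes> x" "a \<otimes> y" z] assms(1)
      by (simp add: r_distr m_closed teq_def diff_diff_eq)
  next
    case (right x y z)
    then show ?thesis
      using teq_right_add[of x y "a \<otimes> z"] assms(1) by (simp add: m_closed teq_def diff_diff_eq)
  next
    case (balanced x s y)
    then show ?thesis
      using teq_balanced[of "a \<otimes> x" s y] assms(1) by (simp add: S_closed m_closed m_assoc teq_def)
  qed
qed (auto simp: null_zero null_diff)

lemma rmul_null: assumes "a \<in> carrier R" "z \<in> null" shows "rmul a z \<in> null"
  using assms(2)
proof (induction rule: null_induct)
  case (relator r)
  then show ?case
  proof (cases rule: relator_cases)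
    case (left x y z)
    then show ?thesis
      using teq_left_add[of x y "z \<otimes> a"] assms(1) by (simp add: m_closed teq_def diff_diff_eq)
  next
    case (right x y z)
    then show ?thesis
      using teq_right_add[of "x \<otimes> a" "y \<otimes> a" z] assms(1)
      by (simp add: l_distr m_closed teq_def diff_diff_eq)
  next
    case (balanced x s y)
    then show ?thesis
      using teq_balanced[of x s "y \<otimes> a"] assms(1) by (simp add: S_closed m_closed m_assoc teq_def)
  qed
qed (auto simp: null_zero null_diff)

lemma lmul_teq: "\<lbrakk>a \<in> carrier R; z \<approx>\<^sub>T w\<rbrakk> \<Longrightarrow> lmul a z \<approx>\<^sub>T lmul a w"
  unfolding teq_def using lmul_null[of a "z - w"] by simp

lemma rmul_teq: "\<lbrakk>a \<in> carrier R; z \<approx>\<^sub>T w\<rbrakk> \<Longrightarrow> rmul a z \<approx>\<^sub>T rmul a w"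
  unfolding teq_def using rmul_null[of a "z - w"] by simp

text \<open>\<open>tensor_lmult\<close> and \<open>tensor_rmult\<close> are unions over all
  representatives of a class; when the operation respects the congruence, all members of the union
  are one and the same class.\<close>

lemma Union_tclass:
  assumes "\<And>w. w \<approx>\<^sub>T z \<Longrightarrow> f w \<approx>\<^sub>T f z"
  shows "(\<Union>w\<in>tclass z. tclass (f w)) = tclass (f z)"
proof -
  have "tclass (f w) = tclass (f z)" if "w \<in> tclass z" for w
  proof -
    have "w \<approx>\<^sub>T z" using that by (auto simp: tclass_eq teq_def)
    then show ?thesis by (simp add: assms tclass_eq_iff)
  qed
  moreover have "z \<in> tclass z"
    using null_zero by (force simp: tclass_eq)
  ultimately show ?thesis by blast
qed

lemma tensor_lmult_tclass:
  "a \<in> carrier R \<Longrightarrow> tensor_lmult R S a (tclass z) = tclass (lmul a z)"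
  using Union_tclass[of z "lmul a"] lmul_teq by (simp add: tensor_lmult_def lmul_def)

lemma tensor_rmult_tclass:
  "a \<in> carrier R \<Longrightarrow> tensor_rmult R S (tclass z) a = tclass (rmul a z)"
  using Union_tclass[of z "rmul a"] rmul_teq by (simp add: tensor_rmult_def rmul_def)

text \<open>The universal property of the tensor product: a biadditive balanced map kills the three
  kinds of relators. Values in the ring itself suffice, because every map to be tested projects the
  left factor and then multiplies.\<close>

lemma frag_eval_null:
  assumes h: "h \<in> pairs \<rightarrow> carrier R"
    and l: "\<And>x y z. \<lbrakk>x \<in> carrier R; y \<in> carrier R; z \<in> carrier R\<rbrakk> \<Longrightarrow> h (x \<oplus> y, z) = h (x, z) \<oplus> h (y, z)"
    and r: "\<And>x y z. \<lbrakk>x \<in> carrier R; y \<in> carrier R; z \<in> carrier R\<rbrakk> \<Longrightarrow> h (z, x \<oplus> y) = h (z, x) \<oplus> h (z, y)"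
    and b: "\<And>x s y. \<lbrakk>x \<in> carrier R; s \<in> carrier S; y \<in> carrier R\<rbrakk> \<Longrightarrow> h (x \<otimes> s, y) = h (x, s \<otimes> y)"
    and "z \<in> null"
  shows "frag_eval h z = \<zero>"
  using assms(5)
proof (induction rule: null_induct)
  case (relator q)
  have hc: "h (x, y) \<in> carrier R" if "x \<in> carrier R" "y \<in> carrier R" for x y
    using that h by auto
  from relator show ?case
  proof (cases rule: relator_cases)
    case (left x y z)
    then have "frag_eval h q = h (x \<oplus> y, z) \<ominus> h (x, z) \<ominus> h (y, z)"
      using hc h by (simp add: frag_eval_diff[of _ pairs] keys_diff_subset)
    then show ?thesis
      using left hc l[of x y z] by (simp add: sum_minus_both)
  next
    case (right x y z)
    then have "frag_eval h q = h (z, x \<oplus> y) \<ominus> h (z, x) \<ominus> h (z, y)"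
      using hc h by (simp add: frag_eval_diff[of _ pairs] keys_diff_subset)
    then show ?thesis
      using right hc r[of x y z] by (simp add: sum_minus_both)
  next
    case (balanced x s y)
    then show ?thesis
      using hc h b[of x s y] by (simp add: S_closed frag_eval_diff[of _ pairs] m_closed a_minus_def r_neg)
  qed
next
  case (diff x y)
  then show ?case
    using keys_null[of x] keys_null[of y] h by (simp add: frag_eval_diff[of _ pairs] a_minus_def)
qed simp

lemma frag_eval_teq:
  assumes "h \<in> pairs \<rightarrow> carrier R"
    and "\<And>x y z. \<lbrakk>x \<in> carrier R; y \<in> carrier R; z \<in> carrier R\<rbrakk> \<Longrightarrow> h (x \<oplus> y, z) = h (x, z) \<oplus> h (y, z)"
    and "\<And>x y z. \<lbrakk>x \<in> carrier R; y \<in> carrier R; z \<in> carrier R\<rbrakk> \<Longrightarrow> h (z, x \<oplus> y) = h (z, x) \<oplus> h (z, y)"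
    and "\<And>x s y. \<lbrakk>x \<in> carrier R; s \<in> carrier S; y \<in> carrier R\<rbrakk> \<Longrightarrow> h (x \<otimes> s, y) = h (x, s \<otimes> y)"
    and "z \<approx>\<^sub>T w" "Poly_Mapping.keys w \<subseteq> pairs"
  shows "frag_eval h z = frag_eval h w"
proof -
  have n: "z - w \<in> null" using assms(5) by (simp add: teq_def)
  have "frag_eval h (z - w + w) = frag_eval h (z - w) \<oplus> frag_eval h w"
    by (rule frag_eval_add[OF keys_null[OF n] assms(6,1)])
  moreover have "frag_eval h (z - w) = \<zero>"
    by (rule frag_eval_null[OF assms(1-4) n])
  moreover have "frag_eval h w \<in> carrier R"
    by (rule frag_eval_closed[OF assms(6,1)])
  ultimately show ?thesis by simp
qed

text \<open>Multiplication is biadditive and, by associativity, balanced; so its values on a class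
  form a singleton and \<open>the_elem\<close> is meaningful.\<close>

lemma tensor_mu_tclass:
  assumes "Poly_Mapping.keys z \<subseteq> pairs"
  shows "tensor_mu R (tclass z) = frag_eval (\<lambda>p. fst p \<otimes> snd p) z"
proof -
  have "frag_eval (\<lambda>p. fst p \<otimes> snd p) w = frag_eval (\<lambda>p. fst p \<otimes> snd p) z" if "w \<in> tclass z" for w
  proof (rule frag_eval_teq[OF _ _ _ _ _ assms])
    show "w \<approx>\<^sub>T z" using that by (auto simp: tclass_eq teq_def)
  qed (use S_subset in \<open>auto simp: l_distr r_distr m_assoc m_closed subset_iff\<close>)
  moreover have "z \<in> tclass z"
    using null_zero by (force simp: tclass_eq)
  ultimately have "frag_eval (\<lambda>p. fst p \<otimes> snd p) ` tclass z = {frag_eval (\<lambda>p. fst p \<otimes> snd p) z}"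
    by blast
  then show ?thesis
    unfolding tensor_mu_def by (simp add: frag_eval_def[abs_def])
qed

text \<open>The separability element is the formal sum of all \<open>p v i \<otimes> q v i\<close>; it is infinite as soon
  as there are infinitely many \<open>v\<close>, but every \<open>x\<close> annihilates almost all of its summands.\<close>

lemma separable_criterion:
  fixes I :: "'v \<Rightarrow> 'i set" and p q :: "'v \<Rightarrow> 'i \<Rightarrow> 'a" and V :: "'a \<Rightarrow> 'v set"
  assumes sub: "subrng S R"
    and I: "\<And>v. finite (I v)"
    and p: "\<And>v i. i \<in> I v \<Longrightarrow> p v i \<in> carrier R"
    and q: "\<And>v i. i \<in> I v \<Longrightarrow> q v i \<in> carrier R"
    and V: "\<And>x. x \<in> carrier R \<Longrightarrow> finite (V x)"
      "\<And>x v i. \<lbrakk>x \<in> carrier R; v \<notin> V x; i \<in> I v\<rbrakk> \<Longrightarrow> x \<otimes> p v i = \<zero>"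
    and H: "H \<subseteq> carrier R"
    and gen: "\<And>P x. \<lbrakk>x \<in> carrier R; P \<zero>; \<And>a. a \<in> H \<Longrightarrow> P a;
        \<And>x y. \<lbrakk>x \<in> carrier R; y \<in> carrier R; P x; P y\<rbrakk> \<Longrightarrow> P (x \<oplus> y)\<rbrakk> \<Longrightarrow> P x"
    and step: "\<And>a. a \<in> H \<Longrightarrow> \<exists>v w. (\<forall>u. u \<noteq> v \<longrightarrow> (\<forall>i\<in>I u. a \<otimes> p u i = \<zero>)) \<and>
        (\<forall>u. u \<noteq> w \<longrightarrow> (\<forall>i\<in>I u. q u i \<otimes> a = \<zero>)) \<and>
        (\<Sum>i\<in>I v. frag_of (a \<otimes> p v i, q v i)) \<approx>\<^sub>T (\<Sum>i\<in>I w. frag_of (p w i, q w i \<otimes> a)) \<and>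
        (\<Oplus>i\<in>I v. (a \<otimes> p v i) \<otimes> q v i) = a"
  shows "separable_rng_extension R S"
proof -
  \<comment> \<open>The truncation to the indices in \<open>U\<close> of x times the infinite
    separability element. All finite \<open>U\<close> containing \<open>V x\<close> give the same
    class.\<close>
  define D where "D U x = (\<Sum>v\<in>U. \<Sum>i\<in>I v. frag_of (x \<otimes> p v i, q v i))" for U x
  have keys_sum_pairs: "Poly_Mapping.keys (\<Sum>j\<in>J. z j) \<subseteq> pairs"
    if "\<And>j. j \<in> J \<Longrightarrow> Poly_Mapping.keys (z j) \<subseteq> pairs" for J :: "'j set" and z
    using keys_sum[of z J] that by blast
  have Dk: "Poly_Mapping.keys (D U x) \<subseteq> pairs" if "x \<in> carrier R" for U x
    unfolding D_def using that p q by (intro keys_sum_pairs) (auto simp: m_closed)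
  have D_restrict: "D W x \<approx>\<^sub>T D U x"
    if "x \<in> carrier R" "finite W" "U \<subseteq> W" "\<And>v i. \<lbrakk>v \<in> W - U; i \<in> I v\<rbrakk> \<Longrightarrow> x \<otimes> p v i = \<zero>" for W U x
  proof -
    have "D (W - U) x \<approx>\<^sub>T (\<Sum>v\<in>W - U. \<Sum>i\<in>I v. 0)"
      unfolding D_def by (intro teq_sum) (use that(4) q teq_left_zero in auto)
    then have "D (W - U) x + D U x \<approx>\<^sub>T 0 + D U x"
      by (intro teq_add) auto
    then show ?thesis
      using sum.subset_diff[OF that(3,2), of "\<lambda>v. \<Sum>i\<in>I v. frag_of (x \<otimes> p v i, q v i)"]
      by (simp add: D_def)
  qed
  have D_V: "D W x \<approx>\<^sub>T D (V x) x" if "x \<in> carrier R" "finite W" "V x \<subseteq> W" for W x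
    using that V(2) by (intro D_restrict) auto
  have D_add: "D W (x \<oplus> y) \<approx>\<^sub>T D W x + D W y" if "x \<in> carrier R" "y \<in> carrier R" for W x y
  proof -
    have "D W (x \<oplus> y) \<approx>\<^sub>T (\<Sum>v\<in>W. \<Sum>i\<in>I v. frag_of (x \<otimes> p v i, q v i) + frag_of (y \<otimes> p v i, q v i))"
      unfolding D_def using that p q teq_left_add by (intro teq_sum) (auto simp: l_distr m_closed)
    then show ?thesis by (simp add: D_def sum.distrib)
  qed
  have lmul_D: "lmul a (D W x) = D W (a \<otimes> x)" if "a \<in> carrier R" "x \<in> carrier R" for a x W
    unfolding D_def using that p by (simp add: m_assoc cong: sum.cong)
  have rmul_D: "rmul a (D W x) = (\<Sum>v\<in>W. \<Sum>i\<in>I v. frag_of (x \<otimes> p v i, q v i \<otimes> a))" for a x W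
    by (simp add: D_def)
  define \<delta> where "\<delta> x = tclass (D (V x) x)" for x
  have \<delta>_add: "D (V (x \<oplus> y)) (x \<oplus> y) \<approx>\<^sub>T D (V x) x + D (V y) y"
    if xy: "x \<in> carrier R" "y \<in> carrier R" for x y
  proof -
    \<comment> \<open>\<open>V (x \<oplus> y)\<close> bears no relation to \<open>V x\<close> and
      \<open>V y\<close>, so all truncations are first moved to one finite index set.\<close>
    let ?W = "V x \<union> V y \<union> V (x \<oplus> y)"
    have "D (V (x \<oplus> y)) (x \<oplus> y) \<approx>\<^sub>T D ?W (x \<oplus> y)"
      using xy V(1) by (intro teq_sym[OF D_V]) auto
    also have "\<dots> \<approx>\<^sub>T D ?W x + D ?W y" by (rule D_add[OF xy])
    also have "\<dots> \<approx>\<^sub>T D (V x) x + D (V y) y"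
      using xy V(1) by (intro teq_add D_V) auto
    finally show ?thesis .
  qed
  have left: "\<delta> (a \<otimes> x) = tensor_lmult R S a (\<delta> x)" if ax: "a \<in> carrier R" "x \<in> carrier R" for a x
  proof -
    let ?W = "V x \<union> V (a \<otimes> x)"
    have "D (V (a \<otimes> x)) (a \<otimes> x) \<approx>\<^sub>T D ?W (a \<otimes> x)"
      using ax V(1) by (intro teq_sym[OF D_V]) (auto simp: m_closed)
    also have "\<dots> = lmul a (D ?W x)" by (simp add: lmul_D ax)
    also have "\<dots> \<approx>\<^sub>T lmul a (D (V x) x)"
      using ax V(1) by (intro lmul_teq D_V) (auto simp: m_closed)
    finally show ?thesis
      by (simp add: \<delta>_def tensor_lmult_tclass ax tclass_eq_iff)
  qed
  \<comment> \<open>Right linearity is additive in \<open>a\<close>, so \<open>gen\<close> reduces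
    it to generators, and for these \<open>step\<close> exchanges the summands at \<open>v\<close>
    and at \<open>w\<close>.\<close>
  have right': "\<forall>x\<in>carrier R. D (V (x \<otimes> a)) (x \<otimes> a) \<approx>\<^sub>T rmul a (D (V x) x)" if "a \<in> carrier R" for a
    using that
  proof (rule gen)
    show "\<forall>x\<in>carrier R. D (V (x \<otimes> \<zero>)) (x \<otimes> \<zero>) \<approx>\<^sub>T rmul \<zero> (D (V x) x)"
    proof
      fix x assume x: "x \<in> carrier R"
      have "rmul \<zero> (D (V x) x) \<approx>\<^sub>T (\<Sum>v\<in>V x. \<Sum>i\<in>I v. 0)"
        unfolding rmul_D using x p q by (intro teq_sum) (auto simp: m_closed intro!: teq_right_zero)
      moreover have "D (V (x \<otimes> \<zero>)) (x \<otimes> \<zero>) \<approx>\<^sub>T D {} \<zero>"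
        using x p V(1) by simp (intro D_restrict, auto)
      ultimately show "D (V (x \<otimes> \<zero>)) (x \<otimes> \<zero>) \<approx>\<^sub>T rmul \<zero> (D (V x) x)"
        using teq_trans[OF _ teq_sym, of _ 0] by (simp add: D_def)
    qed
  next
    fix a assume a: "a \<in> H"
    then have aR: "a \<in> carrier R" using H by blast
    obtain v w where v: "\<And>u i. \<lbrakk>u \<noteq> v; i \<in> I u\<rbrakk> \<Longrightarrow> a \<otimes> p u i = \<zero>"
      and w: "\<And>u i. \<lbrakk>u \<noteq> w; i \<in> I u\<rbrakk> \<Longrightarrow> q u i \<otimes> a = \<zero>"
      and vw: "(\<Sum>i\<in>I v. frag_of (a \<otimes> p v i, q v i)) \<approx>\<^sub>T (\<Sum>i\<in>I w. frag_of (p w i, q w i \<otimes> a))"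
      using step[OF a] by blast
    show "\<forall>x\<in>carrier R. D (V (x \<otimes> a)) (x \<otimes> a) \<approx>\<^sub>T rmul a (D (V x) x)"
    proof
      fix x assume x: "x \<in> carrier R"
      \<comment> \<open>Left multiplication by \<open>a\<close> sees only the summands at
        \<open>v\<close>, right multiplication only those at \<open>w\<close>; both indices are
        inserted because they need not belong to the truncations at hand.\<close>
      let ?W = "insert v (V (x \<otimes> a))" and ?U = "insert w (V x)"
      have "D (V (x \<otimes> a)) (x \<otimes> a) \<approx>\<^sub>T D ?W (x \<otimes> a)"
        using x aR V(1) by (intro teq_sym[OF D_V]) (auto simp: m_closed)
      also have "\<dots> \<approx>\<^sub>T D {v} (x \<otimes> a)"
        using x aR V(1) v p by (intro D_restrict) (auto simp: m_closed m_assoc)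
      also have "\<dots> = lmul x (\<Sum>i\<in>I v. frag_of (a \<otimes> p v i, q v i))"
        using x aR p by (simp add: D_def m_assoc cong: sum.cong)
      also have "\<dots> \<approx>\<^sub>T lmul x (\<Sum>i\<in>I w. frag_of (p w i, q w i \<otimes> a))"
        by (rule lmul_teq[OF x vw])
      also have "\<dots> = rmul a (D {w} x)"
        by (simp add: D_def)
      also have "\<dots> = 0 + rmul a (D {w} x)" by simp
      \<comment> \<open>The summands away from \<open>w\<close> are annihilated by \<open>a\<close>
        on the right and may be put back to recover the full truncation.\<close>
      also have "\<dots> \<approx>\<^sub>T rmul a (D (?U - {w}) x) + rmul a (D {w} x)"
      proof (intro teq_add teq_sym[of _ 0])
        have "rmul a (D (?U - {w}) x) \<approx>\<^sub>T (\<Sum>v\<in>?U - {w}. \<Sum>i\<in>I v. 0)"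
          unfolding rmul_D using x p w by (intro teq_sum) (auto simp: m_closed intro!: teq_right_zero)
        then show "rmul a (D (?U - {w}) x) \<approx>\<^sub>T 0" by simp
      qed auto
      also have "\<dots> = rmul a (D ?U x)"
        using V(1)[OF x] by (simp add: D_def sum.insert_remove add.commute)
      also have "\<dots> \<approx>\<^sub>T rmul a (D (V x) x)"
        using x aR V(1) by (intro rmul_teq D_V) auto
      finally show "D (V (x \<otimes> a)) (x \<otimes> a) \<approx>\<^sub>T rmul a (D (V x) x)" .
    qed
  next
    fix a b assume ab: "a \<in> carrier R" "b \<in> carrier R"
      and A: "\<forall>x\<in>carrier R. D (V (x \<otimes> a)) (x \<otimes> a) \<approx>\<^sub>T rmul a (D (V x) x)"
      and B: "\<forall>x\<in>carrier R. D (V (x \<otimes> b)) (x \<otimes> b) \<approx>\<^sub>T rmul b (D (V x) x)"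
    show "\<forall>x\<in>carrier R. D (V (x \<otimes> (a \<oplus> b))) (x \<otimes> (a \<oplus> b)) \<approx>\<^sub>T rmul (a \<oplus> b) (D (V x) x)"
    proof
      fix x assume x: "x \<in> carrier R"
      have "D (V (x \<otimes> (a \<oplus> b))) (x \<otimes> (a \<oplus> b)) \<approx>\<^sub>T D (V (x \<otimes> a)) (x \<otimes> a) + D (V (x \<otimes> b)) (x \<otimes> b)"
        using \<delta>_add[of "x \<otimes> a" "x \<otimes> b"] x ab by (simp add: r_distr m_closed)
      also have "\<dots> \<approx>\<^sub>T rmul a (D (V x) x) + rmul b (D (V x) x)"
        using A B x by (intro teq_add) auto
      also have "\<dots> = (\<Sum>v\<in>V x. \<Sum>i\<in>I v. frag_of (x \<otimes> p v i, q v i \<otimes> a) + frag_of (x \<otimes> p v i, q v i \<otimes> b))"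
        by (simp add: rmul_D sum.distrib)
      also have "\<dots> \<approx>\<^sub>T rmul (a \<oplus> b) (D (V x) x)"
        unfolding rmul_D using x ab p q
        by (intro teq_sum) (auto simp: r_distr m_closed intro!: teq_sym[OF teq_right_add])
      finally show "D (V (x \<otimes> (a \<oplus> b))) (x \<otimes> (a \<oplus> b)) \<approx>\<^sub>T rmul (a \<oplus> b) (D (V x) x)" .
    qed
  qed
  have right: "\<delta> (x \<otimes> a) = tensor_rmult R S (\<delta> x) a" if "a \<in> carrier R" "x \<in> carrier R" for a x
    using right' that by (simp add: \<delta>_def tensor_rmult_tclass tclass_eq_iff)
  have hom: "\<delta> \<in> hom (add_monoid R) (tensor_product R S)"
  proof (rule homI)
    fix x y assume "x \<in> carrier (add_monoid R)" "y \<in> carrier (add_monoid R)"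
    then show "\<delta> (x \<otimes>\<^bsub>add_monoid R\<^esub> y) = \<delta> x \<otimes>\<^bsub>tensor_product R S\<^esub> \<delta> y"
      using \<delta>_add by (simp add: \<delta>_def tclass_mult Dk tclass_eq_iff)
  qed (simp add: \<delta>_def tclass_closed Dk)
  define M where "M = frag_eval (\<lambda>p. fst p \<otimes> snd p)"
  have Mh: "(\<lambda>p. fst p \<otimes> snd p) \<in> pairs \<rightarrow> carrier R" by (auto simp: m_closed)
  have M: "tensor_mu R (tclass z) = M z" if "Poly_Mapping.keys z \<subseteq> pairs" for z
    using tensor_mu_tclass[OF that] by (simp add: M_def)
  have M_teq: "M z = M w" if "z \<approx>\<^sub>T w" "Poly_Mapping.keys z \<subseteq> pairs" "Poly_Mapping.keys w \<subseteq> pairs" for z w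
    using M[OF that(2)] M[OF that(3)] that(1)[folded tclass_eq_iff] by simp
  have "M (D (V x) x) = x" if "x \<in> carrier R" for x
    using that
  proof (rule gen)
    have "M (D (V \<zero>) \<zero>) = M (D {} \<zero>)"
      using V(1) p by (intro M_teq D_restrict Dk) auto
    then show "M (D (V \<zero>) \<zero>) = \<zero>" by (simp add: M_def D_def)
  next
    fix a assume a: "a \<in> H"
    then have aR: "a \<in> carrier R" using H by blast
    obtain v where v: "\<And>u i. \<lbrakk>u \<noteq> v; i \<in> I u\<rbrakk> \<Longrightarrow> a \<otimes> p u i = \<zero>"
      and mu: "(\<Oplus>i\<in>I v. (a \<otimes> p v i) \<otimes> q v i) = a"
      using step[OF a] by blast
    have "D (V a) a \<approx>\<^sub>T D (insert v (V a)) a"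
      using aR V(1) by (intro teq_sym[OF D_V]) auto
    also have "\<dots> \<approx>\<^sub>T D {v} a"
      using aR V(1) v by (intro D_restrict) auto
    finally have "M (D (V a) a) = M (D {v} a)"
      using aR by (intro M_teq Dk)
    also have "\<dots> = (\<Oplus>i\<in>I v. M (frag_of (a \<otimes> p v i, q v i)))"
      using frag_eval_sum[OF I _ Mh, of v "\<lambda>i. frag_of (a \<otimes> p v i, q v i)"] aR p q
      by (simp add: M_def D_def m_closed)
    also have "\<dots> = (\<Oplus>i\<in>I v. (a \<otimes> p v i) \<otimes> q v i)"
      unfolding M_def using aR p q by (intro add.finprod_cong') (auto simp: m_closed)
    finally show "M (D (V a) a) = a" by (simp add: mu)
  next
    fix x y assume xy: "x \<in> carrier R" "y \<in> carrier R" "M (D (V x) x) = x" "M (D (V y) y) = y"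
    have k: "Poly_Mapping.keys (D (V x) x + D (V y) y) \<subseteq> pairs"
      using keys_add[of "D (V x) x" "D (V y) y"] Dk xy(1,2) by blast
    have "M (D (V (x \<oplus> y)) (x \<oplus> y)) = M (D (V x) x + D (V y) y)"
      using xy by (intro M_teq \<delta>_add Dk k) auto
    also have "\<dots> = x \<oplus> y"
      using frag_eval_add[OF Dk Dk Mh] xy by (simp add: M_def)
    finally show "M (D (V (x \<oplus> y)) (x \<oplus> y)) = x \<oplus> y" .
  qed
  then have mu: "tensor_mu R (\<delta> x) = x" if "x \<in> carrier R" for x
    using that by (simp add: \<delta>_def M Dk)
  show ?thesis
    unfolding separable_rng_extension_def
    by (intro conjI bexI[OF _ hom] ballI rng_axioms sub left right mu)
qed

end

section \<open>Groupoids of field isomorphisms\<close>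

lemma mor_dom_id [simp]: "mor_dom (mor_id E) = E"
  and mor_rng_id [simp]: "mor_rng (mor_id E) = E"
  and mor_map_id [simp]: "x \<in> E \<Longrightarrow> mor_map (mor_id E) x = x"
  by (auto simp: mor_id_def mor_rng_def)

lemma mor_dom_comp [simp]: "mor_dom (mor_comp \<gamma> \<tau>) = mor_dom \<tau>"
  by (simp add: mor_comp_def)

lemma mor_map_comp [simp]: "x \<in> mor_dom \<tau> \<Longrightarrow> mor_map (mor_comp \<gamma> \<tau>) x = mor_map \<gamma> (mor_map \<tau> x)"
  by (simp add: mor_comp_def compose_def)

lemma mor_rng_comp [simp]: "mor_dom \<gamma> = mor_rng \<tau> \<Longrightarrow> mor_rng (mor_comp \<gamma> \<tau>) = mor_rng \<gamma>"
  by (force simp: mor_comp_def mor_rng_def compose_def)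

lemma mor_map_in_rng [intro]: "x \<in> mor_dom \<gamma> \<Longrightarrow> mor_map \<gamma> x \<in> mor_rng \<gamma>"
  by (simp add: mor_rng_def)

lemma mor_comp_assoc:
  "mor_rng \<rho> = mor_dom \<tau> \<Longrightarrow> mor_comp (mor_comp \<gamma> \<tau>) \<rho> = mor_comp \<gamma> (mor_comp \<tau> \<rho>)"
  by (auto simp: mor_comp_def compose_def mor_rng_def fun_eq_iff)

lemma mor_eqI:
  assumes "mor_dom \<gamma> = mor_dom \<tau>" "mor_map \<gamma> \<in> extensional (mor_dom \<gamma>)"
    "mor_map \<tau> \<in> extensional (mor_dom \<tau>)" "\<And>x. x \<in> mor_dom \<gamma> \<Longrightarrow> mor_map \<gamma> x = mor_map \<tau> x"
  shows "\<gamma> = \<tau>"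
  using assms extensionalityI[of "mor_map \<gamma>" "mor_dom \<gamma>" "mor_map \<tau>"] by (simp add: prod_eq_iff)

text \<open>An abstraction satisfied by the groupoid of conjugate fields and by each of its wide
  subgroupoids, so that every fact about crossed products is available for both rings. Being a
  groupoid is encoded as being a wide subgroupoid of oneself.\<close>

locale field_groupoid = field A for A :: "('a, 'b) ring_scheme" (structure) +
  fixes \<Gamma> :: "'a mor set" and \<beta> :: "'a mor \<Rightarrow> 'a mor \<Rightarrow> 'a"
  assumes subfield_dom: "\<gamma> \<in> \<Gamma> \<Longrightarrow> subfield (mor_dom \<gamma>) A"
    and map_extensional: "\<gamma> \<in> \<Gamma> \<Longrightarrow> mor_map \<gamma> \<in> extensional (mor_dom \<gamma>)"
    and map_add: "\<lbrakk>\<gamma> \<in> \<Gamma>; x \<in> mor_dom \<gamma>; y \<in> mor_dom \<gamma>\<rbrakk> \<Longrightarrow> mor_map \<gamma> (x \<oplus> y) = mor_map \<gamma> x \<oplus> mor_map \<gamma> y"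
    and map_mult: "\<lbrakk>\<gamma> \<in> \<Gamma>; x \<in> mor_dom \<gamma>; y \<in> mor_dom \<gamma>\<rbrakk> \<Longrightarrow> mor_map \<gamma> (x \<otimes> y) = mor_map \<gamma> x \<otimes> mor_map \<gamma> y"
    and map_one: "\<gamma> \<in> \<Gamma> \<Longrightarrow> mor_map \<gamma> \<one> = \<one>"
    and groupoid: "wide_subgroupoid \<Gamma> \<Gamma>"
    and cocycle: "normalized_cocycle \<Gamma> \<beta>"
begin

lemma id_dom: "\<gamma> \<in> \<Gamma> \<Longrightarrow> mor_id (mor_dom \<gamma>) \<in> \<Gamma>"
  and id_rng: "\<gamma> \<in> \<Gamma> \<Longrightarrow> mor_id (mor_rng \<gamma>) \<in> \<Gamma>"
  and comp_closed: "\<lbrakk>\<gamma> \<in> \<Gamma>; \<tau> \<in> \<Gamma>; mor_dom \<gamma> = mor_rng \<tau>\<rbrakk> \<Longrightarrow> mor_comp \<gamma> \<tau> \<in> \<Gamma>"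
  using groupoid by (auto simp: wide_subgroupoid_def)

lemma subfield_rng: "\<gamma> \<in> \<Gamma> \<Longrightarrow> subfield (mor_rng \<gamma>) A"
  using subfield_dom[OF id_rng] by simp

lemma dom_props:
  assumes "\<gamma> \<in> \<Gamma>"
  shows "mor_dom \<gamma> \<subseteq> carrier A" "\<zero> \<in> mor_dom \<gamma>" "\<one> \<in> mor_dom \<gamma>"
    "\<And>x. x \<in> mor_dom \<gamma> \<Longrightarrow> \<ominus> x \<in> mor_dom \<gamma>"
    "\<And>x y. \<lbrakk>x \<in> mor_dom \<gamma>; y \<in> mor_dom \<gamma>\<rbrakk> \<Longrightarrow> x \<otimes> y \<in> mor_dom \<gamma>"
    "\<And>x y. \<lbrakk>x \<in> mor_dom \<gamma>; y \<in> mor_dom \<gamma>\<rbrakk> \<Longrightarrow> x \<oplus> y \<in> mor_dom \<gamma>"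
  using subringE[OF subfieldE(1)[OF subfield_dom[OF assms]]] by auto

lemma rng_props:
  assumes "\<gamma> \<in> \<Gamma>"
  shows "mor_rng \<gamma> \<subseteq> carrier A" "\<zero> \<in> mor_rng \<gamma>" "\<one> \<in> mor_rng \<gamma>"
    "\<And>x. x \<in> mor_rng \<gamma> \<Longrightarrow> \<ominus> x \<in> mor_rng \<gamma>"
    "\<And>x y. \<lbrakk>x \<in> mor_rng \<gamma>; y \<in> mor_rng \<gamma>\<rbrakk> \<Longrightarrow> x \<otimes> y \<in> mor_rng \<gamma>"
    "\<And>x y. \<lbrakk>x \<in> mor_rng \<gamma>; y \<in> mor_rng \<gamma>\<rbrakk> \<Longrightarrow> x \<oplus> y \<in> mor_rng \<gamma>"
  using subringE[OF subfieldE(1)[OF subfield_rng[OF assms]]] by auto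

lemma map_carrier: "\<lbrakk>\<gamma> \<in> \<Gamma>; x \<in> mor_dom \<gamma>\<rbrakk> \<Longrightarrow> mor_map \<gamma> x \<in> carrier A"
  using rng_props(1) by blast

lemma map_zero: assumes "\<gamma> \<in> \<Gamma>" shows "mor_map \<gamma> \<zero> = \<zero>"
proof -
  have "mor_map \<gamma> \<zero> \<oplus> mor_map \<gamma> \<zero> = mor_map \<gamma> \<zero>"
    using map_add[OF assms, of \<zero> \<zero>] dom_props(2)[OF assms] by simp
  then show ?thesis
    using map_carrier[OF assms dom_props(2)[OF assms]]
      add.l_cancel_one[of "mor_map \<gamma> \<zero>" "mor_map \<gamma> \<zero>"] by simp
qed

lemma map_sum:
  assumes "\<gamma> \<in> \<Gamma>" "finite I" "\<And>i. i \<in> I \<Longrightarrow> x i \<in> mor_dom \<gamma>"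
  shows "(\<Oplus>i\<in>I. x i) \<in> mor_dom \<gamma> \<and> mor_map \<gamma> (\<Oplus>i\<in>I. x i) = (\<Oplus>i\<in>I. mor_map \<gamma> (x i))"
  using assms(2,3)
proof (induction I)
  case empty
  then show ?case using assms(1) by (simp add: map_zero dom_props)
next
  case (insert i I)
  have "x j \<in> carrier A" "mor_map \<gamma> (x j) \<in> carrier A" if "j \<in> insert i I" for j
    using insert.prems[OF that] dom_props(1)[OF assms(1)] map_carrier[OF assms(1)] by auto
  then have "(\<Oplus>j\<in>insert i I. x j) = x i \<oplus> (\<Oplus>j\<in>I. x j)"
      "(\<Oplus>j\<in>insert i I. mor_map \<gamma> (x j)) = mor_map \<gamma> (x i) \<oplus> (\<Oplus>j\<in>I. mor_map \<gamma> (x j))"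
    using insert.hyps by (auto intro!: finsum_insert)
  then show ?case
    using insert.IH insert.prems assms(1) by (simp add: map_add dom_props)
qed

lemma comp_id [simp]: "\<gamma> \<in> \<Gamma> \<Longrightarrow> mor_comp \<gamma> (mor_id (mor_dom \<gamma>)) = \<gamma>"
  by (rule mor_eqI) (auto simp: map_extensional, auto simp: mor_comp_def mor_id_def)

lemma id_comp [simp]: "\<gamma> \<in> \<Gamma> \<Longrightarrow> mor_comp (mor_id (mor_rng \<gamma>)) \<gamma> = \<gamma>"
  by (rule mor_eqI) (auto simp: map_extensional mor_map_in_rng, auto simp: mor_comp_def)

text \<open>Picked inside \<Gamma> from the existence statement for inverses; \<open>inv_eqI\<close>
  makes the choice immaterial.\<close>

definition mor_inv :: "'a mor \<Rightarrow> 'a mor" where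
  "mor_inv \<gamma> = (SOME \<tau>. \<tau> \<in> \<Gamma> \<and> mor_dom \<tau> = mor_rng \<gamma> \<and> mor_rng \<tau> = mor_dom \<gamma> \<and>
     mor_comp \<tau> \<gamma> = mor_id (mor_dom \<gamma>) \<and> mor_comp \<gamma> \<tau> = mor_id (mor_rng \<gamma>))"

lemma mor_inv:
  assumes "\<gamma> \<in> \<Gamma>"
  shows inv_closed: "mor_inv \<gamma> \<in> \<Gamma>"
    and dom_inv [simp]: "mor_dom (mor_inv \<gamma>) = mor_rng \<gamma>"
    and rng_inv [simp]: "mor_rng (mor_inv \<gamma>) = mor_dom \<gamma>"
    and inv_comp [simp]: "mor_comp (mor_inv \<gamma>) \<gamma> = mor_id (mor_dom \<gamma>)"
    and comp_inv [simp]: "mor_comp \<gamma> (mor_inv \<gamma>) = mor_id (mor_rng \<gamma>)"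
proof -
  have "\<exists>\<tau>. \<tau> \<in> \<Gamma> \<and> mor_dom \<tau> = mor_rng \<gamma> \<and> mor_rng \<tau> = mor_dom \<gamma> \<and>
     mor_comp \<tau> \<gamma> = mor_id (mor_dom \<gamma>) \<and> mor_comp \<gamma> \<tau> = mor_id (mor_rng \<gamma>)"
    using groupoid assms unfolding wide_subgroupoid_def by blast
  from someI_ex[OF this] show "mor_inv \<gamma> \<in> \<Gamma>" "mor_dom (mor_inv \<gamma>) = mor_rng \<gamma>"
    "mor_rng (mor_inv \<gamma>) = mor_dom \<gamma>" "mor_comp (mor_inv \<gamma>) \<gamma> = mor_id (mor_dom \<gamma>)"
    "mor_comp \<gamma> (mor_inv \<gamma>) = mor_id (mor_rng \<gamma>)"
    by (simp_all add: mor_inv_def)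
qed

lemma inv_comp_comp [simp]:
  assumes "\<gamma> \<in> \<Gamma>" "\<tau> \<in> \<Gamma>" "mor_dom \<gamma> = mor_rng \<tau>"
  shows "mor_comp (mor_inv \<gamma>) (mor_comp \<gamma> \<tau>) = \<tau>"
  using assms mor_comp_assoc[of \<tau> \<gamma> "mor_inv \<gamma>"] by simp

lemma comp_inv_comp [simp]:
  assumes "\<gamma> \<in> \<Gamma>" "\<tau> \<in> \<Gamma>" "mor_rng \<gamma> = mor_rng \<tau>"
  shows "mor_comp \<gamma> (mor_comp (mor_inv \<gamma>) \<tau>) = \<tau>"
  using assms mor_comp_assoc[of \<tau> "mor_inv \<gamma>" \<gamma>] by simp

text \<open>A right inverse suffices, since \<gamma> can be cancelled on the left.\<close>

lemma inv_eqI: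
  assumes "\<gamma> \<in> \<Gamma>" "\<tau> \<in> \<Gamma>" "mor_dom \<gamma> = mor_rng \<tau>" "mor_comp \<gamma> \<tau> = mor_id (mor_rng \<gamma>)"
  shows "mor_inv \<gamma> = \<tau>"
proof -
  have "mor_inv \<gamma> = mor_comp (mor_inv \<gamma>) (mor_id (mor_rng \<gamma>))"
    using comp_id[OF inv_closed[OF assms(1)]] assms(1) by simp
  then show ?thesis
    using inv_comp_comp[OF assms(1-3)] assms(4) by simp
qed

lemma inv_inv [simp]: "\<gamma> \<in> \<Gamma> \<Longrightarrow> mor_inv (mor_inv \<gamma>) = \<gamma>"
  by (rule inv_eqI) (auto simp: inv_closed)

lemma comp_cancel_left:
  assumes "\<gamma> \<in> \<Gamma>" "\<tau> \<in> \<Gamma>" "\<rho> \<in> \<Gamma>" "mor_dom \<gamma> = mor_rng \<tau>" "mor_dom \<gamma> = mor_rng \<rho>"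
    "mor_comp \<gamma> \<tau> = mor_comp \<gamma> \<rho>"
  shows "\<tau> = \<rho>"
  by (rule inv_comp_comp[OF assms(1,2,4), unfolded assms(6) inv_comp_comp[OF assms(1,3,5)], symmetric])

lemma map_inv_map: "\<lbrakk>\<gamma> \<in> \<Gamma>; x \<in> mor_dom \<gamma>\<rbrakk> \<Longrightarrow> mor_map (mor_inv \<gamma>) (mor_map \<gamma> x) = x"
  using mor_map_comp[of x \<gamma> "mor_inv \<gamma>"] by simp

lemma map_map_inv: "\<lbrakk>\<gamma> \<in> \<Gamma>; x \<in> mor_rng \<gamma>\<rbrakk> \<Longrightarrow> mor_map \<gamma> (mor_map (mor_inv \<gamma>) x) = x"
  using map_inv_map[of "mor_inv \<gamma>" x] by (simp add: inv_closed)

lemma cocycle_closed: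
  "\<lbrakk>\<gamma> \<in> \<Gamma>; \<tau> \<in> \<Gamma>; mor_dom \<gamma> = mor_rng \<tau>\<rbrakk> \<Longrightarrow> \<beta> \<gamma> \<tau> \<in> mor_rng \<gamma>"
  and cocycle_nonzero: "\<lbrakk>\<gamma> \<in> \<Gamma>; \<tau> \<in> \<Gamma>; mor_dom \<gamma> = mor_rng \<tau>\<rbrakk> \<Longrightarrow> \<beta> \<gamma> \<tau> \<noteq> \<zero>"
  and cocycle_id_right [simp]: "\<gamma> \<in> \<Gamma> \<Longrightarrow> \<beta> \<gamma> (mor_id (mor_dom \<gamma>)) = \<one>"
  and cocycle_id_left [simp]: "\<gamma> \<in> \<Gamma> \<Longrightarrow> \<beta> (mor_id (mor_rng \<gamma>)) \<gamma> = \<one>"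
  and cocycle_assoc: "\<lbrakk>\<gamma> \<in> \<Gamma>; \<tau> \<in> \<Gamma>; \<rho> \<in> \<Gamma>; mor_dom \<gamma> = mor_rng \<tau>; mor_dom \<tau> = mor_rng \<rho>\<rbrakk> \<Longrightarrow>
      \<beta> \<gamma> \<tau> \<otimes> \<beta> (mor_comp \<gamma> \<tau>) \<rho> = mor_map \<gamma> (\<beta> \<tau> \<rho>) \<otimes> \<beta> \<gamma> (mor_comp \<tau> \<rho>)"
  proof -
  note c = cocycle[unfolded normalized_cocycle_def]
  show "\<lbrakk>\<gamma> \<in> \<Gamma>; \<tau> \<in> \<Gamma>; mor_dom \<gamma> = mor_rng \<tau>\<rbrakk> \<Longrightarrow> \<beta> \<gamma> \<tau> \<in> mor_rng \<gamma>"
    "\<lbrakk>\<gamma> \<in> \<Gamma>; \<tau> \<in> \<Gamma>; mor_dom \<gamma> = mor_rng \<tau>\<rbrakk> \<Longrightarrow> \<beta> \<gamma> \<tau> \<noteq> \<zero>"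
    using c[THEN conjunct1] by blast+
  show "\<gamma> \<in> \<Gamma> \<Longrightarrow> \<beta> \<gamma> (mor_id (mor_dom \<gamma>)) = \<one>" "\<gamma> \<in> \<Gamma> \<Longrightarrow> \<beta> (mor_id (mor_rng \<gamma>)) \<gamma> = \<one>"
    using c[THEN conjunct2, THEN conjunct1] by blast+
  show "\<lbrakk>\<gamma> \<in> \<Gamma>; \<tau> \<in> \<Gamma>; \<rho> \<in> \<Gamma>; mor_dom \<gamma> = mor_rng \<tau>; mor_dom \<tau> = mor_rng \<rho>\<rbrakk> \<Longrightarrow>
      \<beta> \<gamma> \<tau> \<otimes> \<beta> (mor_comp \<gamma> \<tau>) \<rho> = mor_map \<gamma> (\<beta> \<tau> \<rho>) \<otimes> \<beta> \<gamma> (mor_comp \<tau> \<rho>)"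
    using c[THEN conjunct2, THEN conjunct2] by blast
qed

section \<open>The object crossed product as a ring\<close>

abbreviation CP where "CP \<equiv> object_crossed_product \<Gamma> \<beta>"

text \<open>The homogeneous element \<open>a u\<^sub>\<gamma>\<close>. These elements span the
  crossed product additively.\<close>

definition mon :: "'a \<Rightarrow> 'a mor \<Rightarrow> 'a mor \<Rightarrow> 'a" where
  "mon a \<gamma> = (\<lambda>\<tau>. if \<tau> = \<gamma> then a else \<zero>)"

abbreviation unit_mon where "unit_mon \<equiv> mon \<one>"
abbreviation idem where "idem E \<equiv> mon \<one> (mor_id E)"

lemma carrier_CP:
  "f \<in> carrier CP \<longleftrightarrow> (\<forall>\<gamma>\<in>\<Gamma>. f \<gamma> \<in> mor_rng \<gamma>) \<and> (\<forall>\<gamma>. \<gamma> \<notin> \<Gamma> \<longrightarrow> f \<gamma> = \<zero>) \<and> finite {\<gamma>. f \<gamma> \<noteq> \<zero>}"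
  by (simp add: object_crossed_product_def)

lemma zero_CP: "\<zero>\<^bsub>CP\<^esub> = (\<lambda>_. \<zero>)"
  and add_CP: "f \<oplus>\<^bsub>CP\<^esub> g = (\<lambda>\<gamma>. f \<gamma> \<oplus> g \<gamma>)"
  by (simp_all add: object_crossed_product_def)

lemma CP_rng: "\<lbrakk>f \<in> carrier CP; \<gamma> \<in> \<Gamma>\<rbrakk> \<Longrightarrow> f \<gamma> \<in> mor_rng \<gamma>"
  and CP_outside: "\<lbrakk>f \<in> carrier CP; \<gamma> \<notin> \<Gamma>\<rbrakk> \<Longrightarrow> f \<gamma> = \<zero>"
  and CP_finite: "f \<in> carrier CP \<Longrightarrow> finite {\<gamma>. f \<gamma> \<noteq> \<zero>}"
  unfolding carrier_CP by blast+

lemma CP_carrier: "f \<in> carrier CP \<Longrightarrow> f \<gamma> \<in> carrier A"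
  using CP_rng[of f \<gamma>] CP_outside[of f \<gamma>] rng_props(1)[of \<gamma>] by (cases "\<gamma> \<in> \<Gamma>") auto

lemma CP_support: "f \<in> carrier CP \<Longrightarrow> {\<gamma>. f \<gamma> \<noteq> \<zero>} \<subseteq> \<Gamma>"
  using CP_outside by blast

lemma mon_closed: "\<lbrakk>\<gamma> \<in> \<Gamma>; a \<in> mor_rng \<gamma>\<rbrakk> \<Longrightarrow> mon a \<gamma> \<in> carrier CP"
  using rng_props(2) by (auto simp: carrier_CP mon_def)

lemma unit_mon_closed: "\<gamma> \<in> \<Gamma> \<Longrightarrow> unit_mon \<gamma> \<in> carrier CP"
  by (simp add: mon_closed rng_props)

lemma mon_zero [simp]: "mon \<zero> \<gamma> = \<zero>\<^bsub>CP\<^esub>"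
  by (auto simp: mon_def zero_CP)

lemma mon_add: "\<lbrakk>a \<in> carrier A; b \<in> carrier A\<rbrakk> \<Longrightarrow> mon (a \<oplus> b) \<gamma> = mon a \<gamma> \<oplus>\<^bsub>CP\<^esub> mon b \<gamma>"
  by (auto simp: mon_def add_CP)

lemma abelian_group_CP: "abelian_group CP"
proof (rule abelian_groupI)
  fix f g assume f: "f \<in> carrier CP" and g: "g \<in> carrier CP"
  have "finite ({\<gamma>. f \<gamma> \<noteq> \<zero>} \<union> {\<gamma>. g \<gamma> \<noteq> \<zero>})"
    using f g CP_finite by blast
  then have "finite {\<gamma>. f \<gamma> \<oplus> g \<gamma> \<noteq> \<zero>}"
    by (rule rev_finite_subset) auto
  then show "f \<oplus>\<^bsub>CP\<^esub> g \<in> carrier CP"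
    using f g rng_props(6) by (simp add: carrier_CP add_CP)
next
  show "\<zero>\<^bsub>CP\<^esub> \<in> carrier CP" using rng_props(2) by (simp add: carrier_CP zero_CP)
next
  fix f assume f: "f \<in> carrier CP"
  have "(\<lambda>\<gamma>. \<ominus> f \<gamma>) \<in> carrier CP"
    using f rng_props(4) CP_carrier[OF f] by (auto simp: carrier_CP elim: rev_finite_subset)
  moreover have "(\<lambda>\<gamma>. \<ominus> f \<gamma>) \<oplus>\<^bsub>CP\<^esub> f = \<zero>\<^bsub>CP\<^esub>"
    using CP_carrier[OF f] by (auto simp: add_CP zero_CP l_neg)
  ultimately show "\<exists>g\<in>carrier CP. g \<oplus>\<^bsub>CP\<^esub> f = \<zero>\<^bsub>CP\<^esub>" by blast
qed (auto simp: add_CP zero_CP CP_carrier a_ac)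

text \<open>Induction over a finite set containing the support, removing one coefficient at a time.
  Ring laws that are additive in an argument reduce to homogeneous elements by it.\<close>

lemma CP_induct [consumes 1, case_names zero mon add]:
  assumes "f \<in> carrier CP" and z: "P \<zero>\<^bsub>CP\<^esub>"
    and m: "\<And>\<gamma> a. \<lbrakk>\<gamma> \<in> \<Gamma>; a \<in> mor_rng \<gamma>\<rbrakk> \<Longrightarrow> P (mon a \<gamma>)"
    and a: "\<And>f g. \<lbrakk>f \<in> carrier CP; g \<in> carrier CP; P f; P g\<rbrakk> \<Longrightarrow> P (f \<oplus>\<^bsub>CP\<^esub> g)"
  shows "P f"
proof -
  have "P f" if "finite T" "f \<in> carrier CP" "{\<gamma>. f \<gamma> \<noteq> \<zero>} \<subseteq> T" for T f
    using that
  proof (induction T arbitrary: f)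
    case empty
    then have "f = \<zero>\<^bsub>CP\<^esub>" by (auto simp: zero_CP)
    then show ?case using z by simp
  next
    case (insert \<gamma> T)
    let ?g = "f(\<gamma> := \<zero>)"
    have g: "?g \<in> carrier CP"
      using insert.prems(1) rng_props(2) by (auto simp: carrier_CP elim: rev_finite_subset)
    have "P ?g" by (rule insert.IH[OF g]) (use insert.prems in auto)
    show ?case
    proof (cases "\<gamma> \<in> \<Gamma>")
      case True
      have "f = ?g \<oplus>\<^bsub>CP\<^esub> mon (f \<gamma>) \<gamma>"
        by (rule ext) (simp add: add_CP mon_def CP_carrier[OF insert.prems(1)])
      moreover have "P (?g \<oplus>\<^bsub>CP\<^esub> mon (f \<gamma>) \<gamma>)"
        using g \<open>P ?g\<close> True CP_rng[OF insert.prems(1) True] by (intro a m) (auto intro: mon_closed)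
      ultimately show ?thesis by simp
    next
      case False
      then have "?g = f" using CP_outside[OF insert.prems(1) False] by (simp add: fun_upd_idem)
      then show ?thesis using \<open>P ?g\<close> by simp
    qed
  qed
  then show ?thesis using assms(1) CP_finite by blast
qed

abbreviation mult_term where "mult_term f g \<equiv> \<lambda>(s, t). f s \<otimes> mor_map s (g t) \<otimes> \<beta> s t"

lemma mult_term_closed:
  assumes "f \<in> carrier CP" "g \<in> carrier CP" "s \<in> \<Gamma>" "t \<in> \<Gamma>" "mor_dom s = mor_rng t"
  shows "mult_term f g (s, t) \<in> carrier A"
  using assms CP_rng[of g t] map_carrier[of s "g t"] cocycle_closed[of s t] rng_props(1)[of s]
    CP_carrier[of f s] by auto

lemma mult_term_Pi:
  assumes "f \<in> carrier CP" "g \<in> carrier CP" "S \<subseteq> \<Gamma>" "T \<subseteq> \<Gamma>"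
  shows "mult_term f g \<in> {(s, t). s \<in> S \<and> t \<in> T \<and> mor_dom s = mor_rng t \<and> mor_comp s t = r} \<rightarrow> carrier A"
proof
  fix p assume p: "p \<in> {(s, t). s \<in> S \<and> t \<in> T \<and> mor_dom s = mor_rng t \<and> mor_comp s t = r}"
  obtain s t where "p = (s, t)" using surj_pair[of p] by blast
  then show "mult_term f g p \<in> carrier A"
    using p mult_term_closed[OF assms(1,2), of s t] assms(3,4) by auto
qed

text \<open>The defining sum runs over the exact supports, which change under addition. Over fixed
  finite supersets the distributive laws become termwise; the extra pairs contribute zero because
  morphisms preserve zero.\<close>

lemma mult_CP:
  assumes f: "f \<in> carrier CP" and g: "g \<in> carrier CP"
    and S: "finite S" "{\<gamma>. f \<gamma> \<noteq> \<zero>} \<subseteq> S" "S \<subseteq> \<Gamma>"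
    and T: "finite T" "{\<gamma>. g \<gamma> \<noteq> \<zero>} \<subseteq> T" "T \<subseteq> \<Gamma>"
  shows "(f \<otimes>\<^bsub>CP\<^esub> g) r = finsum A (mult_term f g)
    {(s, t). s \<in> S \<and> t \<in> T \<and> mor_dom s = mor_rng t \<and> mor_comp s t = r}"
proof -
  let ?S = "{(s, t). f s \<noteq> \<zero> \<and> g t \<noteq> \<zero> \<and> mor_dom s = mor_rng t \<and> mor_comp s t = r}"
  let ?T = "{(s, t). s \<in> S \<and> t \<in> T \<and> mor_dom s = mor_rng t \<and> mor_comp s t = r}"
  have "finsum A (mult_term f g) ?S = finsum A (mult_term f g) ?T"
  proof (rule add.finprod_mono_neutral_cong_left)
    show "finite ?T"
      by (rule finite_subset[of _ "S \<times> T"]) (use S T in auto)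
    show "mult_term f g \<in> ?T \<rightarrow> carrier A"
      by (rule mult_term_Pi[OF f g S(3) T(3)])
    fix i assume i: "i \<in> ?T - ?S"
    obtain s t where st: "i = (s, t)" using surj_pair[of i] by blast
    with i S T have *: "s \<in> \<Gamma>" "t \<in> \<Gamma>" "mor_dom s = mor_rng t" "f s = \<zero> \<or> g t = \<zero>" by auto
    have "mor_map s (g t) \<in> carrier A" "\<beta> s t \<in> carrier A"
      using *(1-3) CP_rng[OF g, of t] map_carrier[of s "g t"] cocycle_closed[of s t] rng_props(1)[of s]
      by auto
    then show "mult_term f g i = \<zero>"
      using *(4) CP_carrier[OF f, of s] map_zero[OF *(1)] st by auto
  qed (use S T in auto)
  then show ?thesis by (simp add: object_crossed_product_def)
qed

text \<open>True for every function \<open>g\<close>: the defining sum has no pairs to run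
  over.\<close>

lemma mult_CP_zero: "\<zero>\<^bsub>CP\<^esub> \<otimes>\<^bsub>CP\<^esub> g = \<zero>\<^bsub>CP\<^esub>" "g \<otimes>\<^bsub>CP\<^esub> \<zero>\<^bsub>CP\<^esub> = \<zero>\<^bsub>CP\<^esub>"
  by (simp_all add: object_crossed_product_def)

lemma add_CP_closed: "\<lbrakk>f \<in> carrier CP; g \<in> carrier CP\<rbrakk> \<Longrightarrow> f \<oplus>\<^bsub>CP\<^esub> g \<in> carrier CP"
  using abelian_monoid.a_closed[OF abelian_group.axioms(1)[OF abelian_group_CP]] by blast

lemma zero_CP_closed: "\<zero>\<^bsub>CP\<^esub> \<in> carrier CP"
  using abelian_monoid.zero_closed[OF abelian_group.axioms(1)[OF abelian_group_CP]] by blast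

lemma CP_l_distr:
  assumes f: "f \<in> carrier CP" and f': "f' \<in> carrier CP" and g: "g \<in> carrier CP"
  shows "(f \<oplus>\<^bsub>CP\<^esub> f') \<otimes>\<^bsub>CP\<^esub> g = (f \<otimes>\<^bsub>CP\<^esub> g) \<oplus>\<^bsub>CP\<^esub> (f' \<otimes>\<^bsub>CP\<^esub> g)"
proof
  fix r
  let ?S = "{\<gamma>. f \<gamma> \<noteq> \<zero>} \<union> {\<gamma>. f' \<gamma> \<noteq> \<zero>}" and ?T = "{\<gamma>. g \<gamma> \<noteq> \<zero>}"
  let ?I = "{(s, t). s \<in> ?S \<and> t \<in> ?T \<and> mor_dom s = mor_rng t \<and> mor_comp s t = r}"
  have ST: "finite ?S" "?S \<subseteq> \<Gamma>" "finite ?T" "?T \<subseteq> \<Gamma>"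
    using f f' g CP_finite CP_support by auto
  have ff: "f \<oplus>\<^bsub>CP\<^esub> f' \<in> carrier CP" by (rule add_CP_closed[OF f f'])
  have sub: "{\<gamma>. (f \<oplus>\<^bsub>CP\<^esub> f') \<gamma> \<noteq> \<zero>} \<subseteq> ?S" by (auto simp: add_CP)
  have I: "s \<in> \<Gamma>" "t \<in> \<Gamma>" "mor_dom s = mor_rng t" if "(s, t) \<in> ?I" for s t
    using that ST by auto
  have "((f \<oplus>\<^bsub>CP\<^esub> f') \<otimes>\<^bsub>CP\<^esub> g) r = finsum A (mult_term (f \<oplus>\<^bsub>CP\<^esub> f') g) ?I"
    by (rule mult_CP[OF ff g ST(1) sub ST(2,3) _ ST(4)]) auto
  also have "\<dots> = finsum A (\<lambda>p. mult_term f g p \<oplus> mult_term f' g p) ?I"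
  proof (rule add.finprod_cong')
    show "(\<lambda>p. mult_term f g p \<oplus> mult_term f' g p) \<in> ?I \<rightarrow> carrier A"
      using mult_term_Pi[OF f g ST(2,4), of r] mult_term_Pi[OF f' g ST(2,4), of r] by (simp add: Pi_iff)
    fix p assume p: "p \<in> ?I"
    obtain s t where ps: "p = (s, t)" using surj_pair[of p] by blast
    note st = ps I[OF p[unfolded ps]]
    then have "mor_map s (g t) \<in> carrier A" "\<beta> s t \<in> carrier A"
      using CP_rng[OF g, of t] map_carrier[of s "g t"] cocycle_closed[of s t] rng_props(1)[of s] by auto
    then show "mult_term (f \<oplus>\<^bsub>CP\<^esub> f') g p = mult_term f g p \<oplus> mult_term f' g p"
      using CP_carrier[OF f] CP_carrier[OF f'] st(1) by (simp add: add_CP l_distr)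
  qed simp
  also have "\<dots> = finsum A (mult_term f g) ?I \<oplus> finsum A (mult_term f' g) ?I"
    by (rule finsum_addf[OF mult_term_Pi[OF f g ST(2,4)] mult_term_Pi[OF f' g ST(2,4)]])
  also have "finsum A (mult_term f g) ?I = (f \<otimes>\<^bsub>CP\<^esub> g) r"
    by (rule mult_CP[OF f g ST(1) _ ST(2,3) _ ST(4), symmetric]) auto
  also have "finsum A (mult_term f' g) ?I = (f' \<otimes>\<^bsub>CP\<^esub> g) r"
    by (rule mult_CP[OF f' g ST(1) _ ST(2,3) _ ST(4), symmetric]) auto
  finally show "((f \<oplus>\<^bsub>CP\<^esub> f') \<otimes>\<^bsub>CP\<^esub> g) r = ((f \<otimes>\<^bsub>CP\<^esub> g) \<oplus>\<^bsub>CP\<^esub> (f' \<otimes>\<^bsub>CP\<^esub> g)) r"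
    by (simp add: add_CP)
qed

lemma CP_r_distr:
  assumes f: "f \<in> carrier CP" and f': "f' \<in> carrier CP" and g: "g \<in> carrier CP"
  shows "g \<otimes>\<^bsub>CP\<^esub> (f \<oplus>\<^bsub>CP\<^esub> f') = (g \<otimes>\<^bsub>CP\<^esub> f) \<oplus>\<^bsub>CP\<^esub> (g \<otimes>\<^bsub>CP\<^esub> f')"
proof
  fix r
  let ?T = "{\<gamma>. f \<gamma> \<noteq> \<zero>} \<union> {\<gamma>. f' \<gamma> \<noteq> \<zero>}" and ?S = "{\<gamma>. g \<gamma> \<noteq> \<zero>}"
  let ?I = "{(s, t). s \<in> ?S \<and> t \<in> ?T \<and> mor_dom s = mor_rng t \<and> mor_comp s t = r}"
  have ST: "finite ?S" "?S \<subseteq> \<Gamma>" "finite ?T" "?T \<subseteq> \<Gamma>"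
    using f f' g CP_finite CP_support by auto
  have ff: "f \<oplus>\<^bsub>CP\<^esub> f' \<in> carrier CP" by (rule add_CP_closed[OF f f'])
  have sub: "{\<gamma>. (f \<oplus>\<^bsub>CP\<^esub> f') \<gamma> \<noteq> \<zero>} \<subseteq> ?T" by (auto simp: add_CP)
  have I: "s \<in> \<Gamma>" "t \<in> \<Gamma>" "mor_dom s = mor_rng t" if "(s, t) \<in> ?I" for s t
    using that ST by auto
  have "(g \<otimes>\<^bsub>CP\<^esub> (f \<oplus>\<^bsub>CP\<^esub> f')) r = finsum A (mult_term g (f \<oplus>\<^bsub>CP\<^esub> f')) ?I"
    by (rule mult_CP[OF g ff ST(1) _ ST(2,3) sub ST(4)]) auto
  also have "\<dots> = finsum A (\<lambda>p. mult_term g f p \<oplus> mult_term g f' p) ?I"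
  proof (rule add.finprod_cong')
    show "(\<lambda>p. mult_term g f p \<oplus> mult_term g f' p) \<in> ?I \<rightarrow> carrier A"
      using mult_term_Pi[OF g f ST(2,4), of r] mult_term_Pi[OF g f' ST(2,4), of r] by (simp add: Pi_iff)
    fix p assume p: "p \<in> ?I"
    obtain s t where ps: "p = (s, t)" using surj_pair[of p] by blast
    note st = ps I[OF p[unfolded ps]]
    then have "f t \<in> mor_dom s" "f' t \<in> mor_dom s" "\<beta> s t \<in> carrier A"
      using CP_rng[OF f, of t] CP_rng[OF f', of t] cocycle_closed[of s t] rng_props(1)[of s] by auto
    then show "mult_term g (f \<oplus>\<^bsub>CP\<^esub> f') p = mult_term g f p \<oplus> mult_term g f' p"
      using CP_carrier[OF g] st map_carrier[OF st(2)] by (simp add: add_CP l_distr r_distr map_add)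
  qed simp
  also have "\<dots> = finsum A (mult_term g f) ?I \<oplus> finsum A (mult_term g f') ?I"
    by (rule finsum_addf[OF mult_term_Pi[OF g f ST(2,4)] mult_term_Pi[OF g f' ST(2,4)]])
  also have "finsum A (mult_term g f) ?I = (g \<otimes>\<^bsub>CP\<^esub> f) r"
    by (rule mult_CP[OF g f ST(1) _ ST(2,3) _ ST(4), symmetric]) auto
  also have "finsum A (mult_term g f') ?I = (g \<otimes>\<^bsub>CP\<^esub> f') r"
    by (rule mult_CP[OF g f' ST(1) _ ST(2,3) _ ST(4), symmetric]) auto
  finally show "(g \<otimes>\<^bsub>CP\<^esub> (f \<oplus>\<^bsub>CP\<^esub> f')) r = ((g \<otimes>\<^bsub>CP\<^esub> f) \<oplus>\<^bsub>CP\<^esub> (g \<otimes>\<^bsub>CP\<^esub> f')) r"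
    by (simp add: add_CP)
qed

lemma mon_mult_mon:
  assumes "\<gamma> \<in> \<Gamma>" "\<tau> \<in> \<Gamma>" "a \<in> mor_rng \<gamma>" "b \<in> mor_rng \<tau>"
  shows "mon a \<gamma> \<otimes>\<^bsub>CP\<^esub> mon b \<tau> =
    (if mor_dom \<gamma> = mor_rng \<tau> then mon (a \<otimes> mor_map \<gamma> b \<otimes> \<beta> \<gamma> \<tau>) (mor_comp \<gamma> \<tau>) else \<zero>\<^bsub>CP\<^esub>)"
proof
  fix r
  let ?I = "{(s, t). s \<in> {\<gamma>} \<and> t \<in> {\<tau>} \<and> mor_dom s = mor_rng t \<and> mor_comp s t = r}"
  define J where "J = ?I"
  have m: "mon a \<gamma> \<in> carrier CP" "mon b \<tau> \<in> carrier CP"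
    using assms by (simp_all add: mon_closed)
  have eq: "(mon a \<gamma> \<otimes>\<^bsub>CP\<^esub> mon b \<tau>) r = finsum A (mult_term (mon a \<gamma>) (mon b \<tau>)) J"
    unfolding J_def using assms by (intro mult_CP m) (auto simp: mon_def)
  show "(mon a \<gamma> \<otimes>\<^bsub>CP\<^esub> mon b \<tau>) r =
    (if mor_dom \<gamma> = mor_rng \<tau> then mon (a \<otimes> mor_map \<gamma> b \<otimes> \<beta> \<gamma> \<tau>) (mor_comp \<gamma> \<tau>) else \<zero>\<^bsub>CP\<^esub>) r"
  proof (cases "mor_dom \<gamma> = mor_rng \<tau> \<and> mor_comp \<gamma> \<tau> = r")
    case True
    then have "J = {(\<gamma>, \<tau>)}" by (auto simp: J_def)
    then show ?thesis
      using eq True mult_term_closed[OF m, of \<gamma> \<tau>] assms by (simp add: mon_def)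
  next
    case False
    then have "J = {}" by (auto simp: J_def)
    then show ?thesis using eq False by (auto simp: mon_def zero_CP)
  qed
qed

lemma mon_mult_coeff:
  assumes "\<gamma> \<in> \<Gamma>" "\<tau> \<in> \<Gamma>" "a \<in> mor_rng \<gamma>" "b \<in> mor_rng \<tau>" "mor_dom \<gamma> = mor_rng \<tau>"
  shows "a \<otimes> mor_map \<gamma> b \<otimes> \<beta> \<gamma> \<tau> \<in> mor_rng \<gamma>"
  using assms by (intro rng_props(5)) (auto intro: cocycle_closed)

lemma mult_CP_closed:
  assumes "f \<in> carrier CP" "g \<in> carrier CP"
  shows "f \<otimes>\<^bsub>CP\<^esub> g \<in> carrier CP"
  using assms(1)
proof (induction f rule: CP_induct)
  case (mon \<gamma> a)
  show ?case using assms(2)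
  proof (induction g rule: CP_induct)
    case (mon \<tau> b)
    then show ?case
      using \<open>\<gamma> \<in> \<Gamma>\<close> \<open>a \<in> mor_rng \<gamma>\<close>
      by (simp add: mon_mult_mon zero_CP_closed mon_closed comp_closed mon_mult_coeff)
  qed (use mon in \<open>simp_all add: mult_CP_zero zero_CP_closed CP_r_distr mon_closed add_CP_closed\<close>)
qed (use assms(2) in \<open>simp_all add: mult_CP_zero zero_CP_closed CP_l_distr add_CP_closed\<close>)

text \<open>Once the coefficients are commuted, the two bracketings differ exactly by the two sides
  of the cocycle identity. If either pair of neighbours is not composable, both bracketings are
  zero.\<close>

lemma mon_assoc:
  assumes "\<gamma> \<in> \<Gamma>" "\<tau> \<in> \<Gamma>" "\<rho> \<in> \<Gamma>" "a \<in> mor_rng \<gamma>" "b \<in> mor_rng \<tau>" "c \<in> mor_rng \<rho>"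
  shows "(mon a \<gamma> \<otimes>\<^bsub>CP\<^esub> mon b \<tau>) \<otimes>\<^bsub>CP\<^esub> mon c \<rho> = mon a \<gamma> \<otimes>\<^bsub>CP\<^esub> (mon b \<tau> \<otimes>\<^bsub>CP\<^esub> mon c \<rho>)"
proof (cases "mor_dom \<gamma> = mor_rng \<tau> \<and> mor_dom \<tau> = mor_rng \<rho>")
  case True
  let ?b = "mor_map \<gamma> b" and ?c = "mor_map \<gamma> (mor_map \<tau> c)"
  have in_dom: "b \<in> mor_dom \<gamma>" "c \<in> mor_dom \<tau>" "mor_map \<tau> c \<in> mor_dom \<gamma>" "\<beta> \<tau> \<rho> \<in> mor_dom \<gamma>"
    using True assms by (auto simp: cocycle_closed)
  have "a \<in> carrier A" "?b \<in> carrier A" "?c \<in> carrier A" "mor_map \<gamma> (\<beta> \<tau> \<rho>) \<in> carrier A"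
    "\<beta> \<gamma> \<tau> \<in> carrier A" "\<beta> (mor_comp \<gamma> \<tau>) \<rho> \<in> carrier A" "\<beta> \<gamma> (mor_comp \<tau> \<rho>) \<in> carrier A"
    using in_dom assms True rng_props(1)[of \<gamma>] map_carrier[of \<gamma>] cocycle_closed[of \<gamma> \<tau>]
      cocycle_closed[of "mor_comp \<gamma> \<tau>" \<rho>] cocycle_closed[of \<gamma> "mor_comp \<tau> \<rho>"]
    by (auto simp: comp_closed)
  note c = this
  have "a \<otimes> ?b \<otimes> \<beta> \<gamma> \<tau> \<otimes> ?c \<otimes> \<beta> (mor_comp \<gamma> \<tau>) \<rho> = a \<otimes> ?b \<otimes> ?c \<otimes> (\<beta> \<gamma> \<tau> \<otimes> \<beta> (mor_comp \<gamma> \<tau>) \<rho>)"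
    using c by (simp add: m_ac)
  also have "\<dots> = a \<otimes> (?b \<otimes> ?c \<otimes> mor_map \<gamma> (\<beta> \<tau> \<rho>)) \<otimes> \<beta> \<gamma> (mor_comp \<tau> \<rho>)"
    using c cocycle_assoc[of \<gamma> \<tau> \<rho>] assms True by (simp add: m_ac)
  also have "?b \<otimes> ?c \<otimes> mor_map \<gamma> (\<beta> \<tau> \<rho>) = mor_map \<gamma> (b \<otimes> mor_map \<tau> c \<otimes> \<beta> \<tau> \<rho>)"
    using in_dom assms by (simp add: map_mult dom_props)
  finally show ?thesis
    using True assms mon_mult_coeff[of \<gamma> \<tau> a b] mon_mult_coeff[of \<tau> \<rho> b c] in_dom
    by (simp add: mon_mult_mon comp_closed mor_comp_assoc)
next
  case False
  then show ?thesis
    using assms mon_mult_coeff[of \<gamma> \<tau> a b] mon_mult_coeff[of \<tau> \<rho> b c]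
    by (auto simp: mon_mult_mon comp_closed mult_CP_zero)
qed

lemma rng_CP: "rng CP"
proof (intro rng.intro abelian_group_CP rng_axioms.intro)
  fix f g h assume "f \<in> carrier CP" and g: "g \<in> carrier CP" and h: "h \<in> carrier CP"
  then show "(f \<otimes>\<^bsub>CP\<^esub> g) \<otimes>\<^bsub>CP\<^esub> h = f \<otimes>\<^bsub>CP\<^esub> (g \<otimes>\<^bsub>CP\<^esub> h)"
  proof (induction f rule: CP_induct)
    case \<gamma>: (mon \<gamma> a)
    show ?case using g
    proof (induction g rule: CP_induct)
      case \<tau>: (mon \<tau> b)
      show ?case using h
      proof (induction h rule: CP_induct)
        case (mon \<rho> c)
        then show ?case by (simp add: \<gamma> \<tau> mon_assoc)
      qed (simp_all add: mult_CP_zero CP_r_distr mon_closed mult_CP_closed \<gamma> \<tau>)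
    qed (use h in \<open>simp_all add: mult_CP_zero CP_r_distr CP_l_distr mon_closed mult_CP_closed \<gamma>\<close>)
  qed (use g h in \<open>simp_all add: mult_CP_zero CP_l_distr mult_CP_closed\<close>)
qed (simp_all add: mult_CP_closed CP_l_distr CP_r_distr)

text \<open>The inverse of \<open>u\<^sub>\<gamma>\<close> relative to the local idempotents. The
  product of \<open>u\<close> at \<open>\<gamma>\<^sup>-\<^sup>1\<close> with
  \<open>u\<^sub>\<gamma>\<close> is a cocycle value times an idempotent, and this value is divided
  out.\<close>

definition inv_mon :: "'a mor \<Rightarrow> 'a mor \<Rightarrow> 'a" where
  "inv_mon \<gamma> = mon (inv (\<beta> (mor_inv \<gamma>) \<gamma>)) (mor_inv \<gamma>)"

lemma inv_coeff:
  assumes "\<gamma> \<in> \<Gamma>"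
  shows "inv (\<beta> (mor_inv \<gamma>) \<gamma>) \<in> mor_dom \<gamma>" "inv (\<beta> (mor_inv \<gamma>) \<gamma>) \<otimes> \<beta> (mor_inv \<gamma>) \<gamma> = \<one>"
  using subfield_m_inv[OF subfield_dom[OF assms], of "\<beta> (mor_inv \<gamma>) \<gamma>"]
    cocycle_closed[of "mor_inv \<gamma>" \<gamma>] cocycle_nonzero[of "mor_inv \<gamma>" \<gamma>] assms
  by (auto simp: inv_closed)

lemma inv_mon_closed: "\<gamma> \<in> \<Gamma> \<Longrightarrow> inv_mon \<gamma> \<in> carrier CP"
  unfolding inv_mon_def by (intro mon_closed) (auto simp: inv_closed inv_coeff)

lemma inv_mon_mult:
  assumes "\<gamma> \<in> \<Gamma>"
  shows "inv_mon \<gamma> \<otimes>\<^bsub>CP\<^esub> unit_mon \<gamma> = idem (mor_dom \<gamma>)"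
proof -
  have "inv (\<beta> (mor_inv \<gamma>) \<gamma>) \<in> carrier A"
    using inv_coeff(1)[OF assms] dom_props(1)[OF assms] by blast
  then show ?thesis
    using inv_coeff[OF assms] assms map_one[OF inv_closed[OF assms]]
    by (simp add: inv_mon_def mon_mult_mon inv_closed rng_props)
qed

text \<open>The cocycle identity for \<open>\<gamma>, \<gamma>\<^sup>-\<^sup>1, \<gamma>\<close> makes the left inverse also a right inverse.\<close>

lemma mult_inv_mon:
  assumes "\<gamma> \<in> \<Gamma>"
  shows "unit_mon \<gamma> \<otimes>\<^bsub>CP\<^esub> inv_mon \<gamma> = idem (mor_rng \<gamma>)"
proof -
  let ?b = "\<beta> (mor_inv \<gamma>) \<gamma>"
  have b: "?b \<in> mor_dom \<gamma>" using cocycle_closed[of "mor_inv \<gamma>" \<gamma>] assms by (simp add: inv_closed)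
  have "\<beta> \<gamma> (mor_inv \<gamma>) \<otimes> \<beta> (mor_id (mor_rng \<gamma>)) \<gamma> = mor_map \<gamma> ?b \<otimes> \<beta> \<gamma> (mor_id (mor_dom \<gamma>))"
    using cocycle_assoc[of \<gamma> "mor_inv \<gamma>" \<gamma>] assms by (simp add: inv_closed)
  then have eq: "\<beta> \<gamma> (mor_inv \<gamma>) = mor_map \<gamma> ?b"
    using assms b map_carrier[OF assms b] cocycle_closed[of \<gamma> "mor_inv \<gamma>"] rng_props(1)[OF assms]
    by (auto simp: inv_closed)
  have "mor_map \<gamma> (inv ?b) \<otimes> mor_map \<gamma> ?b = \<one>"
    using map_mult[OF assms inv_coeff(1)[OF assms] b] inv_coeff(2)[OF assms] map_one[OF assms] by simp
  then show ?thesis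
    using assms inv_coeff(1)[OF assms] map_carrier[OF assms inv_coeff(1)[OF assms]]
    by (simp add: inv_mon_def mon_mult_mon inv_closed rng_props eq)
qed

lemma idem_closed: "\<gamma> \<in> \<Gamma> \<Longrightarrow> idem (mor_rng \<gamma>) \<in> carrier CP"
  by (intro unit_mon_closed id_rng)

lemma idem_mult_mon:
  assumes "\<gamma> \<in> \<Gamma>" "a \<in> mor_rng \<gamma>"
  shows "idem (mor_rng \<gamma>) \<otimes>\<^bsub>CP\<^esub> mon a \<gamma> = mon a \<gamma>"
  using assms subsetD[OF rng_props(1), of \<gamma> a] by (simp add: mon_mult_mon id_rng rng_props)

lemma mon_mult_idem:
  assumes "\<gamma> \<in> \<Gamma>" "a \<in> mor_rng \<gamma>"
  shows "mon a \<gamma> \<otimes>\<^bsub>CP\<^esub> idem (mor_dom \<gamma>) = mon a \<gamma>"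
  using assms subsetD[OF rng_props(1), of \<gamma> a] by (simp add: mon_mult_mon id_dom dom_props map_one)

end

section \<open>The subring supported on a wide subgroupoid\<close>

locale field_groupoid_pair = field_groupoid A \<Gamma> \<beta> for A (structure) and \<Gamma> \<beta> +
  fixes \<Delta> :: "'a mor set"
  assumes wide: "wide_subgroupoid \<Delta> \<Gamma>"
begin

lemma sub_closed: "\<delta> \<in> \<Delta> \<Longrightarrow> \<delta> \<in> \<Gamma>"
  and sub_id_dom: "\<gamma> \<in> \<Gamma> \<Longrightarrow> mor_id (mor_dom \<gamma>) \<in> \<Delta>"
  and sub_comp: "\<lbrakk>\<gamma> \<in> \<Delta>; \<tau> \<in> \<Delta>; mor_dom \<gamma> = mor_rng \<tau>\<rbrakk> \<Longrightarrow> mor_comp \<gamma> \<tau> \<in> \<Delta>"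
  using wide by (auto simp: wide_subgroupoid_def)

text \<open>The inverse supplied by \<Delta> is also an inverse in \<Gamma>, where inverses are
  unique.\<close>

lemma sub_inv: assumes "\<delta> \<in> \<Delta>" shows "mor_inv \<delta> \<in> \<Delta>"
proof -
  obtain \<tau> where "\<tau> \<in> \<Delta>" "mor_dom \<tau> = mor_rng \<delta>" "mor_rng \<tau> = mor_dom \<delta>"
    "mor_comp \<delta> \<tau> = mor_id (mor_rng \<delta>)"
    using wide assms by (auto simp: wide_subgroupoid_def)
  then show ?thesis
    using inv_eqI[of \<delta> \<tau>] assms by (simp add: sub_closed)
qed

sublocale sub: field_groupoid A \<Delta> \<beta>
proof (intro field_groupoid.intro field_axioms field_groupoid_axioms.intro)
  show "wide_subgroupoid \<Delta> \<Delta>"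
    using wide by (auto simp: wide_subgroupoid_def)
  show "normalized_cocycle \<Delta> \<beta>"
    using cocycle sub_closed by (auto simp: normalized_cocycle_def)
qed (auto simp: sub_closed subfield_dom map_extensional map_add map_mult map_one)

text \<open>The formulas for sum and product do not mention the groupoid, so only the carriers have
  to be compared; a function supported on \<Delta> takes the value zero on the rest of \<Gamma>, and
  zero lies in every range field.\<close>

lemma subrng_CP: "subrng sub.CP CP"
proof -
  have "f \<in> carrier CP" if "f \<in> carrier sub.CP" for f
  proof -
    have "f \<gamma> \<in> mor_rng \<gamma>" if "\<gamma> \<in> \<Gamma>" for \<gamma>
      using sub.CP_rng[OF \<open>f \<in> carrier sub.CP\<close>] sub.CP_outside[OF \<open>f \<in> carrier sub.CP\<close>]
        rng_props(2)[OF that] by (cases "\<gamma> \<in> \<Delta>") auto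
    moreover have "f \<gamma> = \<zero>" if "\<gamma> \<notin> \<Gamma>" for \<gamma>
      using sub.CP_outside[OF \<open>f \<in> carrier sub.CP\<close>] sub_closed that by blast
    ultimately show ?thesis
      using sub.CP_finite[OF that] by (simp add: carrier_CP)
  qed
  moreover have "x \<oplus>\<^bsub>sub.CP\<^esub> y = x \<oplus>\<^bsub>CP\<^esub> y" "x \<otimes>\<^bsub>sub.CP\<^esub> y = x \<otimes>\<^bsub>CP\<^esub> y" for x y
    by (simp_all add: object_crossed_product_def)
  ultimately show ?thesis
    unfolding subrng_def using sub.rng_CP by blast
qed

sublocale tensor: rng_tensor CP sub.CP
  using rng_CP subrng_CP by (intro rng_tensor.intro rng_tensor_axioms.intro) (simp_all add: subrng_def)

end

section \<open>Separability bounds the index\<close>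

text \<open>On \<open>B\<close> the map \<open>f\<close> factors through \<open>g\<close>, by
  choosing a preimage of every value of \<open>g\<close>.\<close>

lemma finite_image_if_determined:
  assumes "finite (g ` B)" "\<And>x y. \<lbrakk>x \<in> B; y \<in> B; g x = g y\<rbrakk> \<Longrightarrow> f x = f y"
  shows "finite (f ` B)"
proof -
  have "f ` B \<subseteq> (\<lambda>v. f (SOME x. x \<in> B \<and> g x = v)) ` (g ` B)"
  proof
    fix y assume "y \<in> f ` B"
    then obtain x where x: "x \<in> B" "y = f x" by blast
    then have "\<exists>x'. x' \<in> B \<and> g x' = g x" by blast
    from someI_ex[OF this] have "f (SOME x'. x' \<in> B \<and> g x' = g x) = f x"
      using assms(2) x(1) by blast
    then show "y \<in> (\<lambda>v. f (SOME x. x \<in> B \<and> g x = v)) ` (g ` B)"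
      using x by force
  qed
  then show ?thesis using assms(1) finite_surj by blast
qed

section \<open>Projections to sets of morphisms\<close>

context field_groupoid
begin

definition part :: "'a mor set \<Rightarrow> ('a mor \<Rightarrow> 'a) \<Rightarrow> 'a mor \<Rightarrow> 'a" where
  "part c f = (\<lambda>\<gamma>. if \<gamma> \<in> c then f \<gamma> else \<zero>)"

lemma part_closed: assumes "f \<in> carrier CP" shows "part c f \<in> carrier CP"
  unfolding carrier_CP
proof (intro conjI ballI allI impI)
  show "part c f \<gamma> \<in> mor_rng \<gamma>" if "\<gamma> \<in> \<Gamma>" for \<gamma>
    using CP_rng[OF assms that] rng_props(2)[OF that] by (simp add: part_def)
  show "part c f \<gamma> = \<zero>" if "\<gamma> \<notin> \<Gamma>" for \<gamma>
    using CP_outside[OF assms that] by (simp add: part_def)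
  show "finite {\<gamma>. part c f \<gamma> \<noteq> \<zero>}"
    by (rule finite_subset[OF _ CP_finite[OF assms]]) (auto simp: part_def)
qed

lemma part_zero: "part c \<zero>\<^bsub>CP\<^esub> = \<zero>\<^bsub>CP\<^esub>"
  by (auto simp: part_def zero_CP)

lemma part_add: "part c (f \<oplus>\<^bsub>CP\<^esub> g) = part c f \<oplus>\<^bsub>CP\<^esub> part c g"
  by (auto simp: part_def add_CP)

lemma part_mon: "part c (mon a \<gamma>) = (if \<gamma> \<in> c then mon a \<gamma> else \<zero>\<^bsub>CP\<^esub>)"
  by (auto simp: part_def mon_def zero_CP)

lemma part_cong: "(\<And>\<gamma>. f \<gamma> \<noteq> \<zero> \<Longrightarrow> \<gamma> \<in> c \<longleftrightarrow> \<gamma> \<in> c') \<Longrightarrow> part c f = part c' f"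
proof
  fix \<gamma> assume "\<And>\<gamma>. f \<gamma> \<noteq> \<zero> \<Longrightarrow> \<gamma> \<in> c \<longleftrightarrow> \<gamma> \<in> c'"
  from this[of \<gamma>] show "part c f \<gamma> = part c' f \<gamma>"
    by (cases "f \<gamma> = \<zero>") (simp_all add: part_def)
qed

lemma part_all: assumes "f \<in> carrier CP" shows "part \<Gamma> f = f"
  by (rule ext) (simp add: part_def CP_outside[OF assms])

lemma part_disjoint_Un:
  assumes "f \<in> carrier CP" "c \<inter> c' = {}"
  shows "part (c \<union> c') f = part c f \<oplus>\<^bsub>CP\<^esub> part c' f"
  by (rule ext) (use assms(2) in \<open>auto simp: part_def add_CP CP_carrier[OF assms(1)]\<close>)

definition translate :: "'a mor \<Rightarrow> 'a mor set \<Rightarrow> 'a mor set" where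
  "translate \<tau> c = {mor_comp \<tau> \<gamma> | \<gamma>. \<gamma> \<in> c \<and> mor_rng \<gamma> = mor_dom \<tau>}"

text \<open>Left multiplication by \<open>u\<^sub>\<tau>\<close> moves the coefficient at \<gamma>
  to \<tau>\<gamma>, and left cancellation keeps the translates of \<open>c\<close> and of its
  complement apart.\<close>

lemma part_translate:
  assumes "\<tau> \<in> \<Gamma>" "c \<subseteq> \<Gamma>" "f \<in> carrier CP"
  shows "part (translate \<tau> c) (unit_mon \<tau> \<otimes>\<^bsub>CP\<^esub> f) = unit_mon \<tau> \<otimes>\<^bsub>CP\<^esub> part c f"
  using assms(3)
proof (induction f rule: CP_induct)
  case (mon \<gamma> a)
  have "mor_comp \<tau> \<gamma> \<in> translate \<tau> c \<longleftrightarrow> \<gamma> \<in> c" if "mor_dom \<tau> = mor_rng \<gamma>"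
  proof
    assume "mor_comp \<tau> \<gamma> \<in> translate \<tau> c"
    then obtain \<gamma>' where g: "\<gamma>' \<in> c" "mor_rng \<gamma>' = mor_dom \<tau>" "mor_comp \<tau> \<gamma> = mor_comp \<tau> \<gamma>'"
      unfolding translate_def by blast
    then have "\<gamma> = \<gamma>'"
      using comp_cancel_left[OF assms(1) mon(1) subsetD[OF assms(2) g(1)] that _ g(3)] by simp
    then show "\<gamma> \<in> c" using g(1) by simp
  next
    assume "\<gamma> \<in> c"
    with that[symmetric] show "mor_comp \<tau> \<gamma> \<in> translate \<tau> c"
      unfolding translate_def by blast
  qed
  then show ?case
    using mon assms(1) by (simp add: mon_mult_mon rng_props part_mon part_zero mult_CP_zero)
qed (use assms(1) in \<open>simp_all add: mult_CP_zero part_zero CP_r_distr part_add unit_mon_closed part_closed\<close>)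

end

context field_groupoid_pair
begin

text \<open>These are the unions of left cosets of \<Delta>; for them the projection
  \<open>part c\<close> is right linear over the subring.\<close>

definition stable :: "'a mor set \<Rightarrow> bool" where
  "stable c \<longleftrightarrow> c \<subseteq> \<Gamma> \<and> (\<forall>\<gamma>\<in>c. \<forall>\<delta>\<in>\<Delta>. mor_dom \<gamma> = mor_rng \<delta> \<longrightarrow> mor_comp \<gamma> \<delta> \<in> c)"

lemma stable_comp_iff:
  assumes "stable c" "\<gamma> \<in> \<Gamma>" "\<delta> \<in> \<Delta>" "mor_dom \<gamma> = mor_rng \<delta>"
  shows "mor_comp \<gamma> \<delta> \<in> c \<longleftrightarrow> \<gamma> \<in> c"
proof
  assume c: "mor_comp \<gamma> \<delta> \<in> c"
  have "mor_comp (mor_comp \<gamma> \<delta>) (mor_inv \<delta>) \<in> c"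
    using assms(1) c sub_inv[OF assms(3)] sub_closed[OF assms(3)] unfolding stable_def by simp
  also have "mor_comp (mor_comp \<gamma> \<delta>) (mor_inv \<delta>) = \<gamma>"
    using assms sub_closed[OF assms(3)] by (simp add: mor_comp_assoc flip: assms(4))
  finally show "\<gamma> \<in> c" .
qed (use assms in \<open>auto simp: stable_def\<close>)

text \<open>On homogeneous elements this is \<open>stable_comp_iff\<close>: passing from \<gamma> to
  \<gamma>\<delta> neither enters nor leaves \<open>c\<close>. Both sides are additive in both
  arguments.\<close>

lemma part_mult_stable:
  assumes "stable c" "f \<in> carrier CP" "s \<in> carrier sub.CP"
  shows "part c (f \<otimes>\<^bsub>CP\<^esub> s) = part c f \<otimes>\<^bsub>CP\<^esub> s"
  using assms(3)
proof (induction s rule: sub.CP_induct)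
  case zero
  then show ?case by (simp add: zero_CP[symmetric] sub.zero_CP mult_CP_zero part_zero)
next
  case \<delta>: (mon \<delta> b)
  then have \<delta>': "\<delta> \<in> \<Gamma>" by (simp add: sub_closed)
  show ?case
    using assms(2)
  proof (induction f rule: CP_induct)
    case (mon \<gamma> a)
    then show ?case
      using \<delta> \<delta>' stable_comp_iff[OF assms(1) mon(1) \<delta>(1)]
      by (simp add: mon_mult_mon part_mon part_zero mult_CP_zero)
  qed (simp_all add: mult_CP_zero part_zero CP_l_distr part_add mon_closed part_closed \<delta> \<delta>')
next
  case (add f' g')
  have *: "f' \<oplus>\<^bsub>sub.CP\<^esub> g' = f' \<oplus>\<^bsub>CP\<^esub> g'" by (simp add: add_CP sub.add_CP)
  show ?case
    using add assms(2) tensor.S_closed unfolding * by (simp add: CP_r_distr part_add part_closed)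
qed

lemma stable_all: "stable \<Gamma>"
  using comp_closed sub_closed by (auto simp: stable_def)

lemma stable_translate:
  assumes "stable c" "\<tau> \<in> \<Gamma>" shows "stable (translate \<tau> c)"
  unfolding stable_def
proof (intro conjI ballI impI)
  show "translate \<tau> c \<subseteq> \<Gamma>"
    using assms comp_closed[OF assms(2)] unfolding translate_def stable_def by auto
  fix \<gamma> \<delta> assume "\<gamma> \<in> translate \<tau> c" "\<delta> \<in> \<Delta>" "mor_dom \<gamma> = mor_rng \<delta>"
  then obtain \<gamma>' where g: "\<gamma>' \<in> c" "mor_rng \<gamma>' = mor_dom \<tau>" "\<gamma> = mor_comp \<tau> \<gamma>'"
    unfolding translate_def by blast
  have "mor_dom \<gamma>' = mor_rng \<delta>" using g(3) \<open>mor_dom \<gamma> = mor_rng \<delta>\<close> by simp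
  then have "mor_comp \<gamma>' \<delta> \<in> c" "mor_rng (mor_comp \<gamma>' \<delta>) = mor_dom \<tau>"
      "mor_comp \<gamma> \<delta> = mor_comp \<tau> (mor_comp \<gamma>' \<delta>)"
    using assms(1) g \<open>\<delta> \<in> \<Delta>\<close> by (auto simp: stable_def mor_comp_assoc)
  then show "mor_comp \<gamma> \<delta> \<in> translate \<tau> c"
    unfolding translate_def by blast
qed

text \<open>For \<open>\<Delta>\<close>-stable \<open>c\<close>, projecting the left factor to the span of the \<open>u\<^sub>\<gamma>\<close>, \<open>\<gamma> \<in> c\<close>, and then
  multiplying is well defined on the tensor product over \<open>\<Delta>\<close>.\<close>

definition part_mu :: "'a mor set \<Rightarrow> ((('a mor \<Rightarrow> 'a) \<times> ('a mor \<Rightarrow> 'a)) \<Rightarrow>\<^sub>0 int) \<Rightarrow> 'a mor \<Rightarrow> 'a" where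
  "part_mu c = tensor.frag_eval (\<lambda>p. part c (fst p) \<otimes>\<^bsub>CP\<^esub> snd p)"

lemma part_mu_Pi: "(\<lambda>p. part c (fst p) \<otimes>\<^bsub>CP\<^esub> snd p) \<in> tensor.pairs \<rightarrow> carrier CP"
  by (rule Pi_I) (simp add: mem_Times_iff part_closed mult_CP_closed)

lemma part_mu_closed: "Poly_Mapping.keys z \<subseteq> tensor.pairs \<Longrightarrow> part_mu c z \<in> carrier CP"
  unfolding part_mu_def by (rule tensor.frag_eval_closed[OF _ part_mu_Pi])

lemma part_mu_teq:
  assumes "stable c" "tensor.teq z w" "Poly_Mapping.keys w \<subseteq> tensor.pairs"
  shows "part_mu c z = part_mu c w"
  unfolding part_mu_def
proof (rule tensor.frag_eval_teq[OF part_mu_Pi _ _ _ assms(2,3)])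
  show "part c (fst (x \<otimes>\<^bsub>CP\<^esub> s, y)) \<otimes>\<^bsub>CP\<^esub> snd (x \<otimes>\<^bsub>CP\<^esub> s, y) = part c (fst (x, s \<otimes>\<^bsub>CP\<^esub> y)) \<otimes>\<^bsub>CP\<^esub> snd (x, s \<otimes>\<^bsub>CP\<^esub> y)"
    if "x \<in> carrier CP" "s \<in> carrier sub.CP" "y \<in> carrier CP" for x s y
    using that by (simp add: part_mult_stable[OF assms(1)] tensor.S_closed tensor.m_assoc part_closed)
qed (simp_all add: part_add CP_l_distr CP_r_distr part_closed)

lemma part_mu_lmul:
  assumes "\<tau> \<in> \<Gamma>" "c \<subseteq> \<Gamma>" "Poly_Mapping.keys z \<subseteq> tensor.pairs"
  shows "part_mu (translate \<tau> c) (tensor.lmul (unit_mon \<tau>) z) = unit_mon \<tau> \<otimes>\<^bsub>CP\<^esub> part_mu c z"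
  unfolding part_mu_def tensor.lmul_def
proof (rule tensor.frag_eval_hom_eqI[OF assms(3) part_mu_Pi _ part_mu_Pi])
  fix p assume p: "p \<in> tensor.pairs"
  then show "Poly_Mapping.keys (case p of (x, y) \<Rightarrow> frag_of (unit_mon \<tau> \<otimes>\<^bsub>CP\<^esub> x, y)) \<subseteq> tensor.pairs"
    by (cases p) (simp add: mult_CP_closed unit_mon_closed assms(1))
  show "tensor.frag_eval (\<lambda>p. part (translate \<tau> c) (fst p) \<otimes>\<^bsub>CP\<^esub> snd p)
      (case p of (x, y) \<Rightarrow> frag_of (unit_mon \<tau> \<otimes>\<^bsub>CP\<^esub> x, y)) = unit_mon \<tau> \<otimes>\<^bsub>CP\<^esub> (part c (fst p) \<otimes>\<^bsub>CP\<^esub> snd p)"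
    using p by (cases p)
      (simp add: mult_CP_closed unit_mon_closed assms(1,2) part_closed part_translate tensor.m_assoc)
qed (simp_all add: mult_CP_closed unit_mon_closed assms(1) tensor.mult_diff)

lemma part_mu_rmul:
  assumes "a \<in> carrier CP" "Poly_Mapping.keys z \<subseteq> tensor.pairs"
  shows "part_mu c (tensor.rmul a z) = part_mu c z \<otimes>\<^bsub>CP\<^esub> a"
  unfolding part_mu_def tensor.rmul_def
proof (rule tensor.frag_eval_hom_eqI[where \<phi> = "\<lambda>y. y \<otimes>\<^bsub>CP\<^esub> a", OF assms(2) part_mu_Pi _ part_mu_Pi])
  fix p assume p: "p \<in> tensor.pairs"
  then show "Poly_Mapping.keys (case p of (x, y) \<Rightarrow> frag_of (x, y \<otimes>\<^bsub>CP\<^esub> a)) \<subseteq> tensor.pairs"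
    by (cases p) (simp add: mult_CP_closed assms(1))
  show "tensor.frag_eval (\<lambda>p. part c (fst p) \<otimes>\<^bsub>CP\<^esub> snd p)
      (case p of (x, y) \<Rightarrow> frag_of (x, y \<otimes>\<^bsub>CP\<^esub> a)) = (part c (fst p) \<otimes>\<^bsub>CP\<^esub> snd p) \<otimes>\<^bsub>CP\<^esub> a"
    using p by (cases p) (simp add: mult_CP_closed assms(1) part_closed tensor.m_assoc)
qed (simp_all add: mult_CP_closed assms(1) tensor.mult_diff)

lemma part_mu_cong:
  assumes "Poly_Mapping.keys z \<subseteq> tensor.pairs"
    and "\<And>x y. (x, y) \<in> Poly_Mapping.keys z \<Longrightarrow> part c x = part c' x"
  shows "part_mu c z = part_mu c' z"
  unfolding part_mu_def
proof (rule tensor.frag_eval_cong[OF assms(1) part_mu_Pi])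
  fix p assume "p \<in> Poly_Mapping.keys z"
  then show "part c (fst p) \<otimes>\<^bsub>CP\<^esub> snd p = part c' (fst p) \<otimes>\<^bsub>CP\<^esub> snd p"
    using assms(2)[of "fst p" "snd p"] by simp
qed

lemma part_mu_Un:
  assumes "c \<inter> c' = {}" "Poly_Mapping.keys z \<subseteq> tensor.pairs"
  shows "part_mu (c \<union> c') z = part_mu c z \<oplus>\<^bsub>CP\<^esub> part_mu c' z"
  using assms(2)
proof (induction z rule: free_Abelian_group_induct[consumes 1, case_names zero diff frag])
  case zero
  then show ?case by (simp add: part_mu_def)
next
  case (diff z w)
  have d: "part_mu e (z - w) = part_mu e z \<ominus>\<^bsub>CP\<^esub> part_mu e w" for e
    unfolding part_mu_def by (rule tensor.frag_eval_diff[OF diff(1,2) part_mu_Pi])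
  show ?case
    using part_mu_closed[OF diff(1)] part_mu_closed[OF diff(2)] diff(3,4)
    by (simp add: d a_minus_def tensor.minus_add tensor.a_ac)
next
  case (frag p)
  then have "part_mu e (frag_of p) = part e (fst p) \<otimes>\<^bsub>CP\<^esub> snd p" for e
    unfolding part_mu_def by (intro tensor.frag_eval_frag_of) (simp add: mem_Times_iff part_closed mult_CP_closed)
  then show ?case
    using frag assms(1) by (simp add: mem_Times_iff part_disjoint_Un CP_l_distr part_closed)
qed

text \<open>The empty set is disjoint from itself, so additivity gives v = v + v.\<close>

lemma part_mu_empty: assumes "Poly_Mapping.keys z \<subseteq> tensor.pairs" shows "part_mu {} z = \<zero>\<^bsub>CP\<^esub>"
  using part_mu_Un[of "{}" "{}" z] part_mu_closed[OF assms, of "{}"] assms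
    tensor.add.l_cancel_one[of "part_mu {} z" "part_mu {} z"] by simp

section \<open>Left cosets of the subgroupoid and their translates\<close>

definition left_coset :: "'a mor \<Rightarrow> 'a mor set" where
  "left_coset \<gamma> = {mor_comp \<gamma> \<delta> | \<delta>. \<delta> \<in> \<Delta> \<and> mor_rng \<delta> = mor_dom \<gamma>}"

lemma left_coset_self: assumes "\<gamma> \<in> \<Gamma>" shows "\<gamma> \<in> left_coset \<gamma>"
  unfolding left_coset_def
  by (intro CollectI exI[of _ "mor_id (mor_dom \<gamma>)"]) (simp add: assms sub_id_dom)

lemma left_coset_subset: assumes "\<gamma> \<in> \<Gamma>" shows "left_coset \<gamma> \<subseteq> \<Gamma>"
  using comp_closed[OF assms] sub_closed unfolding left_coset_def by auto

lemma left_coset_rng: "\<gamma>' \<in> left_coset \<gamma> \<Longrightarrow> mor_rng \<gamma>' = mor_rng \<gamma>"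
  unfolding left_coset_def by auto

lemma stable_left_coset: assumes "\<gamma> \<in> \<Gamma>" shows "stable (left_coset \<gamma>)"
  unfolding stable_def
proof (intro conjI ballI impI left_coset_subset[OF assms])
  fix \<gamma>' \<delta> assume "\<gamma>' \<in> left_coset \<gamma>" and \<delta>: "\<delta> \<in> \<Delta>" "mor_dom \<gamma>' = mor_rng \<delta>"
  then obtain \<delta>' where d: "\<delta>' \<in> \<Delta>" "mor_rng \<delta>' = mor_dom \<gamma>" "\<gamma>' = mor_comp \<gamma> \<delta>'"
    unfolding left_coset_def by blast
  have dd: "mor_dom \<delta>' = mor_rng \<delta>" using d(3) \<delta>(2) by simp
  show "mor_comp \<gamma>' \<delta> \<in> left_coset \<gamma>"
    unfolding left_coset_def
    by (intro CollectI exI[of _ "mor_comp \<delta>' \<delta>"]) (simp add: d dd \<delta>(1) sub_comp mor_comp_assoc)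
qed

lemma left_coset_eq:
  assumes "\<gamma> \<in> \<Gamma>" "\<gamma>' \<in> left_coset \<gamma>" shows "left_coset \<gamma>' = left_coset \<gamma>"
proof -
  obtain \<delta> where d: "\<delta> \<in> \<Delta>" "mor_rng \<delta> = mor_dom \<gamma>" "\<gamma>' = mor_comp \<gamma> \<delta>"
    using assms(2) unfolding left_coset_def by blast
  have "mor_comp \<gamma>' \<epsilon> \<in> left_coset \<gamma>" if "\<epsilon> \<in> \<Delta>" "mor_rng \<epsilon> = mor_dom \<gamma>'" for \<epsilon>
    using stable_left_coset[OF assms(1)] assms(2) that unfolding stable_def by simp
  moreover have "mor_comp \<gamma> \<epsilon> \<in> left_coset \<gamma>'" if "\<epsilon> \<in> \<Delta>" "mor_rng \<epsilon> = mor_dom \<gamma>" for \<epsilon>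
  proof -
    have "mor_comp \<gamma>' (mor_comp (mor_inv \<delta>) \<epsilon>) = mor_comp \<gamma> \<epsilon>"
      using d that by (simp add: mor_comp_assoc sub_closed)
    moreover have "mor_comp (mor_inv \<delta>) \<epsilon> \<in> \<Delta>" "mor_rng (mor_comp (mor_inv \<delta>) \<epsilon>) = mor_dom \<gamma>'"
      using d that by (simp_all add: sub_comp sub_inv sub_closed)
    ultimately show ?thesis
      unfolding left_coset_def
      by (intro CollectI exI[of _ "mor_comp (mor_inv \<delta>) \<epsilon>"] conjI) simp_all
  qed
  ultimately show ?thesis unfolding left_coset_def by blast
qed

lemma translate_left_coset:
  assumes "\<tau> \<in> \<Gamma>" "\<gamma> \<in> \<Gamma>" "mor_dom \<tau> = mor_rng \<gamma>"
  shows "translate \<tau> (left_coset \<gamma>) = left_coset (mor_comp \<tau> \<gamma>)"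
proof -
  have a: "mor_comp \<tau> (mor_comp \<gamma> \<delta>) = mor_comp (mor_comp \<tau> \<gamma>) \<delta>" if "mor_rng \<delta> = mor_dom \<gamma>" for \<delta>
    using that by (simp add: mor_comp_assoc)
  show ?thesis
  proof (intro equalityI subsetI)
    fix x assume "x \<in> translate \<tau> (left_coset \<gamma>)"
    then obtain \<delta> where d: "\<delta> \<in> \<Delta>" "mor_rng \<delta> = mor_dom \<gamma>" "x = mor_comp \<tau> (mor_comp \<gamma> \<delta>)"
      unfolding translate_def left_coset_def by blast
    show "x \<in> left_coset (mor_comp \<tau> \<gamma>)"
      unfolding left_coset_def by (intro CollectI exI[of _ \<delta>]) (simp add: a d)
  next
    fix x assume "x \<in> left_coset (mor_comp \<tau> \<gamma>)"
    then obtain \<delta> where d: "\<delta> \<in> \<Delta>" "mor_rng \<delta> = mor_dom \<gamma>" "x = mor_comp (mor_comp \<tau> \<gamma>) \<delta>"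
      unfolding left_coset_def by auto
    then have "mor_comp \<gamma> \<delta> \<in> left_coset \<gamma>" unfolding left_coset_def by blast
    moreover have "mor_rng (mor_comp \<gamma> \<delta>) = mor_dom \<tau>" using d assms(3) by simp
    ultimately show "x \<in> translate \<tau> (left_coset \<gamma>)"
      unfolding translate_def d(3) a[OF d(2), symmetric] by blast
  qed
qed

text \<open>Meant contrapositively: a nonzero value on a finite disjoint union forces a nonzero
  value on one of its members.\<close>

lemma part_mu_Union_zero:
  assumes "finite \<C>" "disjoint \<C>" "\<And>c. c \<in> \<C> \<Longrightarrow> part_mu c z = \<zero>\<^bsub>CP\<^esub>"
    and k: "Poly_Mapping.keys z \<subseteq> tensor.pairs"
  shows "part_mu (\<Union>\<C>) z = \<zero>\<^bsub>CP\<^esub>"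
  using assms(1-3)
proof (induction \<C>)
  case empty
  then show ?case by (simp add: part_mu_empty[OF k])
next
  case (insert c \<C>)
  have "c \<inter> \<Union>\<C> = {}"
    using insert.prems(1) insert.hyps(2) by (auto simp: disjoint_def)
  moreover have "part_mu (\<Union>\<C>) z = \<zero>\<^bsub>CP\<^esub>"
    using insert by (auto simp: disjoint_def)
  ultimately show ?case
    using insert.prems(2) part_mu_Un[of c "\<Union>\<C>" z] k by simp
qed

lemma finite_index_if_separable:
  assumes sep: "separable_rng_extension CP sub.CP" and E: "mor_id E \<in> \<Gamma>"
  shows "\<exists>\<gamma>\<in>\<Gamma>. mor_rng \<gamma> = E \<and>
    finite {left_coset (mor_comp \<tau> \<gamma>) | \<tau>. \<tau> \<in> \<Gamma> \<and> mor_dom \<tau> = E \<and> mor_rng \<tau> = E}"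
proof -
  obtain \<delta> where hom: "\<delta> \<in> hom (add_monoid CP) (tensor_product CP sub.CP)"
    and left: "\<And>a x. \<lbrakk>a \<in> carrier CP; x \<in> carrier CP\<rbrakk> \<Longrightarrow> \<delta> (a \<otimes>\<^bsub>CP\<^esub> x) = tensor_lmult CP sub.CP a (\<delta> x)"
    and right: "\<And>a x. \<lbrakk>a \<in> carrier CP; x \<in> carrier CP\<rbrakk> \<Longrightarrow> \<delta> (x \<otimes>\<^bsub>CP\<^esub> a) = tensor_rmult CP sub.CP (\<delta> x) a"
    and mu: "\<And>x. x \<in> carrier CP \<Longrightarrow> tensor_mu CP (\<delta> x) = x"
    using sep unfolding separable_rng_extension_def by blast
  have e: "idem E \<in> carrier CP" by (rule unit_mon_closed[OF E])
  have "\<delta> (idem E) \<in> carrier (tensor_product CP sub.CP)"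
    using hom e by (simp add: hom_def Pi_iff)
  then obtain z where z: "Poly_Mapping.keys z \<subseteq> tensor.pairs" "\<delta> (idem E) = tensor.tclass z"
    by (rule tensor.tensor_product_cases)
  have mul: "unit_mon \<tau> \<otimes>\<^bsub>CP\<^esub> idem E = unit_mon \<tau>" "idem E \<otimes>\<^bsub>CP\<^esub> unit_mon \<tau> = unit_mon \<tau>"
    if "\<tau> \<in> \<Gamma>" "mor_dom \<tau> = E" "mor_rng \<tau> = E" for \<tau>
    using mon_mult_idem[of \<tau> \<one>] idem_mult_mon[of \<tau> \<one>] rng_props(3)[of \<tau>] that by simp_all
  \<comment> \<open>The products of \<open>u\<^sub>\<tau>\<close> with \<open>u\<^sub>E\<close> on
    either side are \<open>u\<^sub>\<tau>\<close> itself, so left and right linearity of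
    \<open>\<delta>\<close> compute the same class.\<close>
  have comm: "tensor.teq (tensor.lmul (unit_mon \<tau>) z) (tensor.rmul (unit_mon \<tau>) z)"
    if "\<tau> \<in> \<Gamma>" "mor_dom \<tau> = E" "mor_rng \<tau> = E" for \<tau>
  proof -
    have "tensor.tclass (tensor.lmul (unit_mon \<tau>) z) = tensor.tclass (tensor.rmul (unit_mon \<tau>) z)"
      using left[OF unit_mon_closed e, of \<tau>] right[OF unit_mon_closed e, of \<tau>] mul[OF that] that z(2)
      by (simp add: tensor.tensor_lmult_tclass tensor.tensor_rmult_tclass unit_mon_closed)
    then show ?thesis by (simp only: tensor.tclass_eq_iff)
  qed
  have ez: "tensor.teq (tensor.lmul (idem E) z) z"
  proof -
    have "tensor.tclass (tensor.lmul (idem E) z) = tensor.tclass z"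
      using left[OF e e] mul[OF E] z(2) by (simp add: tensor.tensor_lmult_tclass e)
    then show ?thesis by (simp only: tensor.tclass_eq_iff)
  qed
  \<comment> \<open>The group \<Gamma>(E) acts on the left of morphisms into \<open>E\<close> only.
    Restricting to these loses nothing, since \<open>u\<^sub>E\<close> fixes the class of
    \<open>z\<close>.\<close>
  define \<Gamma>E where "\<Gamma>E = {\<gamma> \<in> \<Gamma>. mor_rng \<gamma> = E}"
  have translate_E: "translate (mor_id E) c = c" if "c \<subseteq> \<Gamma>E" for c
  proof -
    have id: "mor_comp (mor_id E) \<gamma> = \<gamma>" if "\<gamma> \<in> c" for \<gamma>
      using id_comp[of \<gamma>] that \<open>c \<subseteq> \<Gamma>E\<close> unfolding \<Gamma>E_def by blast
    have rng: "mor_rng \<gamma> = E" if "\<gamma> \<in> c" for \<gamma>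
      using that \<open>c \<subseteq> \<Gamma>E\<close> unfolding \<Gamma>E_def by blast
    show ?thesis
    proof (intro equalityI subsetI)
      fix x assume "x \<in> translate (mor_id E) c"
      then obtain \<gamma> where "\<gamma> \<in> c" "x = mor_comp (mor_id E) \<gamma>"
        unfolding translate_def by blast
      then show "x \<in> c" by (simp add: id)
    next
      fix x assume "x \<in> c"
      then show "x \<in> translate (mor_id E) c"
        unfolding translate_def by (intro CollectI exI[of _ x]) (simp add: id rng)
    qed
  qed
  have "part_mu \<Gamma> z = tensor.frag_eval (\<lambda>p. fst p \<otimes>\<^bsub>CP\<^esub> snd p) z"
    unfolding part_mu_def
  proof (rule tensor.frag_eval_cong[OF z(1)])
    show "(\<lambda>p. fst p \<otimes>\<^bsub>CP\<^esub> snd p) \<in> tensor.pairs \<rightarrow> carrier CP"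
      by (rule Pi_I) (simp add: mem_Times_iff mult_CP_closed)
    fix p assume "p \<in> Poly_Mapping.keys z"
    then have "p \<in> tensor.pairs" using z(1) by blast
    then show "part \<Gamma> (fst p) \<otimes>\<^bsub>CP\<^esub> snd p = fst p \<otimes>\<^bsub>CP\<^esub> snd p"
      by (simp add: mem_Times_iff part_all)
  qed
  then have all: "part_mu \<Gamma> z = idem E"
    using mu[OF e] tensor.tensor_mu_tclass[OF z(1)] z(2) by simp
  \<comment> \<open>As a translate of \<Gamma> by an identity, this set falls under
    \<open>part_mu_lmul\<close>, which computes its component from the component at \<Gamma>, that
    is, from the multiplication map.\<close>
  have \<Gamma>E: "\<Gamma>E = translate (mor_id E) \<Gamma>"
  proof
    have "\<Gamma>E = translate (mor_id E) \<Gamma>E" by (simp add: translate_E)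
    also have "\<dots> \<subseteq> translate (mor_id E) \<Gamma>" unfolding translate_def \<Gamma>E_def by blast
    finally show "\<Gamma>E \<subseteq> translate (mor_id E) \<Gamma>" .
    show "translate (mor_id E) \<Gamma> \<subseteq> \<Gamma>E"
      using comp_closed[OF E] unfolding translate_def \<Gamma>E_def by auto
  qed
  have stable_E: "stable \<Gamma>E" unfolding \<Gamma>E by (rule stable_translate[OF stable_all E])
  have "part_mu \<Gamma>E z = part_mu \<Gamma>E (tensor.lmul (idem E) z)"
    by (rule part_mu_teq[OF stable_E ez z(1), symmetric])
  also have "\<dots> = idem E"
    unfolding \<Gamma>E part_mu_lmul[OF E order_refl z(1)] all using mul(1)[OF E] by simp
  finally have part_E: "part_mu \<Gamma>E z = idem E" .
  have nonzero: "idem E \<noteq> \<zero>\<^bsub>CP\<^esub>"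
  proof
    assume "idem E = \<zero>\<^bsub>CP\<^esub>"
    then have "idem E (mor_id E) = \<zero>\<^bsub>CP\<^esub> (mor_id E)" by simp
    then show False by (simp add: mon_def zero_CP)
  qed
  \<comment> \<open>The morphisms occurring in a left factor of the chosen representative. The value
    \<open>part_mu c z\<close> depends on \<open>c \<inter> Z\<close> alone, so it is nonzero for at
    most finitely many cosets.\<close>
  define Z where "Z = (\<Union>p\<in>Poly_Mapping.keys z. {\<gamma>. fst p \<gamma> \<noteq> \<zero>})"
  have "finite {\<gamma>. fst p \<gamma> \<noteq> \<zero>}" if "p \<in> Poly_Mapping.keys z" for p
    using CP_finite[of "fst p"] z(1) that by (auto simp: mem_Times_iff)
  then have Z: "finite Z" by (simp add: Z_def)
  have part_mu_Z: "part_mu c z = part_mu c' z" if "c \<inter> Z = c' \<inter> Z" for c c'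
  proof (rule part_mu_cong[OF z(1)])
    fix x y assume "(x, y) \<in> Poly_Mapping.keys z"
    then have "{\<gamma>. x \<gamma> \<noteq> \<zero>} \<subseteq> Z" by (force simp: Z_def)
    then show "part c x = part c' x" using that by (intro part_cong) blast
  qed
  define \<C> where "\<C> = left_coset ` (Z \<inter> \<Gamma>E)"
  have "disjoint \<C>"
  proof (rule disjointI)
    fix c d assume "c \<in> \<C>" "d \<in> \<C>" "c \<noteq> d"
    then obtain \<gamma> \<gamma>' where g: "\<gamma> \<in> \<Gamma>" "\<gamma>' \<in> \<Gamma>" "c = left_coset \<gamma>" "d = left_coset \<gamma>'"
      unfolding \<C>_def \<Gamma>E_def by blast
    show "c \<inter> d = {}"
      using left_coset_eq[OF g(1)] left_coset_eq[OF g(2)] \<open>c \<noteq> d\<close> unfolding g(3,4) by blast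
  qed
  have C_sub: "left_coset \<gamma> \<subseteq> \<Gamma>E" if "\<gamma> \<in> \<Gamma>E" for \<gamma>
    using that left_coset_subset[of \<gamma>] left_coset_rng[of _ \<gamma>] unfolding \<Gamma>E_def by blast
  have "\<Union>\<C> \<inter> Z = \<Gamma>E \<inter> Z"
    using C_sub left_coset_self unfolding \<C>_def \<Gamma>E_def by blast
  then have "part_mu (\<Union>\<C>) z \<noteq> \<zero>\<^bsub>CP\<^esub>"
    using part_mu_Z[of "\<Union>\<C>" \<Gamma>E] part_E nonzero by simp
  then obtain c where c: "c \<in> \<C>" "part_mu c z \<noteq> \<zero>\<^bsub>CP\<^esub>"
    using part_mu_Union_zero[OF _ \<open>disjoint \<C>\<close> _ z(1)] Z unfolding \<C>_def by blast
  then obtain \<gamma> where \<gamma>: "\<gamma> \<in> \<Gamma>" "mor_rng \<gamma> = E" "c = left_coset \<gamma>"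
    unfolding \<C>_def \<Gamma>E_def by blast
  have c_sub: "c \<subseteq> \<Gamma>" "c \<subseteq> \<Gamma>E" "stable c"
    using left_coset_subset C_sub stable_left_coset \<gamma> unfolding \<Gamma>E_def by blast+
  \<comment> \<open>Needed for cancelling \<open>u\<^sub>\<tau>\<close> below: its inverse times
    \<open>u\<^sub>\<tau>\<close> is only the idempotent at \<open>E\<close>, which has to act as a
    unit on this component.\<close>
  have ec: "idem E \<otimes>\<^bsub>CP\<^esub> part_mu c z = part_mu c z"
    using part_mu_lmul[OF E c_sub(1) z(1)] translate_E[OF c_sub(2)] part_mu_teq[OF c_sub(3) ez z(1)]
    by simp
  have "left_coset (mor_comp \<tau> \<gamma>) \<in> left_coset ` (Z \<inter> \<Gamma>)"
    if \<tau>: "\<tau> \<in> \<Gamma>" "mor_dom \<tau> = E" "mor_rng \<tau> = E" for \<tau>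
  proof -
    have eq: "translate \<tau> c = left_coset (mor_comp \<tau> \<gamma>)"
      unfolding \<gamma>(3) using \<tau> \<gamma> by (intro translate_left_coset) auto
    have \<tau>\<gamma>: "mor_comp \<tau> \<gamma> \<in> \<Gamma>" using \<tau> \<gamma> by (intro comp_closed) auto
    \<comment> \<open>With x the component at \<open>c\<close> and y the one at its translate,
      commutation of \<open>z\<close> with \<open>u\<^sub>\<tau>\<close> gives
      \<open>u\<^sub>\<tau> x = y u\<^sub>\<tau>\<close>; so y = 0 would force x = 0.\<close>
    have "part_mu (translate \<tau> c) z \<noteq> \<zero>\<^bsub>CP\<^esub>"
    proof
      assume 0: "part_mu (translate \<tau> c) z = \<zero>\<^bsub>CP\<^esub>"
      have "unit_mon \<tau> \<otimes>\<^bsub>CP\<^esub> part_mu c z = part_mu (translate \<tau> c) (tensor.lmul (unit_mon \<tau>) z)"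
        by (rule part_mu_lmul[OF \<tau>(1) c_sub(1) z(1), symmetric])
      also have "\<dots> = part_mu (translate \<tau> c) (tensor.rmul (unit_mon \<tau>) z)"
        using \<tau> z(1) unit_mon_closed[OF \<tau>(1)]
        by (intro part_mu_teq stable_translate c_sub comm tensor.keys_rmul)
      also have "\<dots> = \<zero>\<^bsub>CP\<^esub>"
        by (simp add: part_mu_rmul[OF unit_mon_closed[OF \<tau>(1)] z(1)] 0 mult_CP_zero)
      finally have "inv_mon \<tau> \<otimes>\<^bsub>CP\<^esub> (unit_mon \<tau> \<otimes>\<^bsub>CP\<^esub> part_mu c z) = \<zero>\<^bsub>CP\<^esub>"
        by (simp add: mult_CP_zero)
      then have "idem E \<otimes>\<^bsub>CP\<^esub> part_mu c z = \<zero>\<^bsub>CP\<^esub>"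
        using inv_mon_mult[OF \<tau>(1)] \<tau>
          tensor.m_assoc[OF inv_mon_closed unit_mon_closed part_mu_closed, OF \<tau>(1) \<tau>(1) z(1), of c]
        by simp
      then show False using ec c(2) by simp
    qed
    then have "translate \<tau> c \<inter> Z \<noteq> {}"
      using part_mu_Z[of "translate \<tau> c" "{}"] part_mu_empty[OF z(1)] by auto
    then obtain \<gamma>' where "\<gamma>' \<in> left_coset (mor_comp \<tau> \<gamma>)" "\<gamma>' \<in> Z"
      unfolding eq by blast
    moreover from this have "\<gamma>' \<in> \<Gamma>" using left_coset_subset[OF \<tau>\<gamma>] by blast
    ultimately show ?thesis
      using left_coset_eq[OF \<tau>\<gamma>] by blast
  qed
  then have "{left_coset (mor_comp \<tau> \<gamma>) | \<tau>. \<tau> \<in> \<Gamma> \<and> mor_dom \<tau> = E \<and> mor_rng \<tau> = E} \<subseteq> left_coset ` (Z \<inter> \<Gamma>)"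
    by blast
  moreover have "finite (left_coset ` (Z \<inter> \<Gamma>))" using Z by blast
  ultimately show ?thesis
    using \<gamma>(1,2) finite_subset by blast
qed

text \<open>Conjugation by \<gamma> carries the finite orbit at \<open>E\<close> to the domain
  \<open>F\<close> of \<gamma>. Sending \<tau> to the coset of
  \<open>\<gamma> \<tau>\<^sup>-\<^sup>1\<close> rather than of \<open>\<gamma> \<tau>\<close> turns
  left cosets into the right cosets that \<open>rcosets\<close> counts.\<close>

lemma finite_rcosets_if_separable:
  assumes sep: "separable_rng_extension CP sub.CP" and E: "mor_id E \<in> \<Gamma>"
  shows "\<exists>F. mor_id F \<in> \<Gamma> \<and> finite (rcosets\<^bsub>vertex_group \<Gamma> F\<^esub> carrier (vertex_group \<Delta> F))"
proof -
  obtain \<gamma> where \<gamma>: "\<gamma> \<in> \<Gamma>" "mor_rng \<gamma> = E"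
    and fin: "finite {left_coset (mor_comp \<tau> \<gamma>) | \<tau>. \<tau> \<in> \<Gamma> \<and> mor_dom \<tau> = E \<and> mor_rng \<tau> = E}"
    using finite_index_if_separable[OF assms] by blast
  define F where "F = mor_dom \<gamma>"
  define G where "G = {\<tau> \<in> \<Gamma>. mor_dom \<tau> = F \<and> mor_rng \<tau> = F}"
  define H where "H = {\<tau> \<in> \<Delta>. mor_dom \<tau> = F \<and> mor_rng \<tau> = F}"
  have "(\<lambda>\<tau>. left_coset (mor_comp \<gamma> (mor_inv \<tau>))) ` G
      \<subseteq> {left_coset (mor_comp \<tau> \<gamma>) | \<tau>. \<tau> \<in> \<Gamma> \<and> mor_dom \<tau> = E \<and> mor_rng \<tau> = E}"
  proof
    fix c assume "c \<in> (\<lambda>\<tau>. left_coset (mor_comp \<gamma> (mor_inv \<tau>))) ` G"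
    then obtain \<tau> where \<tau>: "\<tau> \<in> \<Gamma>" "mor_dom \<tau> = F" "mor_rng \<tau> = F" "c = left_coset (mor_comp \<gamma> (mor_inv \<tau>))"
      unfolding G_def by blast
    \<comment> \<open>The element of \<Gamma>(E) that satisfies
      \<open>\<rho> \<gamma> = \<gamma> \<tau>\<^sup>-\<^sup>1\<close>.\<close>
    let ?\<rho> = "mor_comp \<gamma> (mor_comp (mor_inv \<tau>) (mor_inv \<gamma>))"
    have "mor_comp ?\<rho> \<gamma> = mor_comp \<gamma> (mor_inv \<tau>)"
      using \<tau> \<gamma> comp_id[OF inv_closed[OF \<tau>(1)]] by (simp add: mor_comp_assoc F_def)
    moreover have "?\<rho> \<in> \<Gamma>" "mor_dom ?\<rho> = E" "mor_rng ?\<rho> = E"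
      using \<tau> \<gamma> by (simp_all add: comp_closed inv_closed F_def)
    ultimately show "c \<in> {left_coset (mor_comp \<tau> \<gamma>) | \<tau>. \<tau> \<in> \<Gamma> \<and> mor_dom \<tau> = E \<and> mor_rng \<tau> = E}"
      unfolding \<tau>(4) by (intro CollectI exI[of _ ?\<rho>]) simp
  qed
  then have "finite ((\<lambda>\<tau>. left_coset (mor_comp \<gamma> (mor_inv \<tau>))) ` G)"
    using fin by (rule finite_subset)
  then have "finite ((\<lambda>\<tau>. H #>\<^bsub>vertex_group \<Gamma> F\<^esub> \<tau>) ` G)"
  proof (rule finite_image_if_determined)
    have sub: "H #>\<^bsub>vertex_group \<Gamma> F\<^esub> \<tau> \<subseteq> H #>\<^bsub>vertex_group \<Gamma> F\<^esub> \<tau>'"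
      if "\<tau> \<in> G" "\<tau>' \<in> G"
        and eq: "left_coset (mor_comp \<gamma> (mor_inv \<tau>)) = left_coset (mor_comp \<gamma> (mor_inv \<tau>'))" for \<tau> \<tau>'
    proof
      have \<tau>: "\<tau> \<in> \<Gamma>" "mor_dom \<tau> = F" "mor_rng \<tau> = F" and \<tau>': "\<tau>' \<in> \<Gamma>" "mor_dom \<tau>' = F" "mor_rng \<tau>' = F"
        using that unfolding G_def by blast+
      have "mor_comp \<gamma> (mor_inv \<tau>') \<in> left_coset (mor_comp \<gamma> (mor_inv \<tau>))"
        unfolding eq using \<tau>' \<gamma> by (intro left_coset_self comp_closed inv_closed) (simp_all add: F_def)
      then obtain \<delta> where \<delta>: "\<delta> \<in> \<Delta>" "mor_rng \<delta> = F"
          "mor_comp \<gamma> (mor_inv \<tau>') = mor_comp (mor_comp \<gamma> (mor_inv \<tau>)) \<delta>"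
        using \<tau> unfolding left_coset_def by auto
      have \<delta>\<Gamma>: "\<delta> \<in> \<Gamma>" using \<delta>(1) by (rule sub_closed)
      have "mor_dom (mor_comp \<gamma> (mor_inv \<tau>')) = mor_dom (mor_comp (mor_comp \<gamma> (mor_inv \<tau>)) \<delta>)"
        by (simp only: \<delta>(3))
      then have dom: "mor_dom \<delta> = F" using \<tau>' by simp
      have "mor_comp \<gamma> (mor_inv \<tau>') = mor_comp \<gamma> (mor_comp (mor_inv \<tau>) \<delta>)"
        using \<delta>(2,3) \<tau> by (simp add: mor_comp_assoc)
      then have inv_eq: "mor_inv \<tau>' = mor_comp (mor_inv \<tau>) \<delta>"
        by (rule comp_cancel_left[rotated -1])
          (use \<gamma> \<tau> \<tau>' \<delta>\<Gamma> \<delta>(2) in \<open>simp_all add: F_def inv_closed comp_closed\<close>)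
      have "mor_comp \<delta> \<tau>' = mor_comp \<tau> (mor_comp (mor_inv \<tau>') \<tau>')"
        unfolding inv_eq using \<tau> \<tau>' \<delta>(2) dom \<delta>\<Gamma>
        by (simp add: mor_comp_assoc comp_closed)
      then have \<tau>_eq: "\<tau> = mor_comp \<delta> \<tau>'"
        using \<tau> \<tau>' comp_id[OF \<tau>(1)] by simp
      fix x assume "x \<in> H #>\<^bsub>vertex_group \<Gamma> F\<^esub> \<tau>"
      then obtain h where h: "h \<in> \<Delta>" "mor_dom h = F" "mor_rng h = F" "x = mor_comp h \<tau>"
        unfolding r_coset_def H_def by (auto simp: vertex_group_def)
      have "x = mor_comp (mor_comp h \<delta>) \<tau>'"
        unfolding h(4) \<tau>_eq using dom \<tau>' \<delta>(2) h by (simp add: mor_comp_assoc)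
      moreover have "mor_comp h \<delta> \<in> H"
        unfolding H_def using h \<delta> dom by (simp add: sub_comp)
      ultimately show "x \<in> H #>\<^bsub>vertex_group \<Gamma> F\<^esub> \<tau>'"
        unfolding r_coset_def by (auto simp: vertex_group_def)
    qed
    show "H #>\<^bsub>vertex_group \<Gamma> F\<^esub> \<tau> = H #>\<^bsub>vertex_group \<Gamma> F\<^esub> \<tau>'"
      if "\<tau> \<in> G" "\<tau>' \<in> G"
        "left_coset (mor_comp \<gamma> (mor_inv \<tau>)) = left_coset (mor_comp \<gamma> (mor_inv \<tau>'))" for \<tau> \<tau>'
      using sub[OF that] sub[OF that(2,1) that(3)[symmetric]] by blast
  qed
  moreover have "rcosets\<^bsub>vertex_group \<Gamma> F\<^esub> carrier (vertex_group \<Delta> F) = (\<lambda>\<tau>. H #>\<^bsub>vertex_group \<Gamma> F\<^esub> \<tau>) ` G"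
    unfolding RCOSETS_def G_def H_def by (auto simp: vertex_group_def)
  moreover have "mor_id F \<in> \<Gamma>" unfolding F_def by (rule id_dom[OF \<gamma>(1)])
  ultimately show ?thesis by auto
qed

end

section \<open>Finite index yields a separability element\<close>

text \<open>Dedekind's argument: the relation at x y minus \<open>\<chi> k y\<close> times the
  relation at x no longer involves the index \<open>k\<close>. By induction \<open>c j\<close> is
  annihilated by \<open>\<chi> j y \<ominus> \<chi> k y\<close>, which is nonzero for a suitable y;
  then the relation at one gives \<open>c k\<close>. A multiplicative monoid \<open>M\<close> is
  general enough for characters distinguished only on a small set.\<close>

lemma (in domain) independent_characters:
  assumes "finite I"
    and M: "M \<subseteq> carrier R" "\<one> \<in> M" "\<And>x y. \<lbrakk>x \<in> M; y \<in> M\<rbrakk> \<Longrightarrow> x \<otimes> y \<in> M"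
    and "\<And>i x. \<lbrakk>i \<in> I; x \<in> M\<rbrakk> \<Longrightarrow> \<chi> i x \<in> carrier R"
    and "\<And>i x y. \<lbrakk>i \<in> I; x \<in> M; y \<in> M\<rbrakk> \<Longrightarrow> \<chi> i (x \<otimes> y) = \<chi> i x \<otimes> \<chi> i y"
    and "\<And>i. i \<in> I \<Longrightarrow> \<chi> i \<one> = \<one>"
    and "\<And>i j. \<lbrakk>i \<in> I; j \<in> I; i \<noteq> j\<rbrakk> \<Longrightarrow> \<exists>x\<in>M. \<chi> i x \<noteq> \<chi> j x"
    and "\<And>i. i \<in> I \<Longrightarrow> c i \<in> carrier R"
    and "\<And>x. x \<in> M \<Longrightarrow> (\<Oplus>i\<in>I. c i \<otimes> \<chi> i x) = \<zero>"
    and "i \<in> I"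
  shows "c i = \<zero>"
  using assms(1,5-)
proof (induction I arbitrary: c i)
  case (insert k I)
  have \<chi>: "\<chi> j x \<in> carrier R" if "j \<in> insert k I" "x \<in> M" for j x
    using insert.prems(1)[OF that] .
  have c: "c j \<in> carrier R" if "j \<in> insert k I" for j
    using insert.prems(5)[OF that] .
  have rel: "c k \<otimes> \<chi> k x \<oplus> (\<Oplus>j\<in>I. c j \<otimes> \<chi> j x) = \<zero>" if "x \<in> M" for x
  proof -
    have "(\<Oplus>j\<in>insert k I. c j \<otimes> \<chi> j x) = c k \<otimes> \<chi> k x \<oplus> (\<Oplus>j\<in>I. c j \<otimes> \<chi> j x)"
      using insert.hyps c \<chi> that by (intro finsum_insert) auto
    then show ?thesis using insert.prems(6)[OF that] by simp
  qed
  have 0: "c j \<otimes> (\<chi> j y \<ominus> \<chi> k y) = \<zero>" if j: "j \<in> I" and y: "y \<in> M" for j y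
  proof (rule insert.IH[of "\<lambda>j. c j \<otimes> (\<chi> j y \<ominus> \<chi> k y)" j])
    fix x assume x: "x \<in> M"
    have "(\<Oplus>j\<in>I. c j \<otimes> (\<chi> j y \<ominus> \<chi> k y) \<otimes> \<chi> j x)
        = (\<Oplus>j\<in>I. c j \<otimes> \<chi> j (x \<otimes> y) \<oplus> \<ominus> \<chi> k y \<otimes> (c j \<otimes> \<chi> j x))"
    proof (rule finsum_cong')
      fix j assume j: "j \<in> I"
      have cl: "c j \<in> carrier R" "\<chi> j x \<in> carrier R" "\<chi> j y \<in> carrier R" "\<chi> k y \<in> carrier R"
        using c \<chi> j x y by auto
      have "\<chi> j (x \<otimes> y) = \<chi> j x \<otimes> \<chi> j y"
        using insert.prems(2)[of j x y] j x y by simp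
      then show "c j \<otimes> (\<chi> j y \<ominus> \<chi> k y) \<otimes> \<chi> j x = c j \<otimes> \<chi> j (x \<otimes> y) \<oplus> \<ominus> \<chi> k y \<otimes> (c j \<otimes> \<chi> j x)"
        using cl by algebra
    qed (use c \<chi> M x y in auto)
    also have "\<dots> = (\<Oplus>j\<in>I. c j \<otimes> \<chi> j (x \<otimes> y)) \<oplus> (\<Oplus>j\<in>I. \<ominus> \<chi> k y \<otimes> (c j \<otimes> \<chi> j x))"
      using c \<chi> M x y by (intro finsum_addf) auto
    also have "(\<Oplus>j\<in>I. \<ominus> \<chi> k y \<otimes> (c j \<otimes> \<chi> j x)) = \<ominus> \<chi> k y \<otimes> (\<Oplus>j\<in>I. c j \<otimes> \<chi> j x)"
      using insert.hyps c \<chi> x y by (intro finsum_rdistr[symmetric]) auto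
    also have "(\<Oplus>j\<in>I. c j \<otimes> \<chi> j (x \<otimes> y)) \<oplus> \<ominus> \<chi> k y \<otimes> (\<Oplus>j\<in>I. c j \<otimes> \<chi> j x) = \<zero>"
    proof -
      let ?S = "\<Oplus>j\<in>I. c j \<otimes> \<chi> j x" and ?T = "\<Oplus>j\<in>I. c j \<otimes> \<chi> j (x \<otimes> y)"
      have cl: "?S \<in> carrier R" "?T \<in> carrier R" "c k \<in> carrier R" "\<chi> k x \<in> carrier R" "\<chi> k y \<in> carrier R"
        using c \<chi> M x y by (auto intro!: finsum_closed)
      have "c k \<otimes> \<chi> k x \<oplus> ?S = \<zero>" "c k \<otimes> (\<chi> k x \<otimes> \<chi> k y) \<oplus> ?T = \<zero>"
        using rel[OF x] rel[OF M(3)[OF x y]] insert.prems(2)[of k x y] x y by auto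
      then have eq: "c k \<otimes> \<chi> k x = \<ominus> ?S" "c k \<otimes> (\<chi> k x \<otimes> \<chi> k y) = \<ominus> ?T"
        using cl minus_equality[of "c k \<otimes> \<chi> k x" ?S]
          minus_equality[of "c k \<otimes> (\<chi> k x \<otimes> \<chi> k y)" ?T] by auto
      have "\<ominus> ?T = \<chi> k y \<otimes> \<ominus> ?S"
        unfolding eq[symmetric] using cl by (simp add: m_ac)
      then have "\<ominus> \<chi> k y \<otimes> ?S = \<ominus> ?T"
        using cl by (simp add: l_minus r_minus)
      then show ?thesis using cl by (simp add: r_neg)
    qed
    finally show "(\<Oplus>j\<in>I. c j \<otimes> (\<chi> j y \<ominus> \<chi> k y) \<otimes> \<chi> j x) = \<zero>" .
  next
    show "c j \<otimes> (\<chi> j y \<ominus> \<chi> k y) \<in> carrier R" if "j \<in> I" for j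
      using that c[of j] \<chi>[of j y] \<chi>[of k y] y by simp
  qed (use insert.prems(1-4) j in auto)
  have cI: "c j = \<zero>" if j: "j \<in> I" for j
  proof -
    have "j \<noteq> k" using j insert.hyps(2) by blast
    then obtain y where y: "y \<in> M" "\<chi> j y \<noteq> \<chi> k y"
      using insert.prems(4)[of j k] j by blast
    have cl: "c j \<in> carrier R" "\<chi> j y \<in> carrier R" "\<chi> k y \<in> carrier R"
      using c \<chi> j y(1) by auto
    then have "\<chi> j y \<ominus> \<chi> k y \<noteq> \<zero>" using y(2) by (simp add: r_right_minus_eq)
    then show ?thesis
      using 0[OF j y(1)] cl integral_iff by auto
  qed
  have "(\<Oplus>j\<in>I. c j \<otimes> \<chi> j \<one>) = (\<Oplus>j\<in>I. \<zero>)"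
    using cI \<chi> M(2) by (intro finsum_cong') auto
  then have "c k = \<zero>"
    using rel[OF M(2)] c insert.prems(3)[of k] by simp
  then show ?case using cI insert.prems(7) by auto
qed simp

section \<open>Tensors of homogeneous elements with their inverses\<close>

context field_groupoid_pair
begin

lemma mult_mon_disjoint:
  assumes "\<And>\<gamma>. f \<gamma> \<noteq> \<zero> \<Longrightarrow> mor_dom \<gamma> \<noteq> mor_rng \<tau>"
  shows "f \<otimes>\<^bsub>CP\<^esub> mon a \<tau> = \<zero>\<^bsub>CP\<^esub>"
proof
  fix r
  have "\<not> (f s \<noteq> \<zero> \<and> mon a \<tau> t \<noteq> \<zero> \<and> mor_dom s = mor_rng t \<and> mor_comp s t = r)" for s t
    using assms[of s] by (cases "t = \<tau>") (auto simp: mon_def)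
  then have "{(s, t). f s \<noteq> \<zero> \<and> mon a \<tau> t \<noteq> \<zero> \<and> mor_dom s = mor_rng t \<and> mor_comp s t = r} = {}"
    by blast
  then have "finsum A (mult_term f (mon a \<tau>))
      {(s, t). f s \<noteq> \<zero> \<and> mon a \<tau> t \<noteq> \<zero> \<and> mor_dom s = mor_rng t \<and> mor_comp s t = r} = \<zero>"
    by (simp only: finsum_empty)
  then show "(f \<otimes>\<^bsub>CP\<^esub> mon a \<tau>) r = \<zero>\<^bsub>CP\<^esub> r"
    by (simp add: object_crossed_product_def)
qed

lemma mon_eq_left:
  assumes "\<gamma> \<in> \<Gamma>" "a \<in> mor_rng \<gamma>"
  shows "mon a \<gamma> = mon a (mor_id (mor_rng \<gamma>)) \<otimes>\<^bsub>CP\<^esub> unit_mon \<gamma>"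
  using assms subsetD[OF rng_props(1) assms(2)] by (simp add: mon_mult_mon id_rng rng_props)

lemma mon_mult_inv_mon:
  assumes "\<gamma> \<in> \<Gamma>" "a \<in> mor_rng \<gamma>"
  shows "mon a \<gamma> \<otimes>\<^bsub>CP\<^esub> inv_mon \<gamma> = mon a (mor_id (mor_rng \<gamma>))"
proof -
  have "mon a \<gamma> \<otimes>\<^bsub>CP\<^esub> inv_mon \<gamma> = mon a (mor_id (mor_rng \<gamma>)) \<otimes>\<^bsub>CP\<^esub> (unit_mon \<gamma> \<otimes>\<^bsub>CP\<^esub> inv_mon \<gamma>)"
    unfolding mon_eq_left[OF assms]
    using assms by (intro tensor.m_assoc) (simp_all add: mon_closed id_rng unit_mon_closed inv_mon_closed)
  then show ?thesis
    using mon_mult_idem[of "mor_id (mor_rng \<gamma>)" a] assms by (simp add: mult_inv_mon id_rng)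
qed

lemma inv_mon_mult_idem: "\<gamma> \<in> \<Gamma> \<Longrightarrow> inv_mon \<gamma> \<otimes>\<^bsub>CP\<^esub> idem (mor_rng \<gamma>) = inv_mon \<gamma>"
  using mon_mult_idem[of "mor_inv \<gamma>" "inv (\<beta> (mor_inv \<gamma>) \<gamma>)"]
  by (simp add: inv_mon_def inv_closed inv_coeff)

lemma idem_mult_inv_mon: "\<gamma> \<in> \<Gamma> \<Longrightarrow> idem (mor_dom \<gamma>) \<otimes>\<^bsub>CP\<^esub> inv_mon \<gamma> = inv_mon \<gamma>"
  using idem_mult_mon[of "mor_inv \<gamma>" "inv (\<beta> (mor_inv \<gamma>) \<gamma>)"]
  by (simp add: inv_mon_def inv_closed inv_coeff)

lemma sub_mon_closed: "\<lbrakk>\<delta> \<in> \<Delta>; b \<in> mor_rng \<delta>\<rbrakk> \<Longrightarrow> mon b \<delta> \<in> carrier sub.CP"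
  by (rule sub.mon_closed)

text \<open>Multiply \<open>eq\<close> by the two inverses; these are inverses only up to
  idempotents, which \<open>s_id\<close> and \<open>x_id\<close> absorb. Inverses of composite
  morphisms are handled through this rule instead of explicit cocycle values.\<close>

lemma inv_mon_commute:
  assumes \<gamma>: "\<gamma> \<in> \<Gamma>" and \<rho>: "\<rho> \<in> \<Gamma>" and s: "s \<in> carrier CP" and x: "x \<in> carrier CP"
    and eq: "unit_mon \<gamma> \<otimes>\<^bsub>CP\<^esub> s = x \<otimes>\<^bsub>CP\<^esub> unit_mon \<rho>"
    and s_id: "idem (mor_dom \<gamma>) \<otimes>\<^bsub>CP\<^esub> s = s" and x_id: "x \<otimes>\<^bsub>CP\<^esub> idem (mor_rng \<rho>) = x"
  shows "s \<otimes>\<^bsub>CP\<^esub> inv_mon \<rho> = inv_mon \<gamma> \<otimes>\<^bsub>CP\<^esub> x"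
proof -
  note cl = unit_mon_closed[OF \<gamma>] unit_mon_closed[OF \<rho>] inv_mon_closed[OF \<gamma>] inv_mon_closed[OF \<rho>]
  have "s \<otimes>\<^bsub>CP\<^esub> inv_mon \<rho> = ((inv_mon \<gamma> \<otimes>\<^bsub>CP\<^esub> unit_mon \<gamma>) \<otimes>\<^bsub>CP\<^esub> s) \<otimes>\<^bsub>CP\<^esub> inv_mon \<rho>"
    by (simp add: inv_mon_mult \<gamma> s_id)
  also have "\<dots> = inv_mon \<gamma> \<otimes>\<^bsub>CP\<^esub> ((unit_mon \<gamma> \<otimes>\<^bsub>CP\<^esub> s) \<otimes>\<^bsub>CP\<^esub> inv_mon \<rho>)"
    using cl s by (simp add: tensor.m_assoc mult_CP_closed)
  also have "\<dots> = inv_mon \<gamma> \<otimes>\<^bsub>CP\<^esub> (x \<otimes>\<^bsub>CP\<^esub> (unit_mon \<rho> \<otimes>\<^bsub>CP\<^esub> inv_mon \<rho>))"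
    unfolding eq using cl x by (simp add: tensor.m_assoc mult_CP_closed)
  also have "\<dots> = inv_mon \<gamma> \<otimes>\<^bsub>CP\<^esub> x"
    by (simp add: mult_inv_mon \<rho> x_id)
  finally show ?thesis .
qed

text \<open>The element at \<gamma>\<delta> is the one at \<gamma> times a multiple of
  \<open>u\<^sub>\<delta>\<close>. That multiple lies in the subring, so it crosses the tensor sign,
  where it turns the inverse at \<gamma>\<delta> into the inverse at \<gamma>.\<close>

lemma teq_sub_translate:
  assumes \<gamma>: "\<gamma> \<in> \<Gamma>" and \<delta>: "\<delta> \<in> \<Delta>" and d: "mor_dom \<gamma> = mor_rng \<delta>" and a: "a \<in> mor_rng \<gamma>"
  shows "tensor.teq (frag_of (mon a (mor_comp \<gamma> \<delta>), inv_mon (mor_comp \<gamma> \<delta>))) (frag_of (mon a \<gamma>, inv_mon \<gamma>))"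
proof -
  have \<delta>\<Gamma>: "\<delta> \<in> \<Gamma>" by (rule sub_closed[OF \<delta>])
  have \<gamma>\<delta>: "mor_comp \<gamma> \<delta> \<in> \<Gamma>" by (rule comp_closed[OF \<gamma> \<delta>\<Gamma> d])
  \<comment> \<open>The factor \<open>e\<close> cancels the cocycle value in
    \<open>u\<^sub>\<gamma> u\<^sub>\<delta>\<close>. As coefficients pass
    \<open>u\<^sub>\<gamma>\<close> by applying \<gamma>, the coefficient in front of
    \<open>u\<^sub>\<delta>\<close> has to be its preimage \<open>b\<close>.\<close>
  define e where "e = inv (\<beta> \<gamma> \<delta>)"
  have e: "e \<in> mor_rng \<gamma>" "e \<otimes> \<beta> \<gamma> \<delta> = \<one>"
    using subfield_m_inv[OF subfield_rng[OF \<gamma>], of "\<beta> \<gamma> \<delta>"] cocycle_closed[OF \<gamma> \<delta>\<Gamma> d] cocycle_nonzero[OF \<gamma> \<delta>\<Gamma> d]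
    by (auto simp: e_def)
  define b where "b = mor_map (mor_inv \<gamma>) e"
  have b: "b \<in> mor_rng \<delta>" "mor_map \<gamma> b = e"
    using e(1) \<gamma> d mor_map_in_rng[of e "mor_inv \<gamma>"] by (simp_all add: b_def map_map_inv)
  have carr: "a \<in> carrier A" "e \<in> carrier A" "\<beta> \<gamma> \<delta> \<in> carrier A"
    using rng_props(1)[OF \<gamma>] a e(1) cocycle_closed[OF \<gamma> \<delta>\<Gamma> d] by auto
  have left: "mon a' \<gamma> \<otimes>\<^bsub>CP\<^esub> mon b \<delta> = mon a' (mor_comp \<gamma> \<delta>)" if "a' \<in> mor_rng \<gamma>" for a'
    using that subsetD[OF rng_props(1)[OF \<gamma>] that] b \<gamma> \<delta>\<Gamma> d carr e by (simp add: mon_mult_mon m_assoc)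
  have b': "mon b \<delta> \<in> carrier CP" by (rule mon_closed[OF \<delta>\<Gamma> b(1)])
  have right: "mon b \<delta> \<otimes>\<^bsub>CP\<^esub> inv_mon (mor_comp \<gamma> \<delta>) = inv_mon \<gamma> \<otimes>\<^bsub>CP\<^esub> idem (mor_rng \<gamma>)"
  proof (rule inv_mon_commute[OF \<gamma> \<gamma>\<delta> b' idem_closed[OF \<gamma>]])
    show "unit_mon \<gamma> \<otimes>\<^bsub>CP\<^esub> mon b \<delta> = idem (mor_rng \<gamma>) \<otimes>\<^bsub>CP\<^esub> unit_mon (mor_comp \<gamma> \<delta>)"
      using left[OF rng_props(3)[OF \<gamma>]] idem_mult_mon[OF \<gamma>\<delta>, of \<one>] d rng_props(3)[OF \<gamma>] by simp
    show "idem (mor_dom \<gamma>) \<otimes>\<^bsub>CP\<^esub> mon b \<delta> = mon b \<delta>"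
      using idem_mult_mon[OF \<delta>\<Gamma> b(1)] d by simp
    show "idem (mor_rng \<gamma>) \<otimes>\<^bsub>CP\<^esub> idem (mor_rng (mor_comp \<gamma> \<delta>)) = idem (mor_rng \<gamma>)"
      using mon_mult_idem[OF id_rng[OF \<gamma>], of \<one>] d rng_props(3)[OF \<gamma>] by simp
  qed
  have "tensor.teq (frag_of (mon a \<gamma> \<otimes>\<^bsub>CP\<^esub> mon b \<delta>, inv_mon (mor_comp \<gamma> \<delta>)))
      (frag_of (mon a \<gamma>, mon b \<delta> \<otimes>\<^bsub>CP\<^esub> inv_mon (mor_comp \<gamma> \<delta>)))"
    by (rule tensor.teq_balanced[OF mon_closed[OF \<gamma> a] sub_mon_closed[OF \<delta> b(1)] inv_mon_closed[OF \<gamma>\<delta>]])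
  then show ?thesis
    by (simp add: left[OF a] right inv_mon_mult_idem \<gamma>)
qed

text \<open>The left product is \<tau>(b) times \<open>u\<^sub>\<rho> s\<close>, where \<rho> =
  \<tau>\<gamma> and \<open>s\<close> is concentrated at an identity. Since \<Delta> contains all
  identities, \<open>s\<close> lies in the subring and crosses the tensor sign; on the other side it
  combines with the inverse at \<gamma> to the inverse at \<rho> followed by
  \<open>a u\<^sub>\<tau>\<close>.\<close>

lemma teq_equivariant:
  assumes \<tau>: "\<tau> \<in> \<Gamma>" and \<gamma>: "\<gamma> \<in> \<Gamma>" and d: "mor_dom \<tau> = mor_rng \<gamma>"
    and a: "a \<in> mor_rng \<tau>" and b: "b \<in> mor_rng \<gamma>"
  shows "tensor.teq (frag_of (mon a \<tau> \<otimes>\<^bsub>CP\<^esub> mon b \<gamma>, inv_mon \<gamma>))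
    (frag_of (mon (mor_map \<tau> b) (mor_comp \<tau> \<gamma>), inv_mon (mor_comp \<tau> \<gamma>) \<otimes>\<^bsub>CP\<^esub> mon a \<tau>))"
proof -
  define \<rho> where "\<rho> = mor_comp \<tau> \<gamma>"
  have \<rho>: "\<rho> \<in> \<Gamma>" "mor_rng \<rho> = mor_rng \<tau>" "mor_dom \<rho> = mor_dom \<gamma>"
    using comp_closed[OF \<tau> \<gamma> d] d by (simp_all add: \<rho>_def)
  have \<beta>: "\<beta> \<tau> \<gamma> \<in> mor_rng \<tau>" by (rule cocycle_closed[OF \<tau> \<gamma> d])
  have tb: "mor_map \<tau> b \<in> mor_rng \<tau>" using b d by auto
  define e where "e = inv (\<beta> \<tau> \<gamma>)"
  have e: "e \<in> mor_rng \<tau>" "\<beta> \<tau> \<gamma> \<otimes> e = \<one>"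
    using subfield_m_inv[OF subfield_rng[OF \<tau>], of "\<beta> \<tau> \<gamma>"] \<beta> cocycle_nonzero[OF \<tau> \<gamma> d]
    by (auto simp: e_def)
  \<comment> \<open>What remains of the coefficient of the left product after splitting off
    \<tau>(b). Moving \<open>c\<close> to the right of \<open>u\<^sub>\<rho>\<close> replaces it by
    its preimage \<open>b'\<close> under \<rho>, the coefficient of \<open>s\<close>.\<close>
  define c where "c = a \<otimes> \<beta> \<tau> \<gamma>"
  have c: "c \<in> mor_rng \<rho>" using rng_props(5)[OF \<tau> a \<beta>] by (simp add: c_def \<rho>)
  define b' where "b' = mor_map (mor_inv \<rho>) c"
  have b': "b' \<in> mor_dom \<rho>" "mor_map \<rho> b' = c"
    using c \<rho>(1) mor_map_in_rng[of c "mor_inv \<rho>"] by (simp_all add: b'_def map_map_inv)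
  have carr: "a \<in> carrier A" "c \<in> carrier A" "e \<in> carrier A" "\<beta> \<tau> \<gamma> \<in> carrier A" "mor_map \<tau> b \<in> carrier A"
    using rng_props(1)[OF \<tau>] a \<beta> e(1) tb c \<rho>(2) by auto
  define s where "s = mon b' (mor_id (mor_dom \<rho>))"
  have s: "s \<in> carrier sub.CP"
    unfolding s_def using b'(1) by (intro sub_mon_closed sub_id_dom \<rho>(1)) simp
  then have s': "s \<in> carrier CP" by (rule tensor.S_closed)
  \<comment> \<open>A factorization of \<open>a u\<^sub>\<tau>\<close> as x y: \<open>x\<close> is
    \<open>s\<close> moved to the left of \<open>u\<^sub>\<rho>\<close>, and \<open>y\<close> is
    \<open>u\<^sub>\<rho>\<close> times the inverse of \<open>u\<^sub>\<gamma>\<close>.\<close>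
  define x where "x = mon c (mor_id (mor_rng \<rho>))"
  have x: "x \<in> carrier CP" unfolding x_def using c by (intro mon_closed id_rng \<rho>(1)) simp
  define y where "y = mon e \<tau>"
  have y: "y \<in> carrier CP" unfolding y_def by (rule mon_closed[OF \<tau> e(1)])
  have unit_s: "mon f \<rho> \<otimes>\<^bsub>CP\<^esub> s = mon (f \<otimes> c) \<rho>" if "f \<in> mor_rng \<rho>" for f
    unfolding s_def using that subsetD[OF rng_props(1)[OF \<rho>(1)] that] b' \<rho>(1) carr
    by (simp add: mon_mult_mon id_dom)
  have s_v: "s \<otimes>\<^bsub>CP\<^esub> inv_mon \<rho> = inv_mon \<rho> \<otimes>\<^bsub>CP\<^esub> x"
  proof (rule inv_mon_commute[OF \<rho>(1) \<rho>(1) s' x])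
    show "unit_mon \<rho> \<otimes>\<^bsub>CP\<^esub> s = x \<otimes>\<^bsub>CP\<^esub> unit_mon \<rho>"
      using unit_s[OF rng_props(3)[OF \<rho>(1)]] mon_eq_left[OF \<rho>(1) c] carr by (simp add: x_def)
    show "idem (mor_dom \<rho>) \<otimes>\<^bsub>CP\<^esub> s = s"
      using idem_mult_mon[OF id_dom[OF \<rho>(1)], of b'] b' by (simp add: s_def)
    show "x \<otimes>\<^bsub>CP\<^esub> idem (mor_rng \<rho>) = x"
      using mon_mult_idem[OF id_rng[OF \<rho>(1)], of c] c by (simp add: x_def)
  qed
  have v: "idem (mor_dom \<gamma>) \<otimes>\<^bsub>CP\<^esub> inv_mon \<gamma> = inv_mon \<rho> \<otimes>\<^bsub>CP\<^esub> y"
  proof (rule inv_mon_commute[OF \<rho>(1) \<gamma> unit_mon_closed[OF id_dom[OF \<gamma>]] y])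
    show "unit_mon \<rho> \<otimes>\<^bsub>CP\<^esub> idem (mor_dom \<gamma>) = y \<otimes>\<^bsub>CP\<^esub> unit_mon \<gamma>"
      using mon_mult_idem[OF \<rho>(1) rng_props(3)[OF \<rho>(1)]] \<tau> \<gamma> d e carr rng_props(3)[OF \<gamma>]
      by (simp add: y_def mon_mult_mon map_one m_comm \<rho>(3) flip: \<rho>_def)
    show "idem (mor_dom \<rho>) \<otimes>\<^bsub>CP\<^esub> idem (mor_dom \<gamma>) = idem (mor_dom \<gamma>)"
      using idem_mult_mon[OF id_dom[OF \<gamma>], of \<one>] dom_props(3)[OF \<gamma>] by (simp add: \<rho>(3))
    show "y \<otimes>\<^bsub>CP\<^esub> idem (mor_rng \<gamma>) = y"
      using mon_mult_idem[OF \<tau> e(1)] d by (simp add: y_def)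
  qed
  have xy: "x \<otimes>\<^bsub>CP\<^esub> y = mon a \<tau>"
    unfolding x_def y_def using \<rho>(2) \<tau> c e carr
    by (simp add: mon_mult_mon id_rng) (simp add: c_def m_assoc carr e)
  have "mon a \<tau> \<otimes>\<^bsub>CP\<^esub> mon b \<gamma> = mon (a \<otimes> mor_map \<tau> b \<otimes> \<beta> \<tau> \<gamma>) \<rho>"
    using \<tau> \<gamma> d a b by (simp add: mon_mult_mon \<rho>_def)
  also have "a \<otimes> mor_map \<tau> b \<otimes> \<beta> \<tau> \<gamma> = mor_map \<tau> b \<otimes> c"
    using carr by (simp add: c_def m_ac)
  also have "mon (mor_map \<tau> b \<otimes> c) \<rho> = mon (mor_map \<tau> b) \<rho> \<otimes>\<^bsub>CP\<^esub> s"
    using unit_s[of "mor_map \<tau> b"] tb \<rho>(2) by simp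
  finally have l: "mon a \<tau> \<otimes>\<^bsub>CP\<^esub> mon b \<gamma> = mon (mor_map \<tau> b) \<rho> \<otimes>\<^bsub>CP\<^esub> s" .
  have "s \<otimes>\<^bsub>CP\<^esub> inv_mon \<gamma> = s \<otimes>\<^bsub>CP\<^esub> (inv_mon \<rho> \<otimes>\<^bsub>CP\<^esub> y)"
    using v by (simp add: idem_mult_inv_mon \<gamma>)
  also have "\<dots> = inv_mon \<rho> \<otimes>\<^bsub>CP\<^esub> (x \<otimes>\<^bsub>CP\<^esub> y)"
    using s' x y inv_mon_closed[OF \<rho>(1)] tensor.m_assoc[of s "inv_mon \<rho>" y]
      tensor.m_assoc[of "inv_mon \<rho>" x y] by (simp add: s_v)
  finally have r: "s \<otimes>\<^bsub>CP\<^esub> inv_mon \<gamma> = inv_mon \<rho> \<otimes>\<^bsub>CP\<^esub> mon a \<tau>" by (simp add: xy)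
  have "tensor.teq (frag_of (mon (mor_map \<tau> b) \<rho> \<otimes>\<^bsub>CP\<^esub> s, inv_mon \<gamma>)) (frag_of (mon (mor_map \<tau> b) \<rho>, s \<otimes>\<^bsub>CP\<^esub> inv_mon \<gamma>))"
    by (rule tensor.teq_balanced[OF mon_closed[OF \<rho>(1)] s inv_mon_closed[OF \<gamma>]]) (simp add: tb \<rho>(2))
  then show ?thesis by (simp add: l r flip: \<rho>_def)
qed

lemma finsum_mon:
  assumes "finite I" "\<And>i. i \<in> I \<Longrightarrow> b i \<in> mor_rng \<tau>" "\<tau> \<in> \<Gamma>"
  shows "(\<Oplus>\<^bsub>CP\<^esub>i\<in>I. mon (b i) \<tau>) = mon (\<Oplus>i\<in>I. b i) \<tau>"
  using assms(1,2)
proof (induction I)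
  case (insert i I)
  have b: "b j \<in> carrier A" if "j \<in> insert i I" for j
    using insert.prems[OF that] rng_props(1)[OF assms(3)] by blast
  have m: "mon (b j) \<tau> \<in> carrier CP" if "j \<in> insert i I" for j
    by (rule mon_closed[OF assms(3) insert.prems[OF that]])
  have "(\<Oplus>\<^bsub>CP\<^esub>j\<in>insert i I. mon (b j) \<tau>) = mon (b i) \<tau> \<oplus>\<^bsub>CP\<^esub> (\<Oplus>\<^bsub>CP\<^esub>j\<in>I. mon (b j) \<tau>)"
    using insert.hyps m by (intro tensor.finsum_insert) auto
  also have "\<dots> = mon (b i \<oplus> (\<Oplus>j\<in>I. b j)) \<tau>"
    using insert.IH insert.prems b by (simp add: mon_add finsum_closed)
  also have "b i \<oplus> (\<Oplus>j\<in>I. b j) = (\<Oplus>j\<in>insert i I. b j)"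
    using insert.hyps b by (intro finsum_insert[symmetric]) auto
  finally show ?case .
qed simp

end

text \<open>As the stabilizer of \<open>B\<close> lies in \<open>\<Delta>\<close>, the class of \<open>u\<^sub>\<gamma> \<otimes> u\<^sub>\<gamma>\<^sup>-\<^sup>1\<close> depends only on the
  restriction of \<open>\<gamma>\<close> to \<open>B\<close>.\<close>

locale open_vertex = field_groupoid_pair A \<Gamma> \<beta> \<Delta> for A (structure) and \<Gamma> \<beta> \<Delta> +
  fixes F B :: "'a set"
  assumes F: "mor_id F \<in> \<Gamma>"
    and B: "finite B" "B \<subseteq> F"
    and connected: "mor_id E \<in> \<Gamma> \<Longrightarrow> \<exists>\<tau>\<in>\<Gamma>. mor_dom \<tau> = F \<and> mor_rng \<tau> = E"
    and finite_orbit: "x \<in> F \<Longrightarrow> finite {mor_map \<gamma> x | \<gamma>. \<gamma> \<in> \<Gamma> \<and> mor_dom \<gamma> = F}"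
    and stabilizer: "\<lbrakk>\<gamma> \<in> \<Gamma>; mor_dom \<gamma> = F; mor_rng \<gamma> = F; \<And>x. x \<in> B \<Longrightarrow> mor_map \<gamma> x = x\<rbrakk> \<Longrightarrow> \<gamma> \<in> \<Delta>"
begin

section \<open>Morphisms up to agreement on a finite set\<close>

definition hom_to :: "'a set \<Rightarrow> 'a mor set" where
  "hom_to E = {\<gamma> \<in> \<Gamma>. mor_dom \<gamma> = F \<and> mor_rng \<gamma> = E}"

definition agree :: "'a mor \<Rightarrow> 'a mor \<Rightarrow> bool" where
  "agree \<gamma> \<gamma>' \<longleftrightarrow> (\<forall>x\<in>B. mor_map \<gamma> x = mor_map \<gamma>' x)"

text \<open>The choice depends on \<gamma> only through its range and its restriction to
  \<open>B\<close>, so morphisms with the same range that agree on \<open>B\<close> receive the same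
  representative.\<close>

definition rep :: "'a mor \<Rightarrow> 'a mor" where
  "rep \<gamma> = (SOME \<gamma>'. \<gamma>' \<in> hom_to (mor_rng \<gamma>) \<and> agree \<gamma>' \<gamma>)"

definition reps :: "'a set \<Rightarrow> 'a mor set" where
  "reps E = rep ` hom_to E"

lemma hom_toD: "\<gamma> \<in> hom_to E \<Longrightarrow> \<gamma> \<in> \<Gamma>" "\<gamma> \<in> hom_to E \<Longrightarrow> mor_dom \<gamma> = F" "\<gamma> \<in> hom_to E \<Longrightarrow> mor_rng \<gamma> = E"
  by (simp_all add: hom_to_def)

lemma hom_to_comp: "\<lbrakk>\<gamma> \<in> hom_to E; \<tau> \<in> \<Gamma>; mor_dom \<tau> = E\<rbrakk> \<Longrightarrow> mor_comp \<tau> \<gamma> \<in> hom_to (mor_rng \<tau>)"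
  by (simp add: hom_to_def comp_closed)

lemma rep: assumes "\<gamma> \<in> hom_to E" shows "rep \<gamma> \<in> hom_to E" "agree (rep \<gamma>) \<gamma>"
proof -
  have "\<exists>\<gamma>'. \<gamma>' \<in> hom_to (mor_rng \<gamma>) \<and> agree \<gamma>' \<gamma>"
    using assms hom_toD(3)[OF assms] by (intro exI[of _ \<gamma>]) (simp add: agree_def)
  from someI_ex[OF this] show "rep \<gamma> \<in> hom_to E" "agree (rep \<gamma>) \<gamma>"
    using hom_toD(3)[OF assms] by (simp_all add: rep_def)
qed

lemma rep_cong:
  assumes "\<gamma> \<in> hom_to E" "\<gamma>' \<in> hom_to E" "agree \<gamma> \<gamma>'" shows "rep \<gamma> = rep \<gamma>'"
proof -
  have "agree \<rho> \<gamma> \<longleftrightarrow> agree \<rho> \<gamma>'" for \<rho>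
    using assms(3) by (simp add: agree_def)
  then show ?thesis
    using hom_toD(3)[OF assms(1)] hom_toD(3)[OF assms(2)] by (simp add: rep_def)
qed

lemma rep_reps: "\<gamma> \<in> reps E \<Longrightarrow> rep \<gamma> = \<gamma>"
  unfolding reps_def using rep_cong[OF rep(1) _ rep(2)] by (elim imageE) simp

lemma reps_hom_to: "\<gamma> \<in> reps E \<Longrightarrow> \<gamma> \<in> hom_to E"
  unfolding reps_def using rep by blast

lemma rep_in_reps: "\<gamma> \<in> hom_to E \<Longrightarrow> rep \<gamma> \<in> reps E"
  by (simp add: reps_def)

lemma reps_distinct: "\<lbrakk>\<gamma> \<in> reps E; \<gamma>' \<in> reps E; agree \<gamma> \<gamma>'\<rbrakk> \<Longrightarrow> \<gamma> = \<gamma>'"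
  using rep_cong[of \<gamma> E \<gamma>'] rep_reps[of \<gamma> E] rep_reps[of \<gamma>' E] reps_hom_to by simp

lemma finite_reps: "finite (reps E)"
  unfolding reps_def
proof (rule finite_image_if_determined)
  let ?O = "\<lambda>x. {mor_map \<gamma> x | \<gamma>. \<gamma> \<in> \<Gamma> \<and> mor_dom \<gamma> = F}"
  show "finite ((\<lambda>\<gamma>. restrict (mor_map \<gamma>) B) ` hom_to E)"
  proof (rule finite_subset)
    show "(\<lambda>\<gamma>. restrict (mor_map \<gamma>) B) ` hom_to E \<subseteq> (\<Pi>\<^sub>E x\<in>B. ?O x)"
    proof
      fix f assume "f \<in> (\<lambda>\<gamma>. restrict (mor_map \<gamma>) B) ` hom_to E"
      then obtain \<gamma> where g: "\<gamma> \<in> \<Gamma>" "mor_dom \<gamma> = F" "f = restrict (mor_map \<gamma>) B"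
        using hom_toD by blast
      show "f \<in> (\<Pi>\<^sub>E x\<in>B. ?O x)"
      proof (rule PiE_I)
        fix x assume "x \<in> B"
        then have "f x = mor_map \<gamma> x" using g(3) by simp
        then show "f x \<in> ?O x" using g(1,2) by blast
      qed (simp add: g(3))
    qed
    show "finite (\<Pi>\<^sub>E x\<in>B. ?O x)"
      using B finite_orbit by (intro finite_PiE) auto
  qed
  fix \<gamma> \<gamma>' assume "\<gamma> \<in> hom_to E" "\<gamma>' \<in> hom_to E" "restrict (mor_map \<gamma>) B = restrict (mor_map \<gamma>') B"
  moreover from this(3) have "agree \<gamma> \<gamma>'"
    unfolding agree_def by (metis restrict_apply')
  ultimately show "rep \<gamma> = rep \<gamma>'" by (intro rep_cong)
qed

lemma agree_comp:
  assumes "\<gamma> \<in> hom_to E" "\<gamma>' \<in> hom_to E'" "agree \<gamma> \<gamma>'"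
  shows "agree (mor_comp \<tau> \<gamma>) (mor_comp \<tau> \<gamma>')"
  using assms(3) B(2) hom_toD(2)[OF assms(1)] hom_toD(2)[OF assms(2)]
  by (auto simp: agree_def subset_iff)

text \<open>\<open>stabilizer\<close> enters here: \<open>\<gamma>\<^sup>-\<^sup>1 \<gamma>'\<close>
  fixes \<open>B\<close> pointwise, so \<gamma> and \<open>\<gamma>'\<close> lie in the same left
  coset of \<Delta>.\<close>

lemma agree_sub:
  assumes g: "\<gamma> \<in> hom_to E" and g': "\<gamma>' \<in> hom_to E" and ag: "agree \<gamma> \<gamma>'"
  shows "mor_comp (mor_inv \<gamma>) \<gamma>' \<in> \<Delta>"
proof (rule stabilizer)
  note h = hom_toD[OF g] and h' = hom_toD[OF g']
  show "mor_comp (mor_inv \<gamma>) \<gamma>' \<in> \<Gamma>" "mor_dom (mor_comp (mor_inv \<gamma>) \<gamma>') = F"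
    "mor_rng (mor_comp (mor_inv \<gamma>) \<gamma>') = F"
    using h h' by (simp_all add: comp_closed inv_closed)
  fix x assume "x \<in> B"
  then have "x \<in> F" "mor_map \<gamma>' x = mor_map \<gamma> x" using B(2) ag by (auto simp: agree_def)
  then show "mor_map (mor_comp (mor_inv \<gamma>) \<gamma>') x = x"
    using h h' by (simp add: map_inv_map)
qed

text \<open>Left translation preserves agreement on \<open>B\<close> and is undone by the inverse
  morphism. The outer \<open>rep\<close> is there because \<tau>\<gamma> need not be the chosen
  representative of its class.\<close>

lemma bij_reps:
  assumes "\<tau> \<in> \<Gamma>" "mor_dom \<tau> = E" "mor_rng \<tau> = E'"
  shows "bij_betw (\<lambda>\<gamma>. rep (mor_comp \<tau> \<gamma>)) (reps E) (reps E')"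
proof -
  \<comment> \<open>Stated for all morphisms, since it is applied both to \<tau> and to its
    inverse.\<close>
  have aux: "rep (mor_comp \<tau> \<gamma>) \<in> reps E'" "rep (mor_comp (mor_inv \<tau>) (rep (mor_comp \<tau> \<gamma>))) = \<gamma>"
    if \<tau>: "\<tau> \<in> \<Gamma>" "mor_dom \<tau> = E" "mor_rng \<tau> = E'" and \<gamma>: "\<gamma> \<in> reps E" for \<tau> \<gamma> E E'
  proof -
    have g: "\<gamma> \<in> hom_to E" by (rule reps_hom_to[OF \<gamma>])
    have tg: "mor_comp \<tau> \<gamma> \<in> hom_to E'" using hom_to_comp[OF g \<tau>(1,2)] \<tau>(3) by simp
    show "rep (mor_comp \<tau> \<gamma>) \<in> reps E'" by (rule rep_in_reps[OF tg])
    have "agree (mor_comp (mor_inv \<tau>) (rep (mor_comp \<tau> \<gamma>))) (mor_comp (mor_inv \<tau>) (mor_comp \<tau> \<gamma>))"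
      by (rule agree_comp[OF rep(1)[OF tg] tg rep(2)[OF tg]])
    also have "mor_comp (mor_inv \<tau>) (mor_comp \<tau> \<gamma>) = \<gamma>"
      using hom_toD[OF g] \<tau> by simp
    finally have ag: "agree (mor_comp (mor_inv \<tau>) (rep (mor_comp \<tau> \<gamma>))) \<gamma>" .
    have "mor_comp (mor_inv \<tau>) (rep (mor_comp \<tau> \<gamma>)) \<in> hom_to E"
      using hom_to_comp[OF rep(1)[OF tg] inv_closed[OF \<tau>(1)]] \<tau> by simp
    from rep_cong[OF this g ag] show "rep (mor_comp (mor_inv \<tau>) (rep (mor_comp \<tau> \<gamma>))) = \<gamma>"
      using rep_reps[OF \<gamma>] by simp
  qed
  have inv: "mor_inv \<tau> \<in> \<Gamma>" "mor_dom (mor_inv \<tau>) = E'" "mor_rng (mor_inv \<tau>) = E"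
    using assms by (simp_all add: inv_closed)
  show ?thesis
    by (rule bij_betw_byWitness[where f' = "\<lambda>\<gamma>. rep (mor_comp (mor_inv \<tau>) \<gamma>)"])
      (use aux[OF assms] aux[OF inv] assms in auto)
qed

text \<open>For such x the value at a representative does not depend on the choice made. The set
  contains \<open>B\<close> and one and is closed under products, which is what independence of
  characters asks of a domain of definition that separates the representatives.\<close>

definition determined :: "'a set" where
  "determined = {x \<in> F. \<forall>E. \<forall>\<gamma>\<in>hom_to E. \<forall>\<gamma>'\<in>hom_to E. agree \<gamma> \<gamma>' \<longrightarrow> mor_map \<gamma> x = mor_map \<gamma>' x}"

lemma determined_F: "x \<in> determined \<Longrightarrow> x \<in> F"
  by (simp add: determined_def)

lemma determined_agree: "\<lbrakk>x \<in> determined; \<gamma> \<in> hom_to E; \<gamma>' \<in> hom_to E; agree \<gamma> \<gamma>'\<rbrakk> \<Longrightarrow> mor_map \<gamma> x = mor_map \<gamma>' x"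
  unfolding determined_def by blast

lemma F_props: "F \<subseteq> carrier A" "\<one> \<in> F" "\<And>x y. \<lbrakk>x \<in> F; y \<in> F\<rbrakk> \<Longrightarrow> x \<otimes> y \<in> F" "subfield F A"
  using dom_props[OF F] subfield_dom[OF F] by simp_all

lemma determined_mult: assumes "x \<in> determined" "y \<in> determined" shows "x \<otimes> y \<in> determined"
proof -
  have "mor_map \<gamma> (x \<otimes> y) = mor_map \<gamma>' (x \<otimes> y)"
    if "\<gamma> \<in> hom_to E" "\<gamma>' \<in> hom_to E" "agree \<gamma> \<gamma>'" for E \<gamma> \<gamma>'
    using determined_agree[OF assms(1) that] determined_agree[OF assms(2) that] determined_F assms
      hom_toD[OF that(1)] hom_toD[OF that(2)] by (simp add: map_mult)
  then show ?thesis
    using F_props(3) determined_F assms unfolding determined_def by blast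
qed

lemma B_sub_determined: "B \<subseteq> determined"
  using B(2) unfolding determined_def agree_def by blast

definition trace :: "'a set \<Rightarrow> 'a \<Rightarrow> 'a" where
  "trace E x = (\<Oplus>\<gamma>\<in>reps E. mor_map \<gamma> x)"

text \<open>Applying \<tau> permutes the representatives up to agreement on \<open>B\<close>, which
  elements of \<open>determined\<close> do not see; so the sum at \<open>E\<close> is reindexed by
  \<open>bij_reps\<close> into the sum at \<open>E'\<close>.\<close>

lemma map_trace:
  assumes "\<tau> \<in> \<Gamma>" "mor_dom \<tau> = E" "mor_rng \<tau> = E'" "x \<in> determined"
  shows "trace E x \<in> E" "mor_map \<tau> (trace E x) = trace E' x"
proof -
  have E: "mor_map \<gamma> x \<in> E" if "\<gamma> \<in> reps E" for \<gamma>
    using hom_toD[OF reps_hom_to[OF that]] determined_F[OF assms(4)] mor_map_in_rng[of x \<gamma>] by simp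
  have sum: "trace E x \<in> E" "mor_map \<tau> (trace E x) = (\<Oplus>\<gamma>\<in>reps E. mor_map \<tau> (mor_map \<gamma> x))"
    using map_sum[OF assms(1) finite_reps[of E], of "\<lambda>\<gamma>. mor_map \<gamma> x"] E assms(2) by (simp_all add: trace_def)
  show "trace E x \<in> E" by fact
  have eq: "mor_map \<tau> (mor_map \<gamma> x) = mor_map (rep (mor_comp \<tau> \<gamma>)) x" if "\<gamma> \<in> reps E" for \<gamma>
  proof -
    have g: "\<gamma> \<in> hom_to E" by (rule reps_hom_to[OF that])
    have tg: "mor_comp \<tau> \<gamma> \<in> hom_to E'" using hom_to_comp[OF g assms(1,2)] assms(3) by simp
    show ?thesis
      using determined_agree[OF assms(4) rep(1)[OF tg] tg rep(2)[OF tg]] determined_F[OF assms(4)] hom_toD(2)[OF g] by simp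
  qed
  have carr: "mor_map \<gamma> x \<in> carrier A" if "\<gamma> \<in> reps E'" for \<gamma>
    using hom_toD[OF reps_hom_to[OF that]] determined_F[OF assms(4)] map_carrier[of \<gamma> x] by simp
  note bij = bij_reps[OF assms(1-3)]
  have "mor_map \<tau> (trace E x) = (\<Oplus>\<gamma>\<in>reps E. mor_map (rep (mor_comp \<tau> \<gamma>)) x)"
    unfolding sum(2) using carr bij_betwE[OF bij] by (intro finsum_cong') (auto simp: eq)
  also have "\<dots> = (\<Oplus>\<gamma>\<in>(\<lambda>\<gamma>. rep (mor_comp \<tau> \<gamma>)) ` reps E. mor_map \<gamma> x)"
    using carr bij_betw_imp_inj_on[OF bij] bij_betw_imp_surj_on[OF bij]
    by (intro add.finprod_reindex[symmetric]) auto
  also have "\<dots> = trace E' x"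
    using bij_betw_imp_surj_on[OF bij] by (simp add: trace_def)
  finally show "mor_map \<tau> (trace E x) = trace E' x" .
qed

text \<open>Distinct representatives already differ on \<open>B\<close>, hence are distinct
  characters of the monoid \<open>determined\<close>; a sum with all coefficients one cannot vanish
  identically on it.\<close>

lemma trace_nonzero: "\<exists>x\<in>determined. trace F x \<noteq> \<zero>"
proof (rule ccontr)
  assume "\<not> ?thesis"
  then have 0: "trace F x = \<zero>" if "x \<in> determined" for x using that by blast
  have carr: "mor_map \<gamma> x \<in> carrier A" if "\<gamma> \<in> reps F" "x \<in> determined" for \<gamma> x
    using hom_toD[OF reps_hom_to[OF that(1)]] determined_F[OF that(2)] map_carrier[of \<gamma> x] by simp
  \<comment> \<open>The representative of the identity shows that \<open>reps F\<close> is not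
    empty, so that there is a coefficient to be forced to zero.\<close>
  have "mor_id F \<in> hom_to F" using F by (simp add: hom_to_def)
  then have mem: "rep (mor_id F) \<in> reps F" by (rule rep_in_reps)
  have one: "\<one> \<in> determined"
  proof -
    have "mor_map \<gamma> \<one> = mor_map \<gamma>' \<one>" if "\<gamma> \<in> hom_to E" "\<gamma>' \<in> hom_to E" for E \<gamma> \<gamma>'
      using hom_toD(1)[OF that(1)] hom_toD(1)[OF that(2)] by (simp add: map_one)
    then show ?thesis unfolding determined_def using F_props(2) by blast
  qed
  have "\<one> = \<zero>"
  proof (rule independent_characters[where I = "reps F" and M = determined and \<chi> = mor_map and c = "\<lambda>_. \<one>", OF finite_reps])
    show "determined \<subseteq> carrier A" using determined_F F_props(1) by blast
    show "(\<Oplus>\<gamma>\<in>reps F. \<one> \<otimes> mor_map \<gamma> x) = \<zero>" if "x \<in> determined" for x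
    proof -
      have "(\<Oplus>\<gamma>\<in>reps F. \<one> \<otimes> mor_map \<gamma> x) = trace F x"
        unfolding trace_def using carr that by (intro finsum_cong') auto
      then show ?thesis using 0[OF that] by simp
    qed
    show "\<exists>x\<in>determined. mor_map \<gamma> x \<noteq> mor_map \<gamma>' x" if "\<gamma> \<in> reps F" "\<gamma>' \<in> reps F" "\<gamma> \<noteq> \<gamma>'" for \<gamma> \<gamma>'
      using reps_distinct[OF that(1,2)] that(3) B_sub_determined unfolding agree_def by blast
    show "mor_map \<gamma> (x \<otimes> y) = mor_map \<gamma> x \<otimes> mor_map \<gamma> y"
      if "\<gamma> \<in> reps F" "x \<in> determined" "y \<in> determined" for \<gamma> x y
      using hom_toD[OF reps_hom_to[OF that(1)]] determined_F[OF that(2)] determined_F[OF that(3)] by (simp add: map_mult)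
    show "mor_map \<gamma> \<one> = \<one>" if "\<gamma> \<in> reps F" for \<gamma>
      using hom_toD[OF reps_hom_to[OF that]] by (simp add: map_one)
  qed (use carr mem determined_mult one in auto)
  then show False by simp
qed

text \<open>A trace t is sent to the same element by all morphisms with a given target, hence so is
  its inverse \<open>t'\<close>; so \<open>t'\<close> is again in \<open>determined\<close> and can
  be taken out of the trace at \<open>F\<close>. Connectedness carries the value one from
  \<open>F\<close> to the other objects.\<close>

lemma exists_trace_one: "\<exists>x\<in>determined. \<forall>E. mor_id E \<in> \<Gamma> \<longrightarrow> trace E x = \<one>"
proof -
  obtain x where x: "x \<in> determined" "trace F x \<noteq> \<zero>" using trace_nonzero by blast
  define t where "t = trace F x"
  have t: "t \<in> F" using map_trace(1)[OF F _ _ x(1), of F F] by (simp add: t_def)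
  define t' where "t' = inv t"
  have t': "t' \<in> F" "t \<otimes> t' = \<one>"
    using subfield_m_inv[OF F_props(4), of t] t x(2) by (auto simp: t'_def t_def)
  have carr: "t \<in> carrier A" "t' \<in> carrier A" "x \<in> carrier A"
    using t t'(1) determined_F[OF x(1)] F_props(1) by auto
  have fix_t: "mor_map \<gamma> t = trace E x" if "\<gamma> \<in> hom_to E" for \<gamma> E
    using map_trace(2)[OF hom_toD(1-3)[OF that] x(1)] by (simp add: t_def)
  have inv_t: "mor_map \<gamma> t \<otimes> mor_map \<gamma> t' = \<one>" if "\<gamma> \<in> hom_to E" for \<gamma> E
    using map_mult[OF hom_toD(1)[OF that], of t t'] map_one[OF hom_toD(1)[OF that]]
      hom_toD(2)[OF that] t t' by simp
  \<comment> \<open>Both images are inverse to the same element \<open>trace E x\<close>.\<close>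
  have fix_t': "mor_map \<gamma> t' = mor_map \<gamma>' t'" if g: "\<gamma> \<in> hom_to E" "\<gamma>' \<in> hom_to E" for \<gamma> \<gamma>' E
  proof -
    have "mor_map \<gamma> t \<in> carrier A" "mor_map \<gamma> t' \<in> carrier A" "mor_map \<gamma>' t' \<in> carrier A"
      using map_carrier hom_toD[OF g(1)] hom_toD[OF g(2)] t t'(1) by simp_all
    then show ?thesis
      using inv_t[OF g(1)] inv_t[OF g(2)] fix_t[OF g(1)] fix_t[OF g(2)]
      by (metis inv_unique m_comm)
  qed
  have t'_det: "t' \<in> determined"
    unfolding determined_def using t'(1) fix_t' by blast
  have tx: "t' \<otimes> x \<in> determined" by (rule determined_mult[OF t'_det x(1)])
  have "trace F (t' \<otimes> x) = (\<Oplus>\<gamma>\<in>reps F. t' \<otimes> mor_map \<gamma> x)"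
    unfolding trace_def
  proof (rule finsum_cong')
    fix \<gamma> assume g: "\<gamma> \<in> reps F"
    note h = reps_hom_to[OF g]
    have "mor_map \<gamma> t' = mor_map (mor_id F) t'"
      using F by (intro fix_t'[OF h]) (simp add: hom_to_def)
    then show "mor_map \<gamma> (t' \<otimes> x) = t' \<otimes> mor_map \<gamma> x"
      using map_mult[OF hom_toD(1)[OF h], of t' x] hom_toD(2)[OF h] t'(1) determined_F[OF x(1)] by simp
  next
    show "(\<lambda>\<gamma>. t' \<otimes> mor_map \<gamma> x) \<in> reps F \<rightarrow> carrier A"
    proof
      fix \<gamma> assume "\<gamma> \<in> reps F"
      from hom_toD[OF reps_hom_to[OF this]] show "t' \<otimes> mor_map \<gamma> x \<in> carrier A"
        using map_carrier[of \<gamma> x] determined_F[OF x(1)] carr by simp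
    qed
  qed simp
  also have "\<dots> = t' \<otimes> trace F x"
    unfolding trace_def
  proof (rule finsum_rdistr[OF finite_reps carr(2), symmetric], rule Pi_I)
    fix \<gamma> assume "\<gamma> \<in> reps F"
    from hom_toD[OF reps_hom_to[OF this]] show "mor_map \<gamma> x \<in> carrier A"
      using map_carrier[of \<gamma> x] determined_F[OF x(1)] by simp
  qed
  also have "\<dots> = \<one>" using t'(2) carr by (simp add: m_comm flip: t_def)
  finally have one: "trace F (t' \<otimes> x) = \<one>" .
  have "trace E (t' \<otimes> x) = \<one>" if E: "mor_id E \<in> \<Gamma>" for E
  proof -
    obtain \<tau> where \<tau>: "\<tau> \<in> \<Gamma>" "mor_dom \<tau> = F" "mor_rng \<tau> = E"
      using connected[OF E] by blast
    show ?thesis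
      using map_trace(2)[OF \<tau> tx] map_one[OF \<tau>(1)] by (simp add: one)
  qed
  then show ?thesis using tx by blast
qed

lemma teq_agree:
  assumes g: "\<gamma> \<in> hom_to E" and g': "\<gamma>' \<in> hom_to E" and ag: "agree \<gamma> \<gamma>'" and x: "x \<in> determined"
  shows "tensor.teq (frag_of (mon (mor_map \<gamma>' x) \<gamma>', inv_mon \<gamma>')) (frag_of (mon (mor_map \<gamma> x) \<gamma>, inv_mon \<gamma>))"
proof -
  note h = hom_toD[OF g] and h' = hom_toD[OF g']
  have eq: "mor_comp \<gamma> (mor_comp (mor_inv \<gamma>) \<gamma>') = \<gamma>'" using h h' by simp
  have x_eq: "mor_map \<gamma>' x = mor_map \<gamma> x" using determined_agree[OF x g g' ag] by simp
  have "mor_map \<gamma> x \<in> mor_rng \<gamma>" using mor_map_in_rng[of x \<gamma>] determined_F[OF x] h by simp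
  moreover have "mor_dom \<gamma> = mor_rng (mor_comp (mor_inv \<gamma>) \<gamma>')" using h h' by simp
  ultimately show ?thesis
    using teq_sub_translate[OF h(1) agree_sub[OF g g' ag], of "mor_map \<gamma> x"] by (simp add: eq x_eq)
qed

lemma separable: "separable_rng_extension CP sub.CP"
proof -
  obtain x where x: "x \<in> determined" and tr: "\<And>E. mor_id E \<in> \<Gamma> \<Longrightarrow> trace E x = \<one>"
    using exists_trace_one by blast
  define I where "I E = (if mor_id E \<in> \<Gamma> then reps E else {})" for E
  define p where "p E \<gamma> = mon (mor_map \<gamma> x) \<gamma>" for E :: "'a set" and \<gamma>
  define q where "q E \<gamma> = inv_mon \<gamma>" for E :: "'a set" and \<gamma>
  have I: "\<gamma> \<in> hom_to E" "mor_map \<gamma> x \<in> mor_rng \<gamma>" if "\<gamma> \<in> I E" for \<gamma> E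
  proof -
    show "\<gamma> \<in> hom_to E" using that reps_hom_to by (auto simp: I_def split: if_splits)
    from hom_toD[OF this] show "mor_map \<gamma> x \<in> mor_rng \<gamma>"
      using mor_map_in_rng[of x \<gamma>] determined_F[OF x] by simp
  qed
  show ?thesis
  \<comment> \<open>The summands at \<open>E\<close> start with morphisms of range \<open>E\<close>,
    so a product of \<open>f\<close> with one of them can be nonzero only if the support of
    \<open>f\<close> contains a morphism starting at \<open>E\<close>. This is the source of
    \<open>V\<close>.\<close>
  proof (rule tensor.separable_criterion[where I = I and p = p and q = q and V = "\<lambda>f. mor_dom ` {\<gamma>. f \<gamma> \<noteq> \<zero>}"
        and H = "{mon a \<tau> | a \<tau>. \<tau> \<in> \<Gamma> \<and> a \<in> mor_rng \<tau>}"])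
    show "subrng sub.CP CP" by (rule subrng_CP)
    show "finite (I E)" for E by (simp add: I_def finite_reps)
    show "p E \<gamma> \<in> carrier CP" "q E \<gamma> \<in> carrier CP" if "\<gamma> \<in> I E" for E \<gamma>
      using I[OF that] hom_toD(1)[OF I(1)[OF that]] by (simp_all add: p_def q_def mon_closed inv_mon_closed)
    show "finite (mor_dom ` {\<gamma>. f \<gamma> \<noteq> \<zero>})" if "f \<in> carrier CP" for f
      using CP_finite[OF that] by simp
    show "f \<otimes>\<^bsub>CP\<^esub> p E \<gamma> = \<zero>\<^bsub>CP\<^esub>"
      if "f \<in> carrier CP" "E \<notin> mor_dom ` {\<gamma>. f \<gamma> \<noteq> \<zero>}" "\<gamma> \<in> I E" for f E \<gamma>
      unfolding p_def using that(2) hom_toD(3)[OF I(1)[OF that(3)]] by (intro mult_mon_disjoint) blast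
    show "{mon a \<tau> | a \<tau>. \<tau> \<in> \<Gamma> \<and> a \<in> mor_rng \<tau>} \<subseteq> carrier CP"
      using mon_closed by blast
    show "P f" if "f \<in> carrier CP" "P \<zero>\<^bsub>CP\<^esub>" "\<And>a. a \<in> {mon a \<tau> | a \<tau>. \<tau> \<in> \<Gamma> \<and> a \<in> mor_rng \<tau>} \<Longrightarrow> P a"
      "\<And>f g. \<lbrakk>f \<in> carrier CP; g \<in> carrier CP; P f; P g\<rbrakk> \<Longrightarrow> P (f \<oplus>\<^bsub>CP\<^esub> g)" for P f
      by (rule CP_induct[of f P]) (use that in blast)+
    fix h assume "h \<in> {mon a \<tau> | a \<tau>. \<tau> \<in> \<Gamma> \<and> a \<in> mor_rng \<tau>}"
    then obtain a \<tau> where \<tau>: "\<tau> \<in> \<Gamma>" and a: "a \<in> mor_rng \<tau>" and h: "h = mon a \<tau>" by blast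
    have IE: "I (mor_dom \<tau>) = reps (mor_dom \<tau>)" "I (mor_rng \<tau>) = reps (mor_rng \<tau>)"
      using \<tau> by (simp_all add: I_def id_dom id_rng)
    have fin: "finite (I (mor_dom \<tau>))" by (simp add: IE finite_reps)
    have h_closed: "h \<in> carrier CP" unfolding h by (rule mon_closed[OF \<tau> a])
    have 1: "h \<otimes>\<^bsub>CP\<^esub> p E \<gamma> = \<zero>\<^bsub>CP\<^esub>" if "E \<noteq> mor_dom \<tau>" "\<gamma> \<in> I E" for E \<gamma>
      using I[OF that(2)] hom_toD[OF I(1)[OF that(2)]] that(1) \<tau> a by (simp add: h p_def mon_mult_mon)
    have 2: "q E \<gamma> \<otimes>\<^bsub>CP\<^esub> h = \<zero>\<^bsub>CP\<^esub>" if "E \<noteq> mor_rng \<tau>" "\<gamma> \<in> I E" for E \<gamma>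
      using hom_toD[OF I(1)[OF that(2)]] that(1) \<tau> a inv_coeff(1)[of \<gamma>]
      by (simp add: h q_def inv_mon_def mon_mult_mon inv_closed)
    \<comment> \<open>The indices asked for by the criterion are the domain and the range of \<tau>.
      Equivariance moves \<open>h\<close> to the right factor, \<open>teq_agree\<close> replaces
      \<tau>\<gamma> by its representative, and \<open>bij_reps\<close> then reindexes the
      sum.\<close>
    have "tensor.teq (\<Sum>\<gamma>\<in>reps (mor_dom \<tau>). frag_of (h \<otimes>\<^bsub>CP\<^esub> p (mor_dom \<tau>) \<gamma>, q (mor_dom \<tau>) \<gamma>))
        (\<Sum>\<gamma>\<in>reps (mor_dom \<tau>). frag_of (p (mor_rng \<tau>) (rep (mor_comp \<tau> \<gamma>)), q (mor_rng \<tau>) (rep (mor_comp \<tau> \<gamma>)) \<otimes>\<^bsub>CP\<^esub> h))"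
    proof (rule tensor.teq_sum)
      fix \<gamma> assume "\<gamma> \<in> reps (mor_dom \<tau>)"
      then have g: "\<gamma> \<in> hom_to (mor_dom \<tau>)" "mor_map \<gamma> x \<in> mor_rng \<gamma>"
        using I[of \<gamma> "mor_dom \<tau>"] by (simp_all add: IE)
      note hg = hom_toD[OF g(1)]
      let ?\<rho> = "mor_comp \<tau> \<gamma>"
      have \<rho>: "?\<rho> \<in> hom_to (mor_rng \<tau>)" by (rule hom_to_comp[OF g(1) \<tau> refl])
      have "tensor.teq (frag_of (mon a \<tau> \<otimes>\<^bsub>CP\<^esub> mon (mor_map \<gamma> x) \<gamma>, inv_mon \<gamma>))
          (frag_of (mon (mor_map \<tau> (mor_map \<gamma> x)) ?\<rho>, inv_mon ?\<rho> \<otimes>\<^bsub>CP\<^esub> mon a \<tau>))"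
        by (rule teq_equivariant[OF \<tau> hg(1) _ a g(2)]) (simp add: hg)
      also have "frag_of (mon (mor_map \<tau> (mor_map \<gamma> x)) ?\<rho>, inv_mon ?\<rho> \<otimes>\<^bsub>CP\<^esub> mon a \<tau>)
          = tensor.rmul h (frag_of (mon (mor_map ?\<rho> x) ?\<rho>, inv_mon ?\<rho>))"
        using determined_F[OF x] hg by (simp add: h)
      also have "tensor.teq (tensor.rmul h (frag_of (mon (mor_map ?\<rho> x) ?\<rho>, inv_mon ?\<rho>)))
          (tensor.rmul h (frag_of (mon (mor_map (rep ?\<rho>) x) (rep ?\<rho>), inv_mon (rep ?\<rho>))))"
        by (rule tensor.rmul_teq[OF h_closed teq_agree[OF rep(1)[OF \<rho>] \<rho> rep(2)[OF \<rho>] x]])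
      finally show "tensor.teq (frag_of (h \<otimes>\<^bsub>CP\<^esub> p (mor_dom \<tau>) \<gamma>, q (mor_dom \<tau>) \<gamma>))
          (frag_of (p (mor_rng \<tau>) (rep ?\<rho>), q (mor_rng \<tau>) (rep ?\<rho>) \<otimes>\<^bsub>CP\<^esub> h))"
        by (simp add: p_def q_def h)
    qed
    also have "(\<Sum>\<gamma>\<in>reps (mor_dom \<tau>). frag_of (p (mor_rng \<tau>) (rep (mor_comp \<tau> \<gamma>)), q (mor_rng \<tau>) (rep (mor_comp \<tau> \<gamma>)) \<otimes>\<^bsub>CP\<^esub> h))
        = (\<Sum>\<rho>\<in>reps (mor_rng \<tau>). frag_of (p (mor_rng \<tau>) \<rho>, q (mor_rng \<tau>) \<rho> \<otimes>\<^bsub>CP\<^esub> h))"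
      by (rule sum.reindex_bij_betw[OF bij_reps[OF \<tau> refl refl]])
    finally have 3: "tensor.teq (\<Sum>\<gamma>\<in>I (mor_dom \<tau>). frag_of (h \<otimes>\<^bsub>CP\<^esub> p (mor_dom \<tau>) \<gamma>, q (mor_dom \<tau>) \<gamma>))
        (\<Sum>\<rho>\<in>I (mor_rng \<tau>). frag_of (p (mor_rng \<tau>) \<rho>, q (mor_rng \<tau>) \<rho> \<otimes>\<^bsub>CP\<^esub> h))"
      by (simp add: IE)
    have coeff: "a \<otimes> mor_map \<tau> (mor_map \<gamma> x) \<in> mor_rng \<tau>" "mor_map \<tau> (mor_map \<gamma> x) \<in> carrier A"
      "mor_map \<gamma> x \<in> mor_dom \<tau>"
      "(h \<otimes>\<^bsub>CP\<^esub> p (mor_dom \<tau>) \<gamma>) \<otimes>\<^bsub>CP\<^esub> q (mor_dom \<tau>) \<gamma> = mon (a \<otimes> mor_map \<tau> (mor_map \<gamma> x)) \<tau>"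
      if "\<gamma> \<in> I (mor_dom \<tau>)" for \<gamma>
    proof -
      note g = I[OF that] and hg = hom_toD[OF I(1)[OF that]]
      show d: "mor_map \<gamma> x \<in> mor_dom \<tau>" using g(2) hg by simp
      then have t: "mor_map \<tau> (mor_map \<gamma> x) \<in> mor_rng \<tau>" by auto
      then show "a \<otimes> mor_map \<tau> (mor_map \<gamma> x) \<in> mor_rng \<tau>" "mor_map \<tau> (mor_map \<gamma> x) \<in> carrier A"
        using rng_props(5)[OF \<tau> a] map_carrier[OF \<tau> d] by blast+
      then have c: "a \<otimes> mor_map \<tau> (mor_map \<gamma> x) \<in> carrier A" using rng_props(1)[OF \<tau>] by blast
      have "(h \<otimes>\<^bsub>CP\<^esub> p (mor_dom \<tau>) \<gamma>) \<otimes>\<^bsub>CP\<^esub> q (mor_dom \<tau>) \<gamma> = h \<otimes>\<^bsub>CP\<^esub> (p (mor_dom \<tau>) \<gamma> \<otimes>\<^bsub>CP\<^esub> q (mor_dom \<tau>) \<gamma>)"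
        using h_closed g hg by (intro tensor.m_assoc) (simp_all add: p_def q_def mon_closed inv_mon_closed)
      also have "p (mor_dom \<tau>) \<gamma> \<otimes>\<^bsub>CP\<^esub> q (mor_dom \<tau>) \<gamma> = mon (mor_map \<gamma> x) (mor_id (mor_dom \<tau>))"
        using mon_mult_inv_mon[OF hg(1) g(2)] by (simp add: p_def q_def hg)
      also have "h \<otimes>\<^bsub>CP\<^esub> mon (mor_map \<gamma> x) (mor_id (mor_dom \<tau>)) = mon (a \<otimes> mor_map \<tau> (mor_map \<gamma> x)) \<tau>"
        using \<tau> a d c by (simp add: h mon_mult_mon id_dom)
      finally show "(h \<otimes>\<^bsub>CP\<^esub> p (mor_dom \<tau>) \<gamma>) \<otimes>\<^bsub>CP\<^esub> q (mor_dom \<tau>) \<gamma> = mon (a \<otimes> mor_map \<tau> (mor_map \<gamma> x)) \<tau>" .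
    qed
    \<comment> \<open>Each product of \<open>u\<^sub>\<gamma>\<close> with its inverse collapses to
      an idempotent, leaving \<open>a\<close> times the image under \<tau> of the trace of x, which
      is one.\<close>
    have "(\<Oplus>\<^bsub>CP\<^esub>\<gamma>\<in>I (mor_dom \<tau>). (h \<otimes>\<^bsub>CP\<^esub> p (mor_dom \<tau>) \<gamma>) \<otimes>\<^bsub>CP\<^esub> q (mor_dom \<tau>) \<gamma>)
        = (\<Oplus>\<^bsub>CP\<^esub>\<gamma>\<in>I (mor_dom \<tau>). mon (a \<otimes> mor_map \<tau> (mor_map \<gamma> x)) \<tau>)"
      by (rule tensor.finsum_cong') (simp_all add: coeff mon_closed \<tau> Pi_I)
    also have "\<dots> = mon (\<Oplus>\<gamma>\<in>I (mor_dom \<tau>). a \<otimes> mor_map \<tau> (mor_map \<gamma> x)) \<tau>"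
      by (rule finsum_mon[OF _ coeff(1) \<tau>]) (simp_all add: fin)
    also have "(\<Oplus>\<gamma>\<in>I (mor_dom \<tau>). a \<otimes> mor_map \<tau> (mor_map \<gamma> x))
        = a \<otimes> (\<Oplus>\<gamma>\<in>I (mor_dom \<tau>). mor_map \<tau> (mor_map \<gamma> x))"
      using subsetD[OF rng_props(1)[OF \<tau>] a] by (intro finsum_rdistr[symmetric]) (simp_all add: coeff fin Pi_I)
    also have "(\<Oplus>\<gamma>\<in>I (mor_dom \<tau>). mor_map \<tau> (mor_map \<gamma> x)) = mor_map \<tau> (trace (mor_dom \<tau>) x)"
      using map_sum[OF \<tau>, of "I (mor_dom \<tau>)" "\<lambda>\<gamma>. mor_map \<gamma> x"] coeff(3)
      by (simp add: trace_def IE finite_reps)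
    also have "\<dots> = \<one>"
      using tr[OF id_dom[OF \<tau>]] by (simp add: map_one \<tau>)
    finally have 4: "(\<Oplus>\<^bsub>CP\<^esub>\<gamma>\<in>I (mor_dom \<tau>). (h \<otimes>\<^bsub>CP\<^esub> p (mor_dom \<tau>) \<gamma>) \<otimes>\<^bsub>CP\<^esub> q (mor_dom \<tau>) \<gamma>) = h"
      using subsetD[OF rng_props(1)[OF \<tau>] a] by (simp add: h)
    show "\<exists>v w. (\<forall>u. u \<noteq> v \<longrightarrow> (\<forall>i\<in>I u. h \<otimes>\<^bsub>CP\<^esub> p u i = \<zero>\<^bsub>CP\<^esub>)) \<and>
        (\<forall>u. u \<noteq> w \<longrightarrow> (\<forall>i\<in>I u. q u i \<otimes>\<^bsub>CP\<^esub> h = \<zero>\<^bsub>CP\<^esub>)) \<and>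
        tensor.teq (\<Sum>i\<in>I v. frag_of (h \<otimes>\<^bsub>CP\<^esub> p v i, q v i)) (\<Sum>i\<in>I w. frag_of (p w i, q w i \<otimes>\<^bsub>CP\<^esub> h)) \<and>
        (\<Oplus>\<^bsub>CP\<^esub>i\<in>I v. (h \<otimes>\<^bsub>CP\<^esub> p v i) \<otimes>\<^bsub>CP\<^esub> q v i) = h"
      by (intro exI[of _ "mor_dom \<tau>"] exI[of _ "mor_rng \<tau>"] conjI allI impI ballI 1 2 3 4)
  qed
qed

end

section \<open>Closed subgroups of finite index are open\<close>

context field_groupoid_pair
begin

lemma carrier_vertex_group:
  "\<gamma> \<in> carrier (vertex_group \<Gamma> E) \<longleftrightarrow> \<gamma> \<in> \<Gamma> \<and> mor_dom \<gamma> = E \<and> mor_rng \<gamma> = E"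
  "\<gamma> \<in> carrier (vertex_group \<Delta> E) \<longleftrightarrow> \<gamma> \<in> \<Delta> \<and> mor_dom \<gamma> = E \<and> mor_rng \<gamma> = E"
  by (simp_all add: vertex_group_def)

lemma mult_vertex_group: "\<gamma> \<otimes>\<^bsub>vertex_group \<Gamma> E\<^esub> \<tau> = mor_comp \<gamma> \<tau>"
  by (simp add: vertex_group_def)

lemma topspace_krull: "topspace (krull_topology \<Gamma> E) = carrier (vertex_group \<Gamma> E)"
proof -
  have "krull_open \<Gamma> E (carrier (vertex_group \<Gamma> E))"
    unfolding krull_open_def
  proof (intro conjI order_refl ballI exI[of _ "{}"])
    fix \<gamma> assume g: "\<gamma> \<in> carrier (vertex_group \<Gamma> E)"
    show "\<gamma> <#\<^bsub>vertex_group \<Gamma> E\<^esub> pointwise_stabilizer \<Gamma> E {} \<subseteq> carrier (vertex_group \<Gamma> E)"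
    proof
      fix x assume "x \<in> \<gamma> <#\<^bsub>vertex_group \<Gamma> E\<^esub> pointwise_stabilizer \<Gamma> E {}"
      then obtain \<gamma>' where "\<gamma>' \<in> carrier (vertex_group \<Gamma> E)" "x = mor_comp \<gamma> \<gamma>'"
        unfolding l_coset_def pointwise_stabilizer_def by (auto simp: vertex_group_def)
      then show "x \<in> carrier (vertex_group \<Gamma> E)"
        using g by (simp add: carrier_vertex_group comp_closed)
    qed
  qed simp_all
  moreover have "U \<subseteq> carrier (vertex_group \<Gamma> E)" if "krull_open \<Gamma> E U" for U
    using that by (simp add: krull_open_def)
  ultimately show ?thesis
    unfolding topspace_def openin_krull_topology by blast
qed

text \<open>Write H for the subgroup. Each right coset other than H has a representative with a
  basic neighbourhood missing H; as there are finitely many cosets, \<open>B\<close> can collect the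
  finite sets defining these neighbourhoods. If \<gamma> outside H fixed \<open>B\<close>, let
  \<rho> = h\<gamma> be the representative of its coset, with h in H. Then
  \<open>\<rho> \<gamma>\<^sup>-\<^sup>1 = h\<close> would lie in the neighbourhood of \<rho>, hence
  outside H.\<close>

lemma open_if_closed_finite_index:
  assumes E: "mor_id E \<in> \<Gamma>"
    and closed: "closedin (krull_topology \<Gamma> E) (carrier (vertex_group \<Delta> E))"
    and fin: "finite (rcosets\<^bsub>vertex_group \<Gamma> E\<^esub> carrier (vertex_group \<Delta> E))"
  shows "\<exists>B. finite B \<and> B \<subseteq> E \<and>
    (\<forall>\<gamma>\<in>\<Gamma>. mor_dom \<gamma> = E \<longrightarrow> mor_rng \<gamma> = E \<longrightarrow> (\<forall>x\<in>B. mor_map \<gamma> x = x) \<longrightarrow> \<gamma> \<in> \<Delta>)"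
proof -
  let ?G = "carrier (vertex_group \<Gamma> E)" and ?H = "carrier (vertex_group \<Delta> E)"
  let ?coset = "\<lambda>\<gamma>. ?H #>\<^bsub>vertex_group \<Gamma> E\<^esub> \<gamma>"
  have "krull_open \<Gamma> E (?G - ?H)"
    using closed unfolding closedin_def topspace_krull openin_krull_topology by blast
  then have "\<forall>\<gamma>\<in>?G - ?H. \<exists>B. finite B \<and> B \<subseteq> E \<and> \<gamma> <#\<^bsub>vertex_group \<Gamma> E\<^esub> pointwise_stabilizer \<Gamma> E B \<subseteq> ?G - ?H"
    by (simp add: krull_open_def)
  then obtain N where N: "\<And>\<gamma>. \<gamma> \<in> ?G - ?H \<Longrightarrow> finite (N \<gamma>)" "\<And>\<gamma>. \<gamma> \<in> ?G - ?H \<Longrightarrow> N \<gamma> \<subseteq> E"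
      "\<And>\<gamma>. \<gamma> \<in> ?G - ?H \<Longrightarrow> \<gamma> <#\<^bsub>vertex_group \<Gamma> E\<^esub> pointwise_stabilizer \<Gamma> E (N \<gamma>) \<subseteq> ?G - ?H"
    by metis
  define r where "r c = (SOME \<gamma>. \<gamma> \<in> c \<and> \<gamma> \<in> ?G - ?H)" for c
  define \<C> where "\<C> = {c \<in> rcosets\<^bsub>vertex_group \<Gamma> E\<^esub> ?H. \<exists>\<gamma>. \<gamma> \<in> c \<and> \<gamma> \<in> ?G - ?H}"
  have r: "r c \<in> c" "r c \<in> ?G - ?H" if "c \<in> \<C>" for c
  proof -
    have "\<exists>\<gamma>. \<gamma> \<in> c \<and> \<gamma> \<in> ?G - ?H" using that unfolding \<C>_def by blast
    from someI_ex[OF this] show "r c \<in> c" "r c \<in> ?G - ?H" unfolding r_def by blast+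
  qed
  define B where "B = (\<Union>c\<in>\<C>. N (r c))"
  have "finite \<C>" by (rule finite_subset[OF _ fin]) (auto simp: \<C>_def)
  then have "finite B" unfolding B_def using N(1)[OF r(2)] by (rule finite_UN_I)
  moreover have "B \<subseteq> E" unfolding B_def using N(2)[OF r(2)] by blast
  moreover have "\<gamma> \<in> \<Delta>"
    if \<gamma>: "\<gamma> \<in> \<Gamma>" "mor_dom \<gamma> = E" "mor_rng \<gamma> = E" and fix_B: "\<And>x. x \<in> B \<Longrightarrow> mor_map \<gamma> x = x" for \<gamma>
  proof (rule ccontr)
    assume "\<gamma> \<notin> \<Delta>"
    then have gG: "\<gamma> \<in> ?G - ?H" using \<gamma> by (simp add: carrier_vertex_group)
    have "mor_id E \<in> ?H"
      using sub_id_dom[OF E] by (simp add: carrier_vertex_group)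
    moreover have "mor_comp (mor_id E) \<gamma> = \<gamma>" using id_comp[OF \<gamma>(1)] \<gamma>(3) by simp
    ultimately have "\<gamma> \<in> ?coset \<gamma>"
      unfolding r_coset_def mult_vertex_group by (intro UN_I[of "mor_id E"]) simp_all
    moreover have "?coset \<gamma> \<in> rcosets\<^bsub>vertex_group \<Gamma> E\<^esub> ?H"
      using gG unfolding RCOSETS_def by blast
    ultimately have C: "?coset \<gamma> \<in> \<C>"
      using gG unfolding \<C>_def by blast
    define \<rho> where "\<rho> = r (?coset \<gamma>)"
    have "\<rho> \<in> ?coset \<gamma>" unfolding \<rho>_def by (rule r(1)[OF C])
    then obtain h where h: "h \<in> ?H" "\<rho> = mor_comp h \<gamma>"
      unfolding r_coset_def mult_vertex_group UN_iff singleton_iff by (elim bexE)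
    have inv: "mor_inv \<gamma> \<in> pointwise_stabilizer \<Gamma> E (N \<rho>)"
      unfolding pointwise_stabilizer_def
    proof (intro CollectI conjI ballI)
      show "mor_inv \<gamma> \<in> ?G" using \<gamma> by (simp add: carrier_vertex_group inv_closed)
      fix x assume x: "x \<in> N \<rho>"
      then have "x \<in> B" "x \<in> E"
        using C N(2)[OF r(2)[OF C]] unfolding B_def \<rho>_def by blast+
      then show "mor_map (mor_inv \<gamma>) x = x"
        using map_inv_map[OF \<gamma>(1), of x] fix_B[of x] \<gamma>(2) by simp
    qed
    have "mor_comp \<rho> (mor_inv \<gamma>) = h"
      using h \<gamma> comp_id[of h] sub_closed[of h] by (simp add: carrier_vertex_group mor_comp_assoc)
    moreover have "mor_comp \<rho> (mor_inv \<gamma>) \<in> \<rho> <#\<^bsub>vertex_group \<Gamma> E\<^esub> pointwise_stabilizer \<Gamma> E (N \<rho>)"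
      using inv unfolding l_coset_def by (auto simp: vertex_group_def)
    ultimately have "h \<in> ?G - ?H"
      using N(3)[OF r(2)[OF C]] unfolding \<rho>_def[symmetric] by blast
    then show False using h(1) by blast
  qed
  ultimately show ?thesis by blast
qed

end

section \<open>The groupoid of conjugate fields\<close>

locale conjugate_setting = field A for A :: "('a, 'b) ring_scheme" (structure) +
  fixes K L N :: "'a set"
  assumes subfield_K: "subfield K A" and subfield_L: "subfield L A" and subfield_N: "subfield N A"
    and L_sub: "L \<subseteq> N" and K_sub: "K \<subseteq> N"
    and algebraic_N: "x \<in> N \<Longrightarrow> (algebraic over K) x"
begin

section \<open>The Galois group\<close>

abbreviation G where "G \<equiv> galois_group K N"

lemma N_props: "N \<subseteq> carrier A" "\<zero> \<in> N" "\<one> \<in> N" "x \<in> N \<Longrightarrow> \<ominus> x \<in> N"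
  "\<lbrakk>x \<in> N; y \<in> N\<rbrakk> \<Longrightarrow> x \<otimes> y \<in> N" "\<lbrakk>x \<in> N; y \<in> N\<rbrakk> \<Longrightarrow> x \<oplus> y \<in> N"
  using subringE[OF subfieldE(1)[OF subfield_N]] by auto

lemma G_iff:
  "g \<in> G \<longleftrightarrow> bij_betw g N N \<and> (\<forall>x\<in>N. \<forall>y\<in>N. g (x \<otimes> y) = g x \<otimes> g y \<and> g (x \<oplus> y) = g x \<oplus> g y) \<and>
    g \<one> = \<one> \<and> g \<in> extensional N \<and> (\<forall>x\<in>K. g x = x)"
  unfolding galois_group_def ring_iso_def ring_hom_def by (auto simp: bij_betw_def)

lemma G_N: "\<lbrakk>g \<in> G; x \<in> N\<rbrakk> \<Longrightarrow> g x \<in> N"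
  unfolding G_iff using bij_betwE by blast

lemma G_simps:
  assumes "g \<in> G"
  shows "\<lbrakk>x \<in> N; y \<in> N\<rbrakk> \<Longrightarrow> g (x \<otimes> y) = g x \<otimes> g y" "\<lbrakk>x \<in> N; y \<in> N\<rbrakk> \<Longrightarrow> g (x \<oplus> y) = g x \<oplus> g y"
    "g \<one> = \<one>" "x \<in> K \<Longrightarrow> g x = x"
  using assms unfolding G_iff by blast+

lemma G_zero: "g \<in> G \<Longrightarrow> g \<zero> = \<zero>"
  using G_simps(4) subringE(2)[OF subfieldE(1)[OF subfield_K]] by blast

lemma G_id: "(\<lambda>x\<in>N. x) \<in> G"
  using N_props K_sub by (auto simp: G_iff bij_betw_def inj_on_def)

lemma G_comp: assumes "g \<in> G" "h \<in> G" shows "compose N g h \<in> G"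
  unfolding G_iff
proof (intro conjI ballI)
  have "bij_betw (g \<circ> h) N N"
    using assms unfolding G_iff by (meson bij_betw_trans)
  then show "bij_betw (compose N g h) N N"
    by (rule bij_betw_cong[THEN iffD1, rotated]) (simp add: compose_def)
qed (use G_N[OF assms(2)] G_simps[OF assms(1)] G_simps[OF assms(2)] N_props K_sub in \<open>auto simp: compose_def\<close>)

lemma G_inv:
  assumes "g \<in> G"
  obtains g' where "g' \<in> G" "\<And>x. x \<in> N \<Longrightarrow> g' (g x) = x" "\<And>x. x \<in> N \<Longrightarrow> g (g' x) = x"
proof -
  have bij: "bij_betw g N N" using assms unfolding G_iff by blast
  define g' where "g' = restrict (inv_into N g) N"
  have l: "g' (g x) = x" if "x \<in> N" for x
    using bij_betw_inv_into_left[OF bij that] G_N[OF assms that] by (simp add: g'_def)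
  have r: "g (g' x) = x" if "x \<in> N" for x
    using bij_betw_inv_into_right[OF bij that] that by (simp add: g'_def)
  have g'N: "g' x \<in> N" if "x \<in> N" for x
    using bij_betwE[OF bij_betw_inv_into[OF bij]] that by (simp add: g'_def)
  have "g' \<in> G"
    unfolding G_iff
  proof (intro conjI ballI)
    show "bij_betw g' N N"
      by (rule bij_betw_byWitness[where f' = g]) (use l r g'N G_N[OF assms] in auto)
    fix x y assume xy: "x \<in> N" "y \<in> N"
    have "g (g' x \<otimes> g' y) = x \<otimes> y" "g (g' x \<oplus> g' y) = x \<oplus> y"
      using xy g'N r by (simp_all add: G_simps[OF assms])
    then show "g' (x \<otimes> y) = g' x \<otimes> g' y" "g' (x \<oplus> y) = g' x \<oplus> g' y"
      using l[of "g' x \<otimes> g' y"] l[of "g' x \<oplus> g' y"] N_props(5,6)[OF g'N[OF xy(1)] g'N[OF xy(2)]] by simp_all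
  next
    show "g' \<one> = \<one>" using l[OF N_props(3)] G_simps(3)[OF assms] by simp
    show "g' x = x" if "x \<in> K" for x using l[of x] G_simps(4)[OF assms that] K_sub that by auto
  qed (simp add: g'_def)
  then show ?thesis using that l r by blast
qed

section \<open>Conjugate fields and the isomorphisms between them\<close>

abbreviation conj where "conj \<equiv> conjugate_fields K L N"
abbreviation \<Gamma> where "\<Gamma> \<equiv> conjugate_groupoid K L N"

lemma conj_N: "E \<in> conj \<Longrightarrow> E \<subseteq> N"
  unfolding conjugate_fields_def using G_N L_sub by blast

lemma conj_image: assumes "E \<in> conj" "g \<in> G" shows "g ` E \<in> conj"
proof -
  obtain h where h: "h \<in> G" "E = h ` L" using assms(1) unfolding conjugate_fields_def by blast
  have "g ` E = compose N g h ` L"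
    unfolding h(2) image_image using L_sub by (intro image_cong refl) (auto simp: compose_def)
  then show ?thesis
    unfolding conjugate_fields_def using G_comp[OF assms(2) h(1)] by blast
qed

lemma conj_L: "L \<in> conj"
  unfolding conjugate_fields_def using G_id L_sub
  by (intro CollectI exI[of _ "\<lambda>x\<in>N. x"]) (auto simp: image_def)

lemma conj_subfield: assumes "E \<in> conj" shows "subfield E A"
proof -
  obtain g where g: "g \<in> G" "E = g ` L" using assms unfolding conjugate_fields_def by blast
  note L = subringE[OF subfieldE(1)[OF subfield_L]]
  have N: "x \<in> N" if "x \<in> L" for x using that L_sub by blast
  have EN: "E \<subseteq> carrier A" using conj_N[OF assms] N_props(1) by blast
  have g_minus: "g (\<ominus> x) = \<ominus> g x" if "x \<in> L" for x
  proof -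
    have "g (\<ominus> x) \<oplus> g x = \<zero>"
      using G_simps(2)[OF g(1), of "\<ominus> x" x] that N N_props(1,4) G_zero[OF g(1)]
      by (simp add: l_neg subset_iff)
    then show ?thesis
      using minus_equality[of "g (\<ominus> x)" "g x"] G_N[OF g(1)] N[OF that] N_props(1,4) by (auto simp: subset_iff)
  qed
  show ?thesis
  proof (rule subfieldI')
    show "subring E A"
    proof (rule subringI[OF EN])
      show "\<one> \<in> E" using imageI[OF L(3), of g] G_simps(3)[OF g(1)] by (simp add: g(2))
    next
      fix h assume "h \<in> E"
      then obtain x where x: "x \<in> L" "h = g x" unfolding g(2) by blast
      then show "\<ominus> h \<in> E" using imageI[OF L(5)[OF x(1)], of g] g_minus[OF x(1)] by (simp add: g(2))
    next
      fix h h' assume "h \<in> E" "h' \<in> E"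
      then obtain x y where xy: "x \<in> L" "y \<in> L" "h = g x" "h' = g y" unfolding g(2) by blast
      then have "h \<otimes> h' = g (x \<otimes> y)" "h \<oplus> h' = g (x \<oplus> y)"
        using G_simps(1,2)[OF g(1), of x y] N by simp_all
      then show "h \<otimes> h' \<in> E" "h \<oplus> h' \<in> E"
        unfolding g(2) using L(6,7)[OF xy(1,2)] by simp_all
    qed
  next
    fix k assume k: "k \<in> E - {\<zero>}"
    then obtain x where x: "x \<in> L" "k = g x" unfolding g(2) by blast
    have "x \<noteq> \<zero>" using k x G_zero[OF g(1)] by auto
    then have ix: "inv x \<in> L" "x \<otimes> inv x = \<one>"
      using subfield_m_inv[OF subfield_L, of x] x(1) by auto
    then have "k \<otimes> g (inv x) = \<one>"
      using G_simps(1)[OF g(1), of x "inv x"] G_simps(3)[OF g(1)] N x by simp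
    then have "inv k = g (inv x)"
      using EN k ix(1) unfolding g(2) by (intro comm_inv_char) auto
    then show "inv k \<in> E" unfolding g(2) using ix(1) by simp
  qed
qed

text \<open>The target of a morphism is forced to be the image of its domain, and the image of a
  conjugate field under the Galois group is again conjugate; so no condition on the target
  remains.\<close>

lemma \<Gamma>_iff: "\<gamma> \<in> \<Gamma> \<longleftrightarrow> (\<exists>E\<in>conj. \<exists>g\<in>G. \<gamma> = (E, restrict g E))"
  unfolding conjugate_groupoid_def conjugate_homs_def using conj_image by auto

lemma mor_rng_restrict: "mor_rng (E, restrict g E) = g ` E"
  by (simp add: mor_rng_def)

lemma \<Gamma>_objects: "mor_id E \<in> \<Gamma> \<longleftrightarrow> E \<in> conj"
proof
  assume "E \<in> conj"
  moreover from this have "mor_id E = (E, restrict (\<lambda>x\<in>N. x) E)"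
    using conj_N by (auto simp: mor_id_def fun_eq_iff)
  ultimately show "mor_id E \<in> \<Gamma>" unfolding \<Gamma>_iff using G_id by blast
qed (auto simp: \<Gamma>_iff mor_id_def)

lemma \<Gamma>_dom: "\<gamma> \<in> \<Gamma> \<Longrightarrow> mor_dom \<gamma> \<in> conj" and \<Gamma>_rng: "\<gamma> \<in> \<Gamma> \<Longrightarrow> mor_rng \<gamma> \<in> conj"
  unfolding \<Gamma>_iff using conj_image by (auto simp: mor_rng_restrict)

lemma \<Gamma>_comp:
  assumes "\<gamma> \<in> \<Gamma>" "\<tau> \<in> \<Gamma>" "mor_dom \<gamma> = mor_rng \<tau>"
  shows "mor_comp \<gamma> \<tau> \<in> \<Gamma>"
proof -
  obtain E' g where g: "E' \<in> conj" "g \<in> G" "\<gamma> = (E', restrict g E')" using assms(1) unfolding \<Gamma>_iff by blast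
  obtain E h where h: "E \<in> conj" "h \<in> G" "\<tau> = (E, restrict h E)" using assms(2) unfolding \<Gamma>_iff by blast
  have E': "E' = h ` E" using assms(3) by (simp add: g(3) h(3) mor_rng_restrict)
  have "mor_comp \<gamma> \<tau> = (E, restrict (compose N g h) E)"
    using conj_N[OF h(1)] by (auto simp: mor_comp_def g(3) h(3) compose_def E' fun_eq_iff)
  then show ?thesis unfolding \<Gamma>_iff using h(1) G_comp[OF g(2) h(2)] by blast
qed

lemma \<Gamma>_inv:
  assumes "\<gamma> \<in> \<Gamma>"
  shows "\<exists>\<tau>\<in>\<Gamma>. mor_dom \<tau> = mor_rng \<gamma> \<and> mor_rng \<tau> = mor_dom \<gamma> \<and>
    mor_comp \<tau> \<gamma> = mor_id (mor_dom \<gamma>) \<and> mor_comp \<gamma> \<tau> = mor_id (mor_rng \<gamma>)"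
proof -
  obtain E g where g: "E \<in> conj" "g \<in> G" "\<gamma> = (E, restrict g E)" using assms unfolding \<Gamma>_iff by blast
  obtain g' where g': "g' \<in> G" "\<And>x. x \<in> N \<Longrightarrow> g' (g x) = x" "\<And>x. x \<in> N \<Longrightarrow> g (g' x) = x"
    using G_inv[OF g(2)] by blast
  let ?\<tau> = "(g ` E, restrict g' (g ` E))"
  have N: "x \<in> N" if "x \<in> E" for x using conj_N[OF g(1)] that by blast
  show ?thesis
  proof (intro bexI[of _ ?\<tau>] conjI)
    show "?\<tau> \<in> \<Gamma>" unfolding \<Gamma>_iff using conj_image[OF g(1,2)] g'(1) by blast
    have "g' ` g ` E = E"
      unfolding image_image using g'(2) N by (simp cong: image_cong)
    then show "mor_rng ?\<tau> = mor_dom \<gamma>" by (simp add: g(3) mor_rng_restrict)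
    show "mor_comp ?\<tau> \<gamma> = mor_id (mor_dom \<gamma>)" "mor_comp \<gamma> ?\<tau> = mor_id (mor_rng \<gamma>)"
      using g'(2) N unfolding mor_comp_def mor_id_def g(3) mor_rng_restrict
      by (auto simp: compose_def fun_eq_iff)
  qed (simp add: g(3) mor_rng_restrict)
qed

lemma \<Gamma>_groupoid: "wide_subgroupoid \<Gamma> \<Gamma>"
  unfolding wide_subgroupoid_def
proof (intro conjI ballI impI order_refl)
  show "mor_id (mor_dom \<gamma>) \<in> \<Gamma>" "mor_id (mor_rng \<gamma>) \<in> \<Gamma>" if "\<gamma> \<in> \<Gamma>" for \<gamma>
    using \<Gamma>_dom[OF that] \<Gamma>_rng[OF that] by (simp_all add: \<Gamma>_objects)
qed (fact \<Gamma>_comp \<Gamma>_inv)+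

lemma field_groupoid:
  assumes "normalized_cocycle \<Gamma> \<beta>"
  shows "field_groupoid A \<Gamma> \<beta>"
proof (intro field_groupoid.intro field_axioms field_groupoid_axioms.intro \<Gamma>_groupoid assms)
  fix \<gamma> assume \<gamma>: "\<gamma> \<in> \<Gamma>"
  obtain E g where g: "E \<in> conj" "g \<in> G" "\<gamma> = (E, restrict g E)" using \<gamma> unfolding \<Gamma>_iff by blast
  have N: "x \<in> N" if "x \<in> E" for x using conj_N[OF g(1)] that by blast
  note E = conj_subfield[OF g(1)]
  note E' = subringE[OF subfieldE(1)[OF E]]
  show "subfield (mor_dom \<gamma>) A" using E by (simp add: g(3))
  show "mor_map \<gamma> \<in> extensional (mor_dom \<gamma>)" by (simp add: g(3))
  show "mor_map \<gamma> \<one> = \<one>" using E'(3) G_simps(3)[OF g(2)] by (simp add: g(3))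
  show "mor_map \<gamma> (x \<oplus> y) = mor_map \<gamma> x \<oplus> mor_map \<gamma> y" "mor_map \<gamma> (x \<otimes> y) = mor_map \<gamma> x \<otimes> mor_map \<gamma> y"
    if "x \<in> mor_dom \<gamma>" "y \<in> mor_dom \<gamma>" for x y
    using that E'(6,7)[of x y] N G_simps(1,2)[OF g(2), of x y] by (simp_all add: g(3))
qed

text \<open>If F = g(L) and E = h(L), then \<open>h g\<^sup>-\<^sup>1\<close> restricts to a
  morphism from F to E.\<close>

lemma \<Gamma>_connected:
  assumes "E \<in> conj" "F \<in> conj"
  shows "\<exists>\<tau>\<in>\<Gamma>. mor_dom \<tau> = F \<and> mor_rng \<tau> = E"
proof -
  obtain g where g: "g \<in> G" "F = g ` L" using assms(2) unfolding conjugate_fields_def by blast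
  obtain h where h: "h \<in> G" "E = h ` L" using assms(1) unfolding conjugate_fields_def by blast
  obtain g' where g': "g' \<in> G" "\<And>x. x \<in> N \<Longrightarrow> g' (g x) = x" "\<And>x. x \<in> N \<Longrightarrow> g (g' x) = x"
    using G_inv[OF g(1)] by blast
  have "compose N h g' ` F = E"
    unfolding g(2) h(2) image_image
    by (rule image_cong) (use L_sub g'(2) G_N[OF g(1)] in \<open>auto simp: compose_def\<close>)
  then have "mor_rng (F, restrict (compose N h g') F) = E" by (simp add: mor_rng_restrict)
  moreover have "(F, restrict (compose N h g') F) \<in> \<Gamma>"
    unfolding \<Gamma>_iff using assms(2) G_comp[OF h(1) g'(1)] by blast
  ultimately show ?thesis by force
qed

lemma G_eval:
  assumes "g \<in> G" "x \<in> N" "set p \<subseteq> K"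
  shows "eval p x \<in> N \<and> g (eval p x) = eval p (g x)"
  using assms(3)
proof (induction p)
  case Nil
  then show ?case using N_props(2) G_zero[OF assms(1)] by simp
next
  case (Cons a p)
  have a: "a \<in> K" "a \<in> N" using Cons.prems K_sub by auto
  have pow: "x [^] n \<in> N \<and> g (x [^] n) = g x [^] n" for n :: nat
    using assms N_props(3,5) by (induction n) (simp_all add: G_simps)
  show ?case
    using Cons a pow[of "length p"] N_props(5,6) assms(1) by (simp add: G_simps)
qed

text \<open>One polynomial over \<open>K\<close> that annihilates x annihilates all its images,
  because the Galois group fixes the coefficients; and it has finitely many roots.\<close>

lemma finite_orbit:
  assumes "F \<in> conj" "x \<in> F"
  shows "finite {mor_map \<gamma> x | \<gamma>. \<gamma> \<in> \<Gamma> \<and> mor_dom \<gamma> = F}"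
proof -
  have x: "x \<in> N" using conj_N[OF assms(1)] assms(2) by blast
  then obtain p where p: "p \<in> carrier (K[X])" "p \<noteq> []" "eval p x = \<zero>"
    using algebraicE[OF subfieldE(1)[OF subfield_K]] algebraic_N N_props(1) by blast
  have pK: "set p \<subseteq> K" using p(1,2) by (simp add: univ_poly_carrier[symmetric] polynomial_def)
  have "is_root p (g x)" if "g \<in> G" for g
    using G_eval[OF that x pK] p(2,3) G_zero[OF that] G_N[OF that x] N_props(1) unfolding is_root_def by auto
  then have "{mor_map \<gamma> x | \<gamma>. \<gamma> \<in> \<Gamma> \<and> mor_dom \<gamma> = F} \<subseteq> {y. is_root p y}"
    using assms(2) unfolding \<Gamma>_iff by auto
  then show ?thesis
    using finite_number_of_roots carrier_polynomial_shell[OF subfieldE(1)[OF subfield_K] p(1)]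
    by (meson finite_subset)
qed

end

theorem theorem47:
  fixes A :: "('a, 'b) ring_scheme" and K L N :: "'a set"
    and \<Gamma> \<Delta> :: "'a mor set" and \<beta> :: "'a mor \<Rightarrow> 'a mor \<Rightarrow> 'a"
  assumes "algebraic_closure A K"
    and "field.separable_field_extension A K L"
    and "field.normal_closure A K L N"
    and "\<Gamma> = field.conjugate_groupoid A K L N"
    and "field.normalized_cocycle A \<Gamma> \<beta>"
    and "wide_subgroupoid \<Delta> \<Gamma>"
    and "\<forall>E\<in>field.conjugate_fields A K L N.
           closedin (krull_topology \<Gamma> E) (carrier (vertex_group \<Delta> E))"
  shows "separable_rng_extension
           (field.object_crossed_product A \<Gamma> \<beta>) (field.object_crossed_product A \<Delta> \<beta>) \<longleftrightarrow>
         (\<exists>E\<in>field.conjugate_fields A K L N.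
            finite (rcosets\<^bsub>vertex_group \<Gamma> E\<^esub> carrier (vertex_group \<Delta> E)))"
proof -
  interpret field A
    using assms(1) by (rule algebraic_closure.axioms(1))
  have normal: "normal_field_extension K N" "L \<subseteq> N"
    using assms(3) unfolding normal_closure_def by simp_all
  have "subfield K A" "subfield N A" "K \<subseteq> N" "\<forall>x\<in>N. (algebraic over K) x"
    using normal(1) unfolding normal_field_extension_def by simp_all
  moreover have "subfield L A"
    using assms(2) unfolding separable_field_extension_def by simp
  ultimately interpret C: conjugate_setting A K L N
    using normal(2) by (intro conjugate_setting.intro field_axioms conjugate_setting_axioms.intro) simp_all
  interpret P: field_groupoid_pair A \<Gamma> \<beta> \<Delta>
    using C.field_groupoid[of \<beta>] assms(4-6)
    by (intro field_groupoid_pair.intro field_groupoid_pair_axioms.intro) simp_all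
  have objects: "mor_id E \<in> \<Gamma> \<longleftrightarrow> E \<in> conjugate_fields K L N" for E
    unfolding assms(4) by (rule C.\<Gamma>_objects)
  show ?thesis
  proof
    assume "separable_rng_extension P.CP P.sub.CP"
    \<comment> \<open>Any object can serve as the starting point of the orbit argument;
      \<open>L\<close> is one of its own conjugates. The object of finite index that comes out may
      be a different one.\<close>
    then show "\<exists>E\<in>conjugate_fields K L N. finite (rcosets\<^bsub>vertex_group \<Gamma> E\<^esub> carrier (vertex_group \<Delta> E))"
      using P.finite_rcosets_if_separable[of L] C.conj_L unfolding objects by blast
  next
    assume "\<exists>E\<in>conjugate_fields K L N. finite (rcosets\<^bsub>vertex_group \<Gamma> E\<^esub> carrier (vertex_group \<Delta> E))"
    then obtain F where F: "F \<in> conjugate_fields K L N"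
      and fin: "finite (rcosets\<^bsub>vertex_group \<Gamma> F\<^esub> carrier (vertex_group \<Delta> F))" by blast
    have "closedin (krull_topology \<Gamma> F) (carrier (vertex_group \<Delta> F))" using assms(7) F by blast
    then obtain B where B: "finite B" "B \<subseteq> F"
      "\<forall>\<gamma>\<in>\<Gamma>. mor_dom \<gamma> = F \<longrightarrow> mor_rng \<gamma> = F \<longrightarrow> (\<forall>x\<in>B. mor_map \<gamma> x = x) \<longrightarrow> \<gamma> \<in> \<Delta>"
      using P.open_if_closed_finite_index[of F, unfolded objects, OF F _ fin] by blast
    interpret O: open_vertex A \<Gamma> \<beta> \<Delta> F B
    proof (intro open_vertex.intro open_vertex_axioms.intro P.field_groupoid_pair_axioms)
      show "mor_id F \<in> \<Gamma>" using F by (simp only: objects)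
      show "\<exists>\<tau>\<in>\<Gamma>. mor_dom \<tau> = F \<and> mor_rng \<tau> = E" if "mor_id E \<in> \<Gamma>" for E
        using C.\<Gamma>_connected[OF _ F, of E] that unfolding objects by (simp only: assms(4))
      show "finite {mor_map \<gamma> x | \<gamma>. \<gamma> \<in> \<Gamma> \<and> mor_dom \<gamma> = F}" if "x \<in> F" for x
        using C.finite_orbit[OF F that] by (simp only: assms(4))
    qed (use B in blast)+
    show "separable_rng_extension P.CP P.sub.CP" by (rule O.separable)
  qed
qed

end
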